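(* For every $\Sigma^1_1$ set $P \subseteq \mathbb{N}$ there exist a finite alphabet $S$ and a cellular automaton $f$ on the full shift $S^{\mathbb{Z}}$ such that $P$ is many-one reducible to the language of the asymptotic set $\mathcal{A}(f)$. In particular, there exists a cellular automaton on a full shift whose asymptotic set has a $\Sigma^1_1$-complete language.
   Context: A cellular automaton on $X = S^{\mathbb{Z}}$ ($S$ finite, product topology) is a continuous map $f: X\to X$ commuting with the shift. The asymptotic set of $f$ is $\mathcal{A}(f) = \bigcup_{x \in X} \bigcap_{n \in \mathbb{N}} \overline{\bigcup_{k \geq n} \{f^k(x)\}}$. The language of a (not necessarily closed) set $Y \subseteq S^{\mathbb{Z}}$ is the set of words $w \in S^*$ with $w = y_{[0,k-1]}$ for some $y \in Y$, $k \in \mathbb{N}$; it is viewed as a subset of $\mathbb{N}$ via a computable bijection $S^* \cong \mathbb{N}$. A set $P \subseteq \mathbb{N}$ is $\Sigma^1_1$ if $w \in P \iff (\exists C \subseteq \mathbb{N})(\forall m \in \mathbb{N})(\exists \ell \in \mathbb{N}) R(C,m,\ell,w)$ for some recursive predicate $R$; it is $\Sigma^1_1$-complete if it is $\Sigma^1_1$ and every $\Sigma^1_1$ set many-one (computably) reduces to it. *)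

theory Defs
  imports "HOL-Analysis.Analysis"
begin

datatype rf =
    Zero
  | Succ
  | Proj nat
  | Orc
  | Comp rf "rf list"
  | Prim rf rf
  | Mn rf

definition arg :: "nat list \<Rightarrow> nat \<Rightarrow> nat" where
  "arg xs i = (if i < length xs then xs ! i else 0)"

inductive reval :: "nat set \<Rightarrow> rf \<Rightarrow> nat list \<Rightarrow> nat \<Rightarrow> bool" for C where
  zero: "reval C Zero xs 0"
| succ: "reval C Succ xs (Suc (arg xs 0))"
| proj: "reval C (Proj i) xs (arg xs i)"
| orc: "reval C Orc xs (if arg xs 0 \<in> C then 1 else 0)"
| comp: "list_all2 (\<lambda>g y. reval C g xs y) gs ys \<Longrightarrow> reval C f ys z \<Longrightarrow> reval C (Comp f gs) xs z"
| prim0: "reval C f xs z \<Longrightarrow> reval C (Prim f g) (0 # xs) z"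
| primS: "reval C (Prim f g) (n # xs) y \<Longrightarrow> reval C g (y # n # xs) z
          \<Longrightarrow> reval C (Prim f g) (Suc n # xs) z"
| mn: "reval C g (y # xs) 0 \<Longrightarrow> (\<forall>z<y. \<exists>v. v \<noteq> 0 \<and> reval C g (z # xs) v)
          \<Longrightarrow> reval C (Mn g) xs y"

definition recursive_pred :: "(nat set \<Rightarrow> nat \<Rightarrow> nat \<Rightarrow> nat \<Rightarrow> bool) \<Rightarrow> bool" where
  "recursive_pred R \<longleftrightarrow> (\<exists>e. \<forall>C m l w. reval C e [m, l, w] (if R C m l w then 1 else 0))"

definition computable :: "(nat \<Rightarrow> nat) \<Rightarrow> bool" where
  "computable g \<longleftrightarrow> (\<exists>e. \<forall>n. reval {} e [n] (g n))"

definition sigma11 :: "nat set \<Rightarrow> bool" where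
  "sigma11 P \<longleftrightarrow> (\<exists>R. recursive_pred R \<and>
     (\<forall>w. w \<in> P \<longleftrightarrow> (\<exists>C. \<forall>m. \<exists>l. R C m l w)))"

definition many_one_reducible :: "nat set \<Rightarrow> nat set \<Rightarrow> bool" where
  "many_one_reducible P Q \<longleftrightarrow> (\<exists>g. computable g \<and> (\<forall>n. n \<in> P \<longleftrightarrow> g n \<in> Q))"

definition sigma11_complete :: "nat set \<Rightarrow> bool" where
  "sigma11_complete Q \<longleftrightarrow> sigma11 Q \<and> (\<forall>P. sigma11 P \<longrightarrow> many_one_reducible P Q)"

text \<open>The alphabet is S = {0..<k} (k \<ge> 1); configurations are maps int \<Rightarrow> nat with values
  in S, carrying the product topology (nat is discrete).\<close>

definition full_shift :: "nat \<Rightarrow> (int \<Rightarrow> nat) set" where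
  "full_shift k = {x. \<forall>i. x i < k}"

definition shift :: "(int \<Rightarrow> nat) \<Rightarrow> (int \<Rightarrow> nat)" where
  "shift x = (\<lambda>i. x (i + 1))"

definition cellular_automaton :: "nat \<Rightarrow> ((int \<Rightarrow> nat) \<Rightarrow> (int \<Rightarrow> nat)) \<Rightarrow> bool" where
  "cellular_automaton k f \<longleftrightarrow> 1 \<le> k \<and> f ` full_shift k \<subseteq> full_shift k \<and>
     continuous_on (full_shift k) f \<and> (\<forall>x \<in> full_shift k. f (shift x) = shift (f x))"

definition asymptotic_set :: "nat \<Rightarrow> ((int \<Rightarrow> nat) \<Rightarrow> (int \<Rightarrow> nat)) \<Rightarrow> (int \<Rightarrow> nat) set" where
  "asymptotic_set k f = (\<Union>x \<in> full_shift k. \<Inter>n. closure {(f ^^ j) x | j. j \<ge> n})"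

definition language :: "(int \<Rightarrow> nat) set \<Rightarrow> nat list set" where
  "language Y = {map (\<lambda>i. y (int i)) [0..<n] | y n. y \<in> Y}"

text \<open>Computable bijection between words over {0..<k} and nat (bijective base-k numeration).\<close>
fun word_code :: "nat \<Rightarrow> nat list \<Rightarrow> nat" where
  "word_code k [] = 0"
| "word_code k (a # w) = Suc a + k * word_code k w"

definition lang_code :: "nat \<Rightarrow> nat list set \<Rightarrow> nat set" where
  "lang_code k L = word_code k ` L"

end

theory Submission
  imports Defs "HOL-Library.Nat_Bijection" "HOL-Library.Countable_Set"
begin

text \<open>
  A \<open>\<Sigma>\<^sup>1\<^sub>1\<close> set can be presented by the question whether some set \<open>T\<close> of numbers satisfies
  \<open>\<forall>m. \<exists>l. \<phi>(T, n, m, l)\<close> for a quantifier-free formula \<open>\<phi>\<close> over pairing and successor; one fixed \<open>\<phi>\<close> is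
  universal, since \<open>T\<close> can contain the evaluations of arbitrary programs and \<open>\<phi>\<close> only checks single
  evaluation rules.

  The cellular automaton simulates a counter machine whose oracle \<open>T\<close> is written in the initial
  configuration. For \<open>M = 1, 2, \<dots>\<close> the machine searches, for every \<open>m \<le> M\<close>, a witness \<open>l\<close>, and after each
  round it displays the input \<open>n\<close> at the origin. The display recurs if and only if all searches succeed.
  Counters are positions of marks, and signals are arranged such that after a bounded time any
  configuration in which the display recurs has carried out a genuine run of the machine with arbitrary
  initial counter values. As every round checks all \<open>m \<le> M\<close> anew, these initial values do not matter.

  Conversely, by compactness a word belongs to the language of the asymptotic set iff it recurs at the
  origin along some orbit, and this is a \<open>\<Sigma>\<^sup>1\<^sub>1\<close> condition.
\<close>

section \<open>Functions computable from an oracle\<close>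

abbreviation pair :: "nat \<Rightarrow> nat \<Rightarrow> nat" where "pair a b \<equiv> prod_encode (a, b)"
abbreviation pair_fst :: "nat \<Rightarrow> nat" where "pair_fst z \<equiv> fst (prod_decode z)"
abbreviation pair_snd :: "nat \<Rightarrow> nat" where "pair_snd z \<equiv> snd (prod_decode z)"

definition oracle_computable :: "nat \<Rightarrow> (nat set \<Rightarrow> nat list \<Rightarrow> nat) \<Rightarrow> bool" where
  "oracle_computable a F \<longleftrightarrow> (\<exists>e. \<forall>C xs. length xs = a \<longrightarrow> reval C e xs (F C xs))"

definition oracle_decidable :: "nat \<Rightarrow> (nat set \<Rightarrow> nat list \<Rightarrow> bool) \<Rightarrow> bool" where
  "oracle_decidable a P \<longleftrightarrow> oracle_computable a (\<lambda>C xs. if P C xs then 1 else 0)"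

named_theorems oracle_computable_intros

lemma arg_eq_nth: "i < length xs \<Longrightarrow> arg xs i = xs ! i"
  by (simp add: arg_def)

lemma oracle_computable_cong:
  assumes "oracle_computable a F" and "\<And>C xs. length xs = a \<Longrightarrow> F C xs = G C xs"
  shows "oracle_computable a G"
  using assms unfolding oracle_computable_def by metis

lemma oracle_computable_compose:
  assumes outer: "oracle_computable (length Gs) F" and inner: "\<forall>G\<in>set Gs. oracle_computable a G"
  shows "oracle_computable a (\<lambda>C xs. F C (map (\<lambda>G. G C xs) Gs))"
proof -
  obtain f where eval_outer: "\<And>C xs. length xs = length Gs \<Longrightarrow> reval C f xs (F C xs)"
    using outer unfolding oracle_computable_def by blast
  obtain h where eval_inner: "\<And>G C xs. G \<in> set Gs \<Longrightarrow> length xs = a \<Longrightarrow> reval C (h G) xs (G C xs)"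
    using inner unfolding oracle_computable_def by metis
  have "reval C (Comp f (map h Gs)) xs (F C (map (\<lambda>G. G C xs) Gs))" if "length xs = a" for C xs
    by (rule reval.comp[where ys = "map (\<lambda>G. G C xs) Gs"])
      (use eval_inner that eval_outer in \<open>auto simp: list_all2_conv_all_nth\<close>)
  then show ?thesis unfolding oracle_computable_def by blast
qed

lemma oracle_computable_compose1:
  assumes "oracle_computable 1 (\<lambda>C xs. F C (xs ! 0))" "oracle_computable a G"
  shows "oracle_computable a (\<lambda>C xs. F C (G C xs))"
  using oracle_computable_compose[of "[G]" "\<lambda>C xs. F C (xs ! 0)" a] assms by simp

lemma oracle_computable_compose2:
  assumes "oracle_computable 2 (\<lambda>C xs. F C (xs ! 0) (xs ! 1))" "oracle_computable a G"
    "oracle_computable a H"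
  shows "oracle_computable a (\<lambda>C xs. F C (G C xs) (H C xs))"
  using oracle_computable_compose[of "[G, H]" "\<lambda>C xs. F C (xs ! 0) (xs ! 1)" a] assms
  by (simp add: numeral_2_eq_2)

lemma oracle_computable_nth [oracle_computable_intros]:
  "i < a \<Longrightarrow> oracle_computable a (\<lambda>C xs. xs ! i)"
  unfolding oracle_computable_def by (metis arg_eq_nth reval.proj)

lemma oracle_computable_Suc [oracle_computable_intros]:
  assumes "oracle_computable a G"
  shows "oracle_computable a (\<lambda>C xs. Suc (G C xs))"
proof (rule oracle_computable_compose1[OF _ assms])
  have "reval C Succ xs (Suc (xs ! 0))" if "length xs = 1" for C xs
    using reval.succ[of C xs] that by (simp add: arg_eq_nth)
  then show "oracle_computable 1 (\<lambda>C xs. Suc (xs ! 0))"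
    unfolding oracle_computable_def by blast
qed

lemma oracle_computable_const [oracle_computable_intros]: "oracle_computable a (\<lambda>C xs. c)"
proof (induction c)
  case 0
  show ?case unfolding oracle_computable_def by (auto intro: reval.zero)
qed (rule oracle_computable_Suc)

lemma oracle_decidable_mem [oracle_computable_intros]:
  assumes "oracle_computable a G"
  shows "oracle_decidable a (\<lambda>C xs. G C xs \<in> C)"
  unfolding oracle_decidable_def
proof (rule oracle_computable_compose1[OF _ assms])
  have "reval C Orc xs (if xs ! 0 \<in> C then 1 else 0)" if "length xs = 1" for C xs
    using reval.orc[of C xs] that by (simp add: arg_eq_nth)
  then show "oracle_computable 1 (\<lambda>C xs. if xs ! 0 \<in> C then 1 else 0)"
    unfolding oracle_computable_def by blast
qed

lemma oracle_computable_primrec: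
  assumes base: "oracle_computable a F" and count: "oracle_computable a N"
    and step: "oracle_computable (Suc (Suc a)) G"
    and H_0: "\<And>C xs. length xs = a \<Longrightarrow> H C xs 0 = F C xs"
    and H_Suc: "\<And>C xs n. length xs = a \<Longrightarrow> H C xs (Suc n) = G C (H C xs n # n # xs)"
  shows "oracle_computable a (\<lambda>C xs. H C xs (N C xs))"
proof -
  obtain f where eval_base: "\<And>C xs. length xs = a \<Longrightarrow> reval C f xs (F C xs)"
    using base unfolding oracle_computable_def by blast
  obtain g where eval_step: "\<And>C xs. length xs = Suc (Suc a) \<Longrightarrow> reval C g xs (G C xs)"
    using step unfolding oracle_computable_def by blast
  have "reval C (Prim f g) (n # xs) (H C xs n)" if "length xs = a" for C xs n
  proof (induction n)
    case 0
    show ?case using eval_base[OF that] H_0[OF that] by (auto intro: reval.prim0)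
  next
    case (Suc n)
    have "reval C g (H C xs n # n # xs) (H C xs (Suc n))"
      unfolding H_Suc[OF that] by (rule eval_step) (simp add: that)
    with Suc show ?case by (rule reval.primS)
  qed
  then have "oracle_computable (Suc a) (\<lambda>C ys. H C (tl ys) (hd ys))"
    unfolding oracle_computable_def
    by (intro exI[of _ "Prim f g"]) (metis length_Suc_conv list.sel(1) list.sel(3))
  then have "oracle_computable (length (N # map (\<lambda>i C xs. xs ! i) [0..<a]))
      (\<lambda>C ys. H C (tl ys) (hd ys))"
    by simp
  from oracle_computable_compose[OF this, of a] count
  have "oracle_computable a (\<lambda>C xs. H C (map (\<lambda>i. xs ! i) [0..<a]) (N C xs))"
    by (auto simp: oracle_computable_nth comp_def)
  then show ?thesis by (rule oracle_computable_cong) (metis map_nth)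
qed

lemma oracle_computable_If [oracle_computable_intros]:
  assumes "oracle_decidable a P" "oracle_computable a F" "oracle_computable a G"
  shows "oracle_computable a (\<lambda>C xs. if P C xs then F C xs else G C xs)"
proof -
  have "oracle_computable 3 (\<lambda>C xs. if xs ! 0 = 0 then xs ! 2 else xs ! 1)"
    by (rule oracle_computable_primrec[where H = "\<lambda>C xs n. if n = 0 then xs ! 2 else xs ! 1"
          and N = "\<lambda>C xs. xs ! 0" and F = "\<lambda>C xs. xs ! 2" and G = "\<lambda>C xs. xs ! 3"])
      (auto intro!: oracle_computable_intros simp: numeral_3_eq_3)
  then have "oracle_computable (length [\<lambda>C xs. if P C xs then 1 else 0, F, G])
      (\<lambda>C xs. if xs ! 0 = 0 then xs ! 2 else xs ! 1)"
    by (simp add: numeral_3_eq_3)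
  from oracle_computable_compose[OF this, of a] assms show ?thesis
    unfolding oracle_decidable_def by (auto elim: oracle_computable_cong simp: numeral_2_eq_2)
qed

lemma oracle_computable_add [oracle_computable_intros]:
  assumes "oracle_computable a G" "oracle_computable a H"
  shows "oracle_computable a (\<lambda>C xs. G C xs + H C xs)"
proof (rule oracle_computable_compose2[OF _ assms])
  show "oracle_computable 2 (\<lambda>C xs. xs ! 0 + xs ! 1)"
    by (rule oracle_computable_primrec[where H = "\<lambda>C xs n. n + xs ! 1" and N = "\<lambda>C xs. xs ! 0"
          and F = "\<lambda>C xs. xs ! 1" and G = "\<lambda>C xs. Suc (xs ! 0)"])
      (auto intro!: oracle_computable_intros)
qed

lemma oracle_computable_diff [oracle_computable_intros]:
  assumes "oracle_computable a G" "oracle_computable a H"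
  shows "oracle_computable a (\<lambda>C xs. G C xs - H C xs)"
proof (rule oracle_computable_compose2[OF _ assms])
  have pred: "oracle_computable 1 (\<lambda>C xs. xs ! 0 - Suc 0)"
    by (rule oracle_computable_primrec[where H = "\<lambda>C xs n. n - Suc 0" and N = "\<lambda>C xs. xs ! 0"
          and F = "\<lambda>C xs. 0" and G = "\<lambda>C xs. xs ! 1"])
      (auto intro: oracle_computable_intros)
  show "oracle_computable 2 (\<lambda>C xs. xs ! 0 - xs ! 1)"
    by (rule oracle_computable_primrec[where H = "\<lambda>C xs n. xs ! 0 - n" and N = "\<lambda>C xs. xs ! 1"
          and F = "\<lambda>C xs. xs ! 0" and G = "\<lambda>C xs. xs ! 0 - Suc 0"])
      (auto intro!: oracle_computable_intros
        oracle_computable_compose1[where F = "\<lambda>C n. n - Suc 0", OF pred])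
qed

lemma oracle_computable_mult [oracle_computable_intros]:
  assumes "oracle_computable a G" "oracle_computable a H"
  shows "oracle_computable a (\<lambda>C xs. G C xs * H C xs)"
proof (rule oracle_computable_compose2[OF _ assms])
  show "oracle_computable 2 (\<lambda>C xs. xs ! 0 * xs ! 1)"
    by (rule oracle_computable_primrec[where H = "\<lambda>C xs n. n * xs ! 1" and N = "\<lambda>C xs. xs ! 0"
          and F = "\<lambda>C xs. 0" and G = "\<lambda>C xs. xs ! 3 + xs ! 0"])
      (auto intro!: oracle_computable_intros simp: numeral_3_eq_3)
qed

lemma oracle_computable_sum:
  assumes summand: "oracle_computable (Suc a) F" and count: "oracle_computable a N"
  shows "oracle_computable a (\<lambda>C xs. \<Sum>i<N C xs. F C (i # xs))"
proof (rule oracle_computable_primrec[where H = "\<lambda>C xs n. \<Sum>i<n. F C (i # xs)" and N = N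
      and F = "\<lambda>C xs. 0" and G = "\<lambda>C xs. xs ! 0 + F C (tl xs)"])
  let ?tail = "map (\<lambda>i C xs. xs ! i) [1..<Suc (Suc a)]"
  have length_tail: "length ?tail = Suc a" by simp
  have tail: "map (\<lambda>G. G C xs) ?tail = tl xs"
    if "length xs = Suc (Suc a)" for C and xs :: "nat list"
    by (rule nth_equalityI) (use that in \<open>auto simp del: upt_Suc simp: nth_tl\<close>)
  have "oracle_computable (Suc (Suc a)) (\<lambda>C xs. F C (map (\<lambda>G. G C xs) ?tail))"
    by (rule oracle_computable_compose)
      (use summand length_tail in \<open>auto intro!: oracle_computable_intros\<close>)
  then have "oracle_computable (Suc (Suc a)) (\<lambda>C xs. F C (tl xs))"
    by (rule oracle_computable_cong) (simp only: tail)
  then show "oracle_computable (Suc (Suc a)) (\<lambda>C xs. xs ! 0 + F C (tl xs))"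
    by (intro oracle_computable_intros) simp
qed (use count in \<open>auto intro: oracle_computable_intros\<close>)

lemma oracle_computable_power [oracle_computable_intros]:
  assumes "oracle_computable a G" "oracle_computable a H"
  shows "oracle_computable a (\<lambda>C xs. G C xs ^ H C xs)"
proof (rule oracle_computable_compose2[OF _ assms])
  show "oracle_computable 2 (\<lambda>C xs. xs ! 0 ^ xs ! 1)"
    by (rule oracle_computable_primrec[where H = "\<lambda>C xs n. xs ! 0 ^ n" and N = "\<lambda>C xs. xs ! 1"
          and F = "\<lambda>C xs. 1" and G = "\<lambda>C xs. xs ! 2 * xs ! 0"])
      (auto intro!: oracle_computable_intros)
qed

lemma oracle_decidable_eq [oracle_computable_intros]:
  assumes "oracle_computable a G" "oracle_computable a H"
  shows "oracle_decidable a (\<lambda>C xs. G C xs = H C xs)"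
proof -
  have "oracle_computable a (\<lambda>C xs. 1 - ((G C xs - H C xs) + (H C xs - G C xs)))"
    using assms by (intro oracle_computable_intros)
  then show ?thesis
    unfolding oracle_decidable_def by (rule oracle_computable_cong) auto
qed

lemma oracle_decidable_le [oracle_computable_intros]:
  assumes "oracle_computable a G" "oracle_computable a H"
  shows "oracle_decidable a (\<lambda>C xs. G C xs \<le> H C xs)"
proof -
  have "oracle_computable a (\<lambda>C xs. 1 - (G C xs - H C xs))"
    using assms by (intro oracle_computable_intros)
  then show ?thesis
    unfolding oracle_decidable_def by (rule oracle_computable_cong) auto
qed

lemma oracle_decidable_conj [oracle_computable_intros]:
  assumes "oracle_decidable a P" "oracle_decidable a Q"
  shows "oracle_decidable a (\<lambda>C xs. P C xs \<and> Q C xs)"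
proof -
  have "oracle_computable a (\<lambda>C xs. if P C xs then if Q C xs then 1 else 0 else 0)"
    using assms by (intro oracle_computable_intros)
  then show ?thesis
    unfolding oracle_decidable_def by (rule oracle_computable_cong) auto
qed

lemma oracle_computable_bounded_cases:
  assumes "oracle_computable a F" "\<And>C xs. F C xs < k"
    and "\<And>j. j < k \<Longrightarrow> oracle_computable a (G j)"
  shows "oracle_computable a (\<lambda>C xs. G (F C xs) C xs)"
proof -
  have "oracle_computable a (\<lambda>C xs. if Suc (F C xs) \<le> n then G (F C xs) C xs else 0)"
    if "n \<le> k" for n
    using that
  proof (induction n)
    case 0
    show ?case by (simp add: oracle_computable_const)
  next
    case (Suc n)
    then have "oracle_computable a (\<lambda>C xs. if F C xs = n then G n C xs
        else if Suc (F C xs) \<le> n then G (F C xs) C xs else 0)"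
      by (intro oracle_computable_If[OF oracle_decidable_eq[OF assms(1) oracle_computable_const]])
        (use assms(3) in auto)
    then show ?case by (rule oracle_computable_cong) auto
  qed
  from this[of k] show ?thesis
    using assms(2) by (simp add: Suc_le_eq)
qed

lemma oracle_computable_triangle [oracle_computable_intros]:
  assumes "oracle_computable a G"
  shows "oracle_computable a (\<lambda>C xs. triangle (G C xs))"
proof (rule oracle_computable_compose1[OF _ assms])
  show "oracle_computable 1 (\<lambda>C xs. triangle (xs ! 0))"
    by (rule oracle_computable_primrec[where H = "\<lambda>C xs n. triangle n" and N = "\<lambda>C xs. xs ! 0"
          and F = "\<lambda>C xs. 0" and G = "\<lambda>C xs. xs ! 0 + Suc (xs ! 1)"])
      (auto intro!: oracle_computable_intros)
qed

lemma oracle_computable_pair [oracle_computable_intros]: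
  assumes "oracle_computable a G" "oracle_computable a H"
  shows "oracle_computable a (\<lambda>C xs. pair (G C xs) (H C xs))"
  unfolding prod_encode_def using assms by (auto intro!: oracle_computable_intros)

lemma prod_decode_Suc:
  "prod_decode (Suc n) =
    (if pair_snd n = 0 then (0, Suc (pair_fst n)) else (Suc (pair_fst n), pair_snd n - 1))"
proof -
  obtain x y where decode: "prod_decode n = (x, y)" by fastforce
  then have encode: "n = prod_encode (x, y)" by (metis prod_decode_inverse)
  have "Suc n = prod_encode (if y = 0 then (0, Suc x) else (Suc x, y - 1))"
    unfolding encode by (cases y) (auto simp: prod_encode_def)
  then have "prod_decode (Suc n) = (if y = 0 then (0, Suc x) else (Suc x, y - 1))"
    by (metis prod_encode_inverse)
  then show ?thesis by (simp add: decode)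
qed

lemma prod_decode_0: "prod_decode 0 = (0, 0)"
  by (simp add: prod_decode_def prod_decode_aux.simps)

lemma triangle_pair_components: "triangle (pair_fst z + pair_snd z) + pair_fst z = z"
proof -
  have "prod_encode (pair_fst z, pair_snd z) = z" by simp
  then show ?thesis by (simp only: prod_encode_def case_prod_conv)
qed

lemma oracle_computable_pair_components:
  assumes "oracle_computable a G"
  shows oracle_computable_pair_fst [oracle_computable_intros]:
      "oracle_computable a (\<lambda>C xs. pair_fst (G C xs))"
    and oracle_computable_pair_snd [oracle_computable_intros]:
      "oracle_computable a (\<lambda>C xs. pair_snd (G C xs))"
proof -
  let ?diagonal = "\<lambda>z. pair_fst z + pair_snd z"
  have diagonal_Suc: "?diagonal (Suc z) =
      (if triangle (?diagonal z) + ?diagonal z = z then Suc (?diagonal z) else ?diagonal z)" for z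
    using triangle_pair_components[of z] by (simp add: prod_decode_Suc)
  have "oracle_computable 1 (\<lambda>C xs. ?diagonal (xs ! 0))"
    by (rule oracle_computable_primrec[where H = "\<lambda>C xs. ?diagonal" and N = "\<lambda>C xs. xs ! 0"
          and F = "\<lambda>C xs. 0"
          and G = "\<lambda>C xs. if triangle (xs ! 0) + xs ! 0 = xs ! 1 then Suc (xs ! 0) else xs ! 0"])
      (auto intro!: oracle_computable_intros simp: diagonal_Suc prod_decode_0)
  then have diagonal: "oracle_computable a (\<lambda>C xs. ?diagonal (G C xs))"
    by (rule oracle_computable_compose1[OF _ assms])
  have "pair_fst z = z - triangle (?diagonal z)" for z
    using triangle_pair_components[of z] by linarith
  moreover have "oracle_computable a (\<lambda>C xs. G C xs - triangle (?diagonal (G C xs)))"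
    using assms diagonal by (intro oracle_computable_diff oracle_computable_triangle)
  ultimately show fst_computable: "oracle_computable a (\<lambda>C xs. pair_fst (G C xs))" by simp
  have "oracle_computable a (\<lambda>C xs. ?diagonal (G C xs) - pair_fst (G C xs))"
    using diagonal fst_computable by (rule oracle_computable_diff)
  then show "oracle_computable a (\<lambda>C xs. pair_snd (G C xs))"
    by (rule oracle_computable_cong) simp
qed

lemma word_code_conv_sum: "word_code k w = (\<Sum>i<length w. Suc (w ! i) * k ^ i)"
proof (induction w)
  case (Cons a w)
  have "(\<Sum>i<length (a # w). Suc ((a # w) ! i) * k ^ i) =
      Suc a + k * (\<Sum>i<length w. Suc (w ! i) * k ^ i)"
    by (simp only: length_Cons sum.lessThan_Suc_shift) (simp add: sum_distrib_left algebra_simps)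
  with Cons show ?case by simp
qed simp

lemma oracle_computable_word_code:
  assumes "oracle_computable (Suc a) F" and "oracle_computable a N"
  shows "oracle_computable a (\<lambda>C xs. word_code k (map (\<lambda>i. F C (i # xs)) [0..<N C xs]))"
proof -
  have "oracle_computable (Suc a) (\<lambda>C xs. Suc (F C xs) * k ^ (xs ! 0))"
    using assms(1) by (intro oracle_computable_intros) auto
  from oracle_computable_sum[OF this assms(2)] show ?thesis
    by (rule oracle_computable_cong) (simp add: word_code_conv_sum)
qed

lemma computable_if_oracle_computable:
  "oracle_computable 1 (\<lambda>C xs. g (xs ! 0)) \<Longrightarrow> computable g"
  unfolding oracle_computable_def computable_def
  by (metis One_nat_def length_Cons list.size(3) nth_Cons_0)

lemma recursive_pred_if_oracle_decidable:
  assumes "oracle_decidable 3 (\<lambda>C xs. R C (xs ! 0) (xs ! 1) (xs ! 2))"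
  shows "recursive_pred R"
proof -
  obtain e where decides: "\<And>C xs. length xs = 3 \<Longrightarrow>
      reval C e xs (if R C (xs ! 0) (xs ! 1) (xs ! 2) then 1 else 0)"
    using assms unfolding oracle_decidable_def oracle_computable_def by blast
  have "reval C e [m, l, w] (if R C m l w then 1 else 0)" for C m l w
    using decides[of "[m, l, w]" C] by (simp add: numeral_2_eq_2)
  then show ?thesis unfolding recursive_pred_def by blast
qed

section \<open>Languages of asymptotic sets\<close>

definition recurs :: "('a \<Rightarrow> bool) \<Rightarrow> ('a \<Rightarrow> 'a) \<Rightarrow> 'a \<Rightarrow> bool" where
  "recurs P f x \<longleftrightarrow> (\<forall>n. \<exists>t\<ge>n. P ((f ^^ t) x))"

definition has_prefix :: "'a list \<Rightarrow> (nat \<Rightarrow> 'a) \<Rightarrow> bool" where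
  "has_prefix w z \<longleftrightarrow> (\<forall>i<length w. z i = w ! i)"

definition right_half :: "(int \<Rightarrow> 'a) \<Rightarrow> nat \<Rightarrow> 'a" where
  "right_half y = (\<lambda>j. y (int j))"

lemma funpow_add_apply: "(f ^^ (m + n)) x = (f ^^ m) ((f ^^ n) x)"
  by (simp add: funpow_add)

lemma recurs_funpow: "recurs P f ((f ^^ k) x) \<longleftrightarrow> recurs P f x"
proof -
  have "(\<exists>\<^sub>F t in sequentially. P ((f ^^ (t + k)) x)) \<longleftrightarrow> (\<exists>\<^sub>F t in sequentially. P ((f ^^ t) x))"
    unfolding frequently_def
    by (subst eventually_sequentially_seg[where P = "\<lambda>t. \<not> P ((f ^^ t) x)"]) (rule refl)
  then show ?thesis
    by (simp add: recurs_def frequently_sequentially funpow_add_apply)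
qed

lemma recurs_mono: "recurs P f x \<Longrightarrow> (\<And>y. P y \<Longrightarrow> Q y) \<Longrightarrow> recurs Q f x"
  unfolding recurs_def by blast

lemma recursE:
  assumes "recurs P f x"
  obtains t where "n \<le> t" "P ((f ^^ t) x)"
  using assms unfolding recurs_def by blast

lemma has_prefix_iff_map: "has_prefix w z \<longleftrightarrow> map z [0..<length w] = w"
  unfolding has_prefix_def list_eq_iff_nth_eq[of _ w] by simp

lemma mem_language_iff: "w \<in> language Y \<longleftrightarrow> (\<exists>y\<in>Y. has_prefix w (right_half y))"
proof
  assume "w \<in> language Y"
  then show "\<exists>y\<in>Y. has_prefix w (right_half y)"
    by (auto simp: language_def has_prefix_def right_half_def)
next
  assume "\<exists>y\<in>Y. has_prefix w (right_half y)"
  then obtain y where "y \<in> Y" "has_prefix w (right_half y)" ..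
  then have "w = map (\<lambda>i. y (int i)) [0..<length w] \<and> y \<in> Y"
    by (simp add: has_prefix_iff_map right_half_def)
  then show "w \<in> language Y" unfolding language_def mem_Collect_eq by (intro exI)
qed

lemma omega_limit_meets_clopen_iff:
  fixes f :: "'a::topological_space \<Rightarrow> 'a"
  assumes invariant: "compact K" "f ` K \<subseteq> K" and clopen: "open U" "closed U" and start: "x \<in> K"
  shows "(\<Inter>n. closure {(f ^^ j) x | j. j \<ge> n}) \<inter> U \<noteq> {} \<longleftrightarrow> recurs (\<lambda>y. y \<in> U) f x"
proof
  assume "(\<Inter>n. closure {(f ^^ j) x | j. j \<ge> n}) \<inter> U \<noteq> {}"
  then obtain y where limit: "y \<in> U" "\<And>n. y \<in> closure {(f ^^ j) x | j. j \<ge> n}" by blast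
  have "\<exists>j\<ge>n. (f ^^ j) x \<in> U" for n
    using open_Int_closure_eq_empty[OF clopen(1), of "{(f ^^ j) x | j. j \<ge> n}"]
      limit(1) limit(2)[of n] by blast
  then show "recurs (\<lambda>y. y \<in> U) f x" by (simp add: recurs_def)
next
  assume recurs: "recurs (\<lambda>y. y \<in> U) f x"
  define B where "B n = closure {(f ^^ j) x | j. j \<ge> n \<and> (f ^^ j) x \<in> U}" for n
  have orbit: "(f ^^ j) x \<in> K" for j using start invariant(2) by (induction j) auto
  have "K \<inter> \<Inter> (B ` UNIV) \<noteq> {}"
  proof (rule compact_imp_fip_image[OF invariant(1)])
    show "closed (B n)" for n by (simp add: B_def)
    fix I :: "nat set" assume "finite I"
    then obtain b where bound: "\<And>i. i \<in> I \<Longrightarrow> i \<le> b" using finite_nat_set_iff_bounded_le by auto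
    obtain j where visit: "b \<le> j" "(f ^^ j) x \<in> U" using recurs by (rule recursE)
    have "(f ^^ j) x \<in> B i" if "i \<in> I" for i
      unfolding B_def using visit bound[OF that] by (intro closure_subset[THEN subsetD]) auto
    then show "K \<inter> \<Inter> (B ` I) \<noteq> {}" using orbit by blast
  qed
  then obtain y where limit: "\<And>n. y \<in> B n" by blast
  have "B n \<subseteq> closure {(f ^^ j) x | j. j \<ge> n}" for n
    unfolding B_def by (rule closure_mono) auto
  moreover have "B 0 \<subseteq> U"
    unfolding B_def by (rule closure_minimal) (auto simp: clopen(2))
  ultimately show "(\<Inter>n. closure {(f ^^ j) x | j. j \<ge> n}) \<inter> U \<noteq> {}" using limit by blast
qed

lemma compact_full_shift: "compact (full_shift k)"
proof -
  have "compactin (product_topology (\<lambda>i::int. euclidean :: nat topology) UNIV)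
      (PiE UNIV (\<lambda>i. {..<k}))"
    by (subst compactin_PiE) (auto simp: finite_imp_compact)
  moreover have "PiE UNIV (\<lambda>i::int. {..<k}) = full_shift k"
    by (auto simp: full_shift_def PiE_def Pi_def)
  ultimately show ?thesis by (simp add: euclidean_product_topology)
qed

lemma language_asymptotic_set_iff:
  assumes stable: "f ` full_shift k \<subseteq> full_shift k"
  shows "w \<in> language (asymptotic_set k f) \<longleftrightarrow>
    (\<exists>x\<in>full_shift k. recurs (\<lambda>y. has_prefix w (right_half y)) f x)"
proof -
  define U where "U = {y :: int \<Rightarrow> nat. has_prefix w (right_half y)}"
  have cylinder: "U = (\<Inter>i\<in>{..<length w}. (\<lambda>y. y (int i)) -` {w ! i})"
    by (auto simp: U_def has_prefix_def right_half_def)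
  have "open U" unfolding cylinder by (intro open_INT ballI open_vimage) (auto simp: open_discrete)
  have "closed U" unfolding cylinder by (intro closed_INT ballI closed_vimage) auto
  have "w \<in> language (asymptotic_set k f) \<longleftrightarrow> asymptotic_set k f \<inter> U \<noteq> {}"
    by (auto simp: mem_language_iff U_def)
  also have "\<dots> \<longleftrightarrow> (\<exists>x\<in>full_shift k. recurs (\<lambda>y. y \<in> U) f x)"
    using omega_limit_meets_clopen_iff[OF compact_full_shift stable \<open>open U\<close> \<open>closed U\<close>]
    unfolding asymptotic_set_def by blast
  finally show ?thesis by (simp add: U_def)
qed

lemma inj_on_word_code: "inj_on (word_code k) (lists {..<k})"
proof (rule inj_onI)
  fix v w assume "v \<in> lists {..<k}" "w \<in> lists {..<k}" "word_code k v = word_code k w"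
  then show "v = w"
  proof (induction v arbitrary: w)
    case Nil
    then show ?case by (cases w) auto
  next
    case (Cons a v)
    then obtain b w' where w_Cons: "w = b # w'" by (cases w) auto
    with Cons.hyps Cons.prems have codes_eq: "a + k * word_code k v = b + k * word_code k w'"
      and "a < k" "b < k" by auto
    from arg_cong[OF codes_eq, of "\<lambda>n. n mod k"] \<open>a < k\<close> \<open>b < k\<close> have "a = b" by simp
    with codes_eq \<open>a < k\<close> have "word_code k v = word_code k w'" by simp
    moreover have "w' \<in> lists {..<k}" using Cons.prems w_Cons by simp
    ultimately show ?case using Cons.IH w_Cons \<open>a = b\<close> by blast
  qed
qed

lemma funpow_full_shift: "f ` full_shift k \<subseteq> full_shift k \<Longrightarrow> x \<in> full_shift k \<Longrightarrow> (f ^^ t) x i < k"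
  by (induction t arbitrary: x)
    (auto simp: full_shift_def simp del: funpow.simps(2) simp add: funpow_Suc_right)

lemma language_asymptotic_set_subset:
  assumes stable: "f ` full_shift k \<subseteq> full_shift k"
  shows "language (asymptotic_set k f) \<subseteq> lists {..<k}"
proof
  fix w assume "w \<in> language (asymptotic_set k f)"
  then obtain x where "x \<in> full_shift k" "recurs (\<lambda>y. has_prefix w (right_half y)) f x"
    using language_asymptotic_set_iff[OF stable] by blast
  then obtain t where "has_prefix w (right_half ((f ^^ t) x))" by (blast elim: recursE)
  then have "w ! i < k" if "i < length w" for i
    using funpow_full_shift[OF stable \<open>x \<in> full_shift k\<close>] that
    by (metis has_prefix_def right_half_def)
  then show "w \<in> lists {..<k}" by (auto simp: in_set_conv_nth)
qed

lemma word_code_mem_lang_code_iff: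
  assumes "L \<subseteq> lists {..<k}" "w \<in> lists {..<k}"
  shows "word_code k w \<in> lang_code k L \<longleftrightarrow> w \<in> L"
  unfolding lang_code_def using inj_on_image_mem_iff[OF inj_on_word_code assms(2,1)] .

lemma lang_code_asymptotic_set_iff:
  assumes stable: "f ` full_shift k \<subseteq> full_shift k"
  shows "N \<in> lang_code k (language (asymptotic_set k f)) \<longleftrightarrow>
    (\<exists>x\<in>full_shift k. \<forall>m. \<exists>t\<ge>m. \<exists>n. N = word_code k (map (right_half ((f ^^ t) x)) [0..<n]))"
    (is "_ \<longleftrightarrow> (\<exists>x\<in>_. ?recurring x)")
proof
  assume "N \<in> lang_code k (language (asymptotic_set k f))"
  then obtain w x where "N = word_code k w" "x \<in> full_shift k"
    "recurs (\<lambda>y. has_prefix w (right_half y)) f x"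
    unfolding lang_code_def using language_asymptotic_set_iff[OF stable] by blast
  then show "\<exists>x\<in>full_shift k. ?recurring x"
    by (metis has_prefix_iff_map recurs_def)
next
  assume "\<exists>x\<in>full_shift k. ?recurring x"
  then obtain x where recurring: "x \<in> full_shift k" "?recurring x" by blast
  define word where "word t n = map (right_half ((f ^^ t) x)) [0..<n]" for t n
  have word: "word t n \<in> lists {..<k}" for t n
    using funpow_full_shift[OF stable recurring(1)] by (auto simp: word_def right_half_def)
  obtain t n where code: "N = word_code k (word t n)" using recurring(2) unfolding word_def by blast
  have "\<exists>t'\<ge>m. has_prefix (word t n) (right_half ((f ^^ t') x))" for m
  proof -
    obtain t' n' where "t' \<ge> m" "N = word_code k (word t' n')"
      using recurring(2) unfolding word_def by blast
    then have "word t' n' = word t n" using code inj_onD[OF inj_on_word_code _ word word] by metis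
    then show ?thesis
      using \<open>t' \<ge> m\<close> by (metis has_prefix_iff_map word_def length_map length_upt minus_nat.diff_0)
  qed
  then have "word t n \<in> language (asymptotic_set k f)"
    using language_asymptotic_set_iff[OF stable] recurring(1) unfolding recurs_def by blast
  then show "N \<in> lang_code k (language (asymptotic_set k f))" by (simp add: code lang_code_def)
qed

section \<open>Cellular automata of radius 1\<close>

definition radius1 :: "('a \<Rightarrow> 'a \<Rightarrow> 'a \<Rightarrow> 'a) \<Rightarrow> (int \<Rightarrow> 'a) \<Rightarrow> int \<Rightarrow> 'a" where
  "radius1 \<rho> x i = \<rho> (x (i - 1)) (x i) (x (i + 1))"

lemma funpow_radius1_Suc: "(radius1 \<rho> ^^ Suc t) x i =
    \<rho> ((radius1 \<rho> ^^ t) x (i - 1)) ((radius1 \<rho> ^^ t) x i) ((radius1 \<rho> ^^ t) x (i + 1))"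
  by (simp add: radius1_def)

lemma int_diff_Suc:
  "int u - int (Suc v) = int u - int v - 1"
  "int (Suc u) - int v = int u - int v + 1"
  by auto

locale numbered_local_rule =
  fixes k :: nat and \<rho> :: "nat \<Rightarrow> nat \<Rightarrow> nat \<Rightarrow> nat"
  assumes symbols_pos: "0 < k"
    and rule_less: "a < k \<Longrightarrow> b < k \<Longrightarrow> c < k \<Longrightarrow> \<rho> a b c < k"
begin

lemma radius1_full_shift: "radius1 \<rho> ` full_shift k \<subseteq> full_shift k"
  using rule_less by (auto simp: full_shift_def radius1_def)

lemma cellular_automaton_radius1: "cellular_automaton k (radius1 \<rho>)"
proof -
  have "continuous_on (full_shift k) (\<lambda>x. radius1 \<rho> x i)" for i
    unfolding continuous_on_def tendsto_discrete
  proof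
    fix x assume "x \<in> full_shift k"
    have "\<forall>\<^sub>F y in at x within full_shift k. y j = x j" for j
      using continuous_on_subset[OF continuous_on_product_coordinates subset_UNIV,
          of "full_shift k" j] \<open>x \<in> full_shift k\<close>
      by (auto simp: continuous_on_def tendsto_discrete)
    then have "\<forall>\<^sub>F y in at x within full_shift k. y (i - 1) = x (i - 1) \<and> y i = x i \<and>
        y (i + 1) = x (i + 1)"
      by (intro eventually_conj)
    then show "\<forall>\<^sub>F y in at x within full_shift k. radius1 \<rho> y i = radius1 \<rho> x i"
      by (rule eventually_mono) (simp add: radius1_def)
  qed
  then have "continuous_on (full_shift k) (radius1 \<rho>)"
    by (rule continuous_on_coordinatewise_then_product)
  then show ?thesis
    using symbols_pos radius1_full_shift unfolding cellular_automaton_def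
    by (auto simp: radius1_def shift_def algebra_simps)
qed

end

text \<open>Guessing the whole space-time diagram makes the dynamics a local condition: the oracle \<open>C\<close>
  records the symbol at time \<open>t\<close> and position \<open>u - v\<close> by the number of \<open>j\<close> with
  \<open>pair (pair t (pair u v)) j \<in> C\<close>, capped so that every oracle records a symbol below \<open>k\<close>.\<close>

definition recorded_symbol :: "nat \<Rightarrow> nat set \<Rightarrow> nat \<Rightarrow> nat" where
  "recorded_symbol k C z = (\<Sum>j<k - 1. if pair z j \<in> C then 1 else 0)"

definition diagram :: "nat \<Rightarrow> nat set \<Rightarrow> nat \<Rightarrow> nat \<Rightarrow> nat \<Rightarrow> nat" where
  "diagram k C t u v = recorded_symbol k C (pair t (pair u v))"

definition consistent_at :: "nat \<Rightarrow> (nat \<Rightarrow> nat \<Rightarrow> nat \<Rightarrow> nat) \<Rightarrow> nat set \<Rightarrow> nat \<Rightarrow> nat \<Rightarrow> nat \<Rightarrow> bool" where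
  "consistent_at k \<rho> C t u v \<longleftrightarrow> diagram k C t (Suc u) (Suc v) = diagram k C t u v \<and>
    diagram k C (Suc t) u v = \<rho> (diagram k C t u (Suc v)) (diagram k C t u v)
      (diagram k C t (Suc u) v)"

definition language_matrix :: "nat \<Rightarrow> (nat \<Rightarrow> nat \<Rightarrow> nat \<Rightarrow> nat) \<Rightarrow> nat set \<Rightarrow> nat \<Rightarrow> nat \<Rightarrow> nat \<Rightarrow> bool"
  where
  "language_matrix k \<rho> C m l N \<longleftrightarrow>
    consistent_at k \<rho> C (pair_fst m) (pair_fst (pair_snd m)) (pair_snd (pair_snd m)) \<and>
    m \<le> pair_fst l \<and> N = word_code k (map (\<lambda>i. diagram k C (pair_fst l) i 0) [0..<pair_snd l])"

lemma recorded_symbol_less: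
  assumes "0 < k"
  shows "recorded_symbol k C z < k"
proof -
  have "recorded_symbol k C z \<le> (\<Sum>j<k - 1. 1)"
    unfolding recorded_symbol_def by (rule sum_mono) simp
  with assms show ?thesis by simp
qed

lemma ex_recorded_symbols:
  assumes "\<And>z. Y z < k"
  shows "\<exists>C. \<forall>z. recorded_symbol k C z = Y z"
proof (intro exI allI)
  fix z
  let ?C = "{pair z j | z j. j < Y z}"
  have "recorded_symbol k ?C z = (\<Sum>j<k - 1. if j < Y z then 1 else 0)"
    by (simp add: recorded_symbol_def)
  also have "\<dots> = card {j \<in> {..<k - 1}. j < Y z}" by (simp add: sum.inter_filter[symmetric])
  also have "{j \<in> {..<k - 1}. j < Y z} = {..<Y z}" using assms[of z] by auto
  finally show "recorded_symbol k ?C z = Y z" by simp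
qed

lemma oracle_computable_diagram:
  assumes "oracle_computable a T" "oracle_computable a U" "oracle_computable a V"
  shows "oracle_computable a (\<lambda>C xs. diagram k C (T C xs) (U C xs) (V C xs))"
proof -
  have "oracle_computable 1
      (\<lambda>C xs. \<Sum>i<k - 1. (\<lambda>C ys. if pair (ys ! 1) (ys ! 0) \<in> C then 1 else 0) C (i # xs))"
    by (rule oracle_computable_sum) (auto intro!: oracle_computable_intros)
  then have "oracle_computable 1 (\<lambda>C xs. recorded_symbol k C (xs ! 0))"
    by (simp add: recorded_symbol_def)
  from oracle_computable_compose1[OF this] show ?thesis
    unfolding diagram_def using assms by (blast intro: oracle_computable_pair)
qed

lemma recursive_pred_language_matrix:
  assumes "0 < k"
  shows "recursive_pred (language_matrix k \<rho>)"
proof (rule recursive_pred_if_oracle_decidable)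
  have bounded: "diagram k C t u v < k" for C t u v
    using recorded_symbol_less[OF assms] by (simp add: diagram_def)
  have rule: "oracle_computable a (\<lambda>C xs. \<rho> (F C xs) (G C xs) (H C xs))"
    if "oracle_computable a F" "oracle_computable a G" "oracle_computable a H"
      "\<And>C xs. F C xs < k" "\<And>C xs. G C xs < k" "\<And>C xs. H C xs < k" for a F G H
  proof -
    have "oracle_computable a (\<lambda>C xs. \<rho> i j (H C xs))" for i j
      by (rule oracle_computable_bounded_cases[where G = "\<lambda>n C xs. \<rho> i j n",
            OF that(3,6) oracle_computable_const])
    then have "oracle_computable a (\<lambda>C xs. \<rho> i (G C xs) (H C xs))" for i
      by (rule oracle_computable_bounded_cases[where G = "\<lambda>n C xs. \<rho> i n (H C xs)", OF that(2,5)])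
    then show ?thesis
      by (rule oracle_computable_bounded_cases[where G = "\<lambda>n C xs. \<rho> n (G C xs) (H C xs)",
        OF that(1,4)])
  qed
  have "oracle_computable 3 (\<lambda>C xs. word_code k
      (map (\<lambda>i. (\<lambda>C ys. diagram k C (pair_fst (ys ! 2)) (ys ! 0) 0) C (i # xs))
        [0..<pair_snd (xs ! 1)]))"
    by (intro oracle_computable_word_code oracle_computable_diagram oracle_computable_intros)
      simp_all
  then have word: "oracle_computable 3
      (\<lambda>C xs. word_code k (map (\<lambda>i. diagram k C (pair_fst (xs ! 1)) i 0) [0..<pair_snd (xs ! 1)]))"
    by simp
  have "oracle_computable 3 (\<lambda>C xs. xs ! 0)" "oracle_computable 3 (\<lambda>C xs. xs ! 1)"
    "oracle_computable 3 (\<lambda>C xs. xs ! 2)"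
    by (auto intro: oracle_computable_intros)
  then show "oracle_decidable 3 (\<lambda>C xs. language_matrix k \<rho> C (xs ! 0) (xs ! 1) (xs ! 2))"
    unfolding language_matrix_def consistent_at_def
    by (intro oracle_decidable_conj oracle_decidable_eq oracle_decidable_le rule bounded word
        oracle_computable_diagram oracle_computable_pair_fst oracle_computable_pair_snd
        oracle_computable_Suc)
qed

context numbered_local_rule
begin

lemma diagram_eq_orbit:
  assumes "\<And>t u v. consistent_at k \<rho> C t u v"
  defines "x \<equiv> \<lambda>i. diagram k C 0 (nat i) (nat (- i))"
  shows "diagram k C t u v = (radius1 \<rho> ^^ t) x (int u - int v)"
proof (induction t arbitrary: u v)
  case 0
  have diagonal: "diagram k C 0 (u + d) (v + d) = diagram k C 0 u v" for u v d
    by (induction d) (use assms(1) in \<open>auto simp: consistent_at_def\<close>)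
  have "nat (int u - int v) + min u v = u" "nat (- (int u - int v)) + min u v = v" by auto
  then show ?case
    using diagonal[of "nat (int u - int v)" "min u v" "nat (- (int u - int v))"]
    by (simp add: x_def)
next
  case (Suc t)
  have "diagram k C (Suc t) u v =
      \<rho> (diagram k C t u (Suc v)) (diagram k C t u v) (diagram k C t (Suc u) v)"
    using assms(1)[of t u v] by (simp add: consistent_at_def)
  also have "\<dots> = (radius1 \<rho> ^^ Suc t) x (int u - int v)"
    by (simp only: Suc.IH funpow_radius1_Suc int_diff_Suc)
  finally show ?case .
qed

lemma ex_diagram:
  assumes "x \<in> full_shift k"
  shows "\<exists>C. \<forall>t u v. diagram k C t u v = (radius1 \<rho> ^^ t) x (int u - int v)"
proof -
  define Y where "Y z = (radius1 \<rho> ^^ pair_fst z) x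
      (int (pair_fst (pair_snd z)) - int (pair_snd (pair_snd z)))" for z
  have "Y z < k" for z
    unfolding Y_def by (rule funpow_full_shift[OF radius1_full_shift assms])
  from ex_recorded_symbols[of Y k, OF this] obtain C where "\<forall>z. recorded_symbol k C z = Y z" ..
  then have "diagram k C t u v = (radius1 \<rho> ^^ t) x (int u - int v)" for t u v
    by (simp add: diagram_def Y_def)
  then show ?thesis by (intro exI allI)
qed

lemma consistent_at_orbit:
  assumes "\<And>t u v. diagram k C t u v = (radius1 \<rho> ^^ t) x (int u - int v)"
  shows "consistent_at k \<rho> C t u v"
  unfolding consistent_at_def assms funpow_radius1_Suc int_diff_Suc by simp

lemma lang_code_iff_language_matrix:
  "N \<in> lang_code k (language (asymptotic_set k (radius1 \<rho>))) \<longleftrightarrow>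
      (\<exists>C. \<forall>m. \<exists>l. language_matrix k \<rho> C m l N)"
    (is "?L \<longleftrightarrow> ?R")
proof
  assume ?L
  then obtain x where full_shift: "x \<in> full_shift k"
    and recurs: "\<forall>m. \<exists>t\<ge>m. \<exists>n. N = word_code k (map (right_half ((radius1 \<rho> ^^ t) x)) [0..<n])"
    unfolding lang_code_asymptotic_set_iff[OF radius1_full_shift] ..
  obtain C where diagram: "\<And>t u v. diagram k C t u v = (radius1 \<rho> ^^ t) x (int u - int v)"
    using ex_diagram[OF full_shift] by blast
  have "\<exists>l. language_matrix k \<rho> C m l N" for m
  proof -
    obtain t n where "m \<le> t" "N = word_code k (map (right_half ((radius1 \<rho> ^^ t) x)) [0..<n])"
      using recurs by blast
    then have "language_matrix k \<rho> C m (pair t n) N"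
      using consistent_at_orbit[OF diagram]
      by (simp add: language_matrix_def diagram right_half_def)
    then show ?thesis ..
  qed
  then show ?R by blast
next
  assume ?R
  then obtain C where matrix: "\<And>m. \<exists>l. language_matrix k \<rho> C m l N" by blast
  have consistent: "consistent_at k \<rho> C t u v" for t u v
    using matrix[of "pair t (pair u v)"] by (auto simp: language_matrix_def)
  define x where "x = (\<lambda>i. diagram k C 0 (nat i) (nat (- i)))"
  have row: "diagram k C t i 0 = right_half ((radius1 \<rho> ^^ t) x) i" for t i
    using diagram_eq_orbit[OF consistent, of t i 0] by (simp add: x_def right_half_def)
  have "\<exists>t\<ge>m. \<exists>n. N = word_code k (map (right_half ((radius1 \<rho> ^^ t) x)) [0..<n])" for m
  proof -
    obtain l where "language_matrix k \<rho> C m l N" using matrix by blast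
    then have "m \<le> pair_fst l"
      and "N = word_code k (map (right_half ((radius1 \<rho> ^^ pair_fst l) x)) [0..<pair_snd l])"
      by (simp_all add: language_matrix_def row)
    then show ?thesis by (intro exI conjI)
  qed
  moreover have "x \<in> full_shift k"
    by (simp add: x_def full_shift_def diagram_def recorded_symbol_less symbols_pos)
  ultimately show ?L
    unfolding lang_code_asymptotic_set_iff[OF radius1_full_shift] by (intro bexI[of _ x] allI)
qed

theorem sigma11_lang_code_radius1:
  "sigma11 (lang_code k (language (asymptotic_set k (radius1 \<rho>))))"
  unfolding sigma11_def
proof (intro exI[of _ "language_matrix k \<rho>"] conjI allI)
  show "recursive_pred (language_matrix k \<rho>)"
    by (rule recursive_pred_language_matrix[OF symbols_pos])
qed (rule lang_code_iff_language_matrix)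

end

locale finite_local_rule =
  fixes A :: "'a set" and \<rho> :: "'a \<Rightarrow> 'a \<Rightarrow> 'a \<Rightarrow> 'a"
  assumes finite_alphabet: "finite A" and alphabet_nonempty: "A \<noteq> {}"
    and rule_closed: "a \<in> A \<Longrightarrow> b \<in> A \<Longrightarrow> c \<in> A \<Longrightarrow> \<rho> a b c \<in> A"
begin

lemma range_funpow_radius1:
  assumes "range y \<subseteq> A"
  shows "range ((radius1 \<rho> ^^ t) y) \<subseteq> A"
proof (induction t)
  case (Suc t)
  then have "(radius1 \<rho> ^^ Suc t) y i \<in> A" for i
    unfolding funpow_radius1_Suc by (intro rule_closed) auto
  then show ?case by blast
qed (use assms in simp)

abbreviation encode :: "'a \<Rightarrow> nat" where "encode \<equiv> to_nat_on A"

definition coded_rule :: "nat \<Rightarrow> nat \<Rightarrow> nat \<Rightarrow> nat" where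
  "coded_rule a b c = encode (\<rho> (from_nat_into A a) (from_nat_into A b) (from_nat_into A c))"

lemma encode_less: "a \<in> A \<Longrightarrow> encode a < card A"
  using to_nat_on_finite[OF finite_alphabet] by (auto simp: bij_betw_def)

lemma encode_from_nat_into: "n < card A \<Longrightarrow> encode (from_nat_into A n) = n"
  using to_nat_on_finite[OF finite_alphabet] by (simp add: bij_betw_def to_nat_on_from_nat_into)

lemma from_nat_into_encode: "a \<in> A \<Longrightarrow> from_nat_into A (encode a) = a"
  by (simp add: countable_finite finite_alphabet)

sublocale coded: numbered_local_rule "card A" coded_rule
proof
  show "0 < card A" using finite_alphabet alphabet_nonempty by (simp add: card_gt_0_iff)
qed (auto simp: coded_rule_def intro!: encode_less rule_closed from_nat_into alphabet_nonempty)

lemma funpow_radius1_coded: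
  assumes "range y \<subseteq> A"
  shows "(radius1 coded_rule ^^ t) (encode \<circ> y) = encode \<circ> (radius1 \<rho> ^^ t) y"
proof (induction t)
  case (Suc t)
  have "(radius1 \<rho> ^^ t) y i \<in> A" for i using range_funpow_radius1[OF assms, of t] by blast
  then have "(radius1 coded_rule ^^ Suc t) (encode \<circ> y) i = encode ((radius1 \<rho> ^^ Suc t) y i)" for i
    by (simp only: funpow_radius1_Suc Suc o_apply coded_rule_def from_nat_into_encode)
  then show ?case unfolding fun_eq_iff o_apply[of encode] by blast
qed simp

lemma has_prefix_encode_iff:
  assumes "w \<in> lists A" "range y \<subseteq> A"
  shows "has_prefix (map encode w) (right_half (encode \<circ> y)) \<longleftrightarrow> has_prefix w (right_half y)"
proof -
  have "encode (y (int i)) = encode (w ! i) \<longleftrightarrow> y (int i) = w ! i" if "i < length w" for i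
    using assms that by (intro to_nat_on_inj) (auto simp: countable_finite finite_alphabet)
  then show ?thesis by (simp add: has_prefix_def right_half_def)
qed

lemma lang_code_coded_iff:
  assumes "w \<in> lists A"
  shows "word_code (card A) (map encode w) \<in>
      lang_code (card A) (language (asymptotic_set (card A) (radius1 coded_rule)))
    \<longleftrightarrow> (\<exists>y. range y \<subseteq> A \<and> recurs (\<lambda>y. has_prefix w (right_half y)) (radius1 \<rho>) y)"
    (is "?code \<longleftrightarrow> _")
proof -
  have recurs_iff:
    "recurs (\<lambda>y. has_prefix (map encode w) (right_half y)) (radius1 coded_rule) (encode \<circ> y)
      \<longleftrightarrow> recurs (\<lambda>y. has_prefix w (right_half y)) (radius1 \<rho>) y" if "range y \<subseteq> A" for y
    by (simp add: recurs_def funpow_radius1_coded[OF that]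
        has_prefix_encode_iff[OF assms range_funpow_radius1[OF that]])
  have full_shift: "full_shift (card A) = {encode \<circ> y | y. range y \<subseteq> A}"
  proof (intro subset_antisym subsetI)
    fix x assume "x \<in> full_shift (card A)"
    then have "x = encode \<circ> (from_nat_into A \<circ> x)"
      by (simp add: fun_eq_iff full_shift_def encode_from_nat_into)
    moreover have "range (from_nat_into A \<circ> x) \<subseteq> A"
      using from_nat_into[OF alphabet_nonempty] by auto
    ultimately show "x \<in> {encode \<circ> y | y. range y \<subseteq> A}" by blast
  qed (auto simp: full_shift_def image_subset_iff intro!: encode_less)
  have "map encode w \<in> lists {..<card A}" using assms encode_less by auto
  then have "?code \<longleftrightarrow> map encode w \<in> language (asymptotic_set (card A) (radius1 coded_rule))"
    by (rule word_code_mem_lang_code_iff[OF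
          language_asymptotic_set_subset[OF coded.radius1_full_shift]])
  also have "\<dots> \<longleftrightarrow> (\<exists>y. range y \<subseteq> A \<and> recurs (\<lambda>y. has_prefix w (right_half y)) (radius1 \<rho>) y)"
    unfolding language_asymptotic_set_iff[OF coded.radius1_full_shift] full_shift
    using recurs_iff by blast
  finally show ?thesis .
qed

end

section \<open>Quantifier-free formulas over pairing\<close>

datatype pterm = Input | Instance | Witness | Nought | Next pterm
  | PairT pterm pterm | First pterm | Second pterm
datatype formula = Eq pterm pterm | In pterm | Nand formula formula

fun pterm_val :: "nat \<Rightarrow> nat \<Rightarrow> nat \<Rightarrow> pterm \<Rightarrow> nat" where
  "pterm_val n m l Input = n"
| "pterm_val n m l Instance = m"
| "pterm_val n m l Witness = l"
| "pterm_val n m l Nought = 0"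
| "pterm_val n m l (Next a) = Suc (pterm_val n m l a)"
| "pterm_val n m l (PairT a b) = pair (pterm_val n m l a) (pterm_val n m l b)"
| "pterm_val n m l (First a) = pair_fst (pterm_val n m l a)"
| "pterm_val n m l (Second a) = pair_snd (pterm_val n m l a)"

fun sat :: "nat set \<Rightarrow> nat \<Rightarrow> nat \<Rightarrow> nat \<Rightarrow> formula \<Rightarrow> bool" where
  "sat T n m l (Eq a b) \<longleftrightarrow> pterm_val n m l a = pterm_val n m l b"
| "sat T n m l (In a) \<longleftrightarrow> pterm_val n m l a \<in> T"
| "sat T n m l (Nand f g) \<longleftrightarrow> \<not> (sat T n m l f \<and> sat T n m l g)"

definition Neg :: "formula \<Rightarrow> formula" where "Neg f = Nand f f"
definition And :: "formula \<Rightarrow> formula \<Rightarrow> formula" where "And f g = Neg (Nand f g)"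
definition Imp :: "formula \<Rightarrow> formula \<Rightarrow> formula" where "Imp f g = Nand f (Neg g)"
definition Conj :: "formula list \<Rightarrow> formula" where "Conj fs = foldr And fs (Eq Nought Nought)"
definition Disj :: "formula list \<Rightarrow> formula" where "Disj fs = Neg (Conj (map Neg fs))"

lemma sat_connectives [simp]:
  "sat T n m l (Neg f) \<longleftrightarrow> \<not> sat T n m l f"
  "sat T n m l (And f g) \<longleftrightarrow> sat T n m l f \<and> sat T n m l g"
  "sat T n m l (Imp f g) \<longleftrightarrow> (sat T n m l f \<longrightarrow> sat T n m l g)"
  by (auto simp: Neg_def And_def Imp_def)

lemma sat_Conj [simp]: "sat T n m l (Conj fs) \<longleftrightarrow> (\<forall>f\<in>set fs. sat T n m l f)"
  by (induction fs) (auto simp: Conj_def)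

lemma sat_Disj [simp]: "sat T n m l (Disj fs) \<longleftrightarrow> (\<exists>f\<in>set fs. sat T n m l f)"
  by (auto simp: Disj_def)

definition Numeral :: "nat \<Rightarrow> pterm" where "Numeral c = (Next ^^ c) Nought"

lemma pterm_val_Numeral [simp]: "pterm_val n m l (Numeral c) = c"
  by (induction c) (auto simp: Numeral_def)

definition component :: "nat \<Rightarrow> nat \<Rightarrow> nat" where "component z i = pair_fst ((pair_snd ^^ i) z)"
definition Component :: "pterm \<Rightarrow> nat \<Rightarrow> pterm" where "Component a i = First ((Second ^^ i) a)"
definition tuple :: "nat list \<Rightarrow> nat" where "tuple as = foldr pair as 0"

lemma pterm_val_Component [simp]:
  "pterm_val n m l (Component a i) = component (pterm_val n m l a) i"
proof -
  have "pterm_val n m l ((Second ^^ i) a) = (pair_snd ^^ i) (pterm_val n m l a)"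
    by (induction i) auto
  then show ?thesis by (simp add: Component_def component_def)
qed

lemma component_tuple: "i < length as \<Longrightarrow> component (tuple as) i = as ! i"
proof (induction as arbitrary: i)
  case (Cons a as)
  then show ?case
    by (cases i) (simp_all add: component_def tuple_def funpow_Suc_right del: funpow.simps(2))
qed simp

definition tagged :: "nat \<Rightarrow> nat \<Rightarrow> nat \<Rightarrow> nat \<Rightarrow> nat" where
  "tagged k a b c = pair k (pair a (pair b c))"
definition Tagged :: "nat \<Rightarrow> pterm \<Rightarrow> pterm \<Rightarrow> pterm \<Rightarrow> pterm" where
  "Tagged k a b c = PairT (Numeral k) (PairT a (PairT b c))"

lemma tagged_eq_iff [simp]:
  "tagged k a b c = tagged k' a' b' c' \<longleftrightarrow> k = k' \<and> a = a' \<and> b = b' \<and> c = c'"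
  by (simp add: tagged_def)

lemma pterm_val_Tagged [simp]:
  "pterm_val n m l (Tagged k a b c) =
      tagged k (pterm_val n m l a) (pterm_val n m l b) (pterm_val n m l c)"
  by (simp add: Tagged_def tagged_def)

section \<open>A universal formula\<close>

abbreviation cons_code :: "nat \<Rightarrow> nat \<Rightarrow> nat" where "cons_code x xs \<equiv> Suc (pair x xs)"

abbreviation "zero_code \<equiv> pair 0 0"
abbreviation "succ_code \<equiv> pair 1 0"
abbreviation "proj_code i \<equiv> pair 2 i"
abbreviation "orc_code \<equiv> pair 3 0"
abbreviation "comp_code f gs \<equiv> pair 4 (pair f gs)"
abbreviation "prim_code f g \<equiv> pair 5 (pair f g)"
abbreviation "mn_code g \<equiv> pair 6 g"

fun program_code :: "rf \<Rightarrow> nat" where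
  "program_code Zero = zero_code"
| "program_code Succ = succ_code"
| "program_code (Proj i) = proj_code i"
| "program_code Orc = orc_code"
| "program_code (Comp f gs) = comp_code (program_code f) (list_encode (map program_code gs))"
| "program_code (Prim f g) = prim_code (program_code f) (program_code g)"
| "program_code (Mn g) = mn_code (program_code g)"

text \<open>\<open>Searches e w m\<close> claims that for every \<open>m' \<ge> m\<close> the program \<open>e\<close> accepts \<open>m'\<close>, some \<open>l\<close> and
  \<open>w\<close>. No well-foundedness is required of supported sets: an induction on a true evaluation shows
  that a supported set contains no wrong value for it, and only total programs are ever asked
  for.\<close>

abbreviation "Evaluates e xs y \<equiv> tagged 0 e xs y"
abbreviation "EvaluatesAll gs xs ys \<equiv> tagged 2 gs xs ys"
abbreviation "Argument xs i y \<equiv> tagged 3 xs i y"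
abbreviation "NonzeroBelow g xs y \<equiv> tagged 4 g xs y"
abbreviation "Searches e w m \<equiv> tagged 5 e w m"
abbreviation "InOracle c \<equiv> tagged 6 c 0 0"

inductive justified :: "nat set \<Rightarrow> nat \<Rightarrow> bool" for T where
  zero: "justified T (Evaluates zero_code xs 0)"
| succ: "Argument xs 0 y \<in> T \<Longrightarrow> justified T (Evaluates succ_code xs (Suc y))"
| proj: "Argument xs i y \<in> T \<Longrightarrow> justified T (Evaluates (proj_code i) xs y)"
| orc_in: "Argument xs 0 c \<in> T \<Longrightarrow> InOracle c \<in> T \<Longrightarrow> justified T (Evaluates orc_code xs 1)"
| orc_notin: "Argument xs 0 c \<in> T \<Longrightarrow> InOracle c \<notin> T \<Longrightarrow> justified T (Evaluates orc_code xs 0)"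
| comp: "EvaluatesAll gs xs ys \<in> T \<Longrightarrow> Evaluates f ys z \<in> T \<Longrightarrow>
    justified T (Evaluates (comp_code f gs) xs z)"
| prim_0: "Evaluates f xs z \<in> T \<Longrightarrow> justified T (Evaluates (prim_code f g) (cons_code 0 xs) z)"
| prim_Suc: "Evaluates (prim_code f g) (cons_code n xs) y \<in> T \<Longrightarrow>
    Evaluates g (cons_code y (cons_code n xs)) z \<in> T \<Longrightarrow>
    justified T (Evaluates (prim_code f g) (cons_code (Suc n) xs) z)"
| mn: "Evaluates g (cons_code y xs) 0 \<in> T \<Longrightarrow> NonzeroBelow g xs y \<in> T \<Longrightarrow>
    justified T (Evaluates (mn_code g) xs y)"
| nonzero_0: "justified T (NonzeroBelow g xs 0)"
| nonzero_Suc: "Evaluates g (cons_code y xs) (Suc v) \<in> T \<Longrightarrow> NonzeroBelow g xs y \<in> T \<Longrightarrow>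
    justified T (NonzeroBelow g xs (Suc y))"
| all_Nil: "justified T (EvaluatesAll 0 xs 0)"
| all_Cons: "Evaluates g xs y \<in> T \<Longrightarrow> EvaluatesAll gs xs ys \<in> T \<Longrightarrow>
    justified T (EvaluatesAll (cons_code g gs) xs (cons_code y ys))"
| argument_Nil: "justified T (Argument 0 i 0)"
| argument_0: "justified T (Argument (cons_code x xs) 0 x)"
| argument_Suc: "Argument xs i y \<in> T \<Longrightarrow> justified T (Argument (cons_code x xs) (Suc i) y)"
| searches: "Evaluates e (cons_code m (cons_code l (cons_code w 0))) 1 \<in> T \<Longrightarrow>
    Searches e w (Suc m) \<in> T \<Longrightarrow>
    justified T (Searches e w m)"
| in_oracle: "justified T (InOracle c)"

definition supported :: "nat set \<Rightarrow> bool" where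
  "supported T \<longleftrightarrow> (\<forall>t\<in>T. justified T t)"

lemma arg_Nil [simp]: "arg [] i = 0" by (simp add: arg_def)
lemma arg_Cons_0 [simp]: "arg (x # xs) 0 = x" by (simp add: arg_def)
lemma arg_Cons_Suc [simp]: "arg (x # xs) (Suc i) = arg xs i" by (simp add: arg_def)

context
  fixes T :: "nat set"
  assumes supported: "supported T"
begin

lemma supportedD: "t \<in> T \<Longrightarrow> justified T t"
  using supported by (simp add: supported_def)

lemma supported_Argument: "Argument (list_encode xs) i y \<in> T \<Longrightarrow> y = arg xs i"
proof (induction xs arbitrary: i)
  case Nil
  from supportedD[OF Nil] show ?case by cases auto
next
  case (Cons x xs)
  from supportedD[OF Cons.prems] show ?case using Cons.IH by cases auto
qed

lemma supported_NonzeroBelow: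
  "NonzeroBelow g xs y \<in> T \<Longrightarrow> z < y \<Longrightarrow> \<exists>v. Evaluates g (cons_code z xs) (Suc v) \<in> T"
proof (induction y)
  case (Suc y)
  from supportedD[OF Suc.prems(1)] show ?case using Suc by cases (auto simp: less_Suc_eq)
qed simp

lemma supported_EvaluatesAll:
  assumes "list_all2 (\<lambda>g y. \<forall>y'. Evaluates (program_code g) xs y' \<in> T \<longrightarrow> y' = y) gs ys"
    and "EvaluatesAll (list_encode (map program_code gs)) xs ys' \<in> T"
  shows "ys' = list_encode ys"
  using assms
proof (induction gs ys arbitrary: ys' rule: list_all2_induct)
  case Nil
  then have "EvaluatesAll 0 xs ys' \<in> T" by simp
  from supportedD[OF this] show ?case by cases auto
next
  case (Cons g gs y ys)
  then have
    "EvaluatesAll (cons_code (program_code g) (list_encode (map program_code gs))) xs ys' \<in> T"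
    by simp
  from supportedD[OF this] show ?case using Cons by cases auto
qed

lemma supported_Evaluates_mn:
  assumes "Evaluates (mn_code g) xs y' \<in> T"
    and root: "\<And>v. Evaluates g (cons_code y xs) v \<in> T \<Longrightarrow> v = 0"
    and below: "\<And>z. z < y \<Longrightarrow> Evaluates g (cons_code z xs) 0 \<notin> T"
  shows "y' = y"
  using supportedD[OF assms(1)]
proof cases
  case mn
  then have mn_facts: "Evaluates g (cons_code y' xs) 0 \<in> T" "NonzeroBelow g xs y' \<in> T" by auto
  have "\<not> y' < y" using below mn_facts(1) by blast
  moreover have "\<not> y < y'"
  proof
    assume "y < y'"
    then obtain v where "Evaluates g (cons_code y xs) (Suc v) \<in> T"
      using supported_NonzeroBelow[OF mn_facts(2)] by blast
    then show False using root by blast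
  qed
  ultimately show ?thesis by simp
qed auto

lemma supported_Evaluates:
  "reval {c. InOracle c \<in> T} e xs y \<Longrightarrow> Evaluates (program_code e) (list_encode xs) y' \<in> T \<Longrightarrow> y' = y"
proof (induction arbitrary: y' rule: reval.induct)
  case (zero xs)
  from supportedD[OF zero[simplified]] show ?case by cases auto
next
  case (succ xs)
  from supportedD[OF succ[simplified]] show ?case by cases (auto dest: supported_Argument)
next
  case (proj i xs)
  from supportedD[OF proj[simplified]] show ?case by cases (auto dest: supported_Argument)
next
  case (orc xs)
  from supportedD[OF orc[simplified]] show ?case by cases (auto dest: supported_Argument)
next
  case (comp xs gs ys f z)
  have "list_all2 (\<lambda>g y. \<forall>y'. Evaluates (program_code g) (list_encode xs) y' \<in> T \<longrightarrow> y' = y) gs ys"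
    using comp.IH(1) by (auto elim!: list.rel_mono_strong)
  note unique_arguments = supported_EvaluatesAll[OF this]
  from supportedD[OF comp.prems[simplified]] show ?case
    using comp.IH(2) by cases (auto dest: unique_arguments)
next
  case (prim0 f xs z g)
  from supportedD[OF prim0.prems[simplified]] show ?case using prim0.IH by cases auto
next
  case (primS f g n xs y z)
  from supportedD[OF primS.prems[simplified]] show ?case using primS.IH by cases auto
next
  case (mn g y xs)
  show ?case
  proof (rule supported_Evaluates_mn)
    show "Evaluates (mn_code (program_code g)) (list_encode xs) y' \<in> T" using mn.prems by simp
  qed (use mn.IH in \<open>auto simp flip: list_encode.simps(2)\<close>)
qed

lemma supported_Searches:
  assumes "Searches e w 0 \<in> T"
  shows "\<exists>l. Evaluates e (list_encode [m, l, w]) 1 \<in> T"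
proof -
  have step: "\<exists>l. Evaluates e (list_encode [m, l, w]) 1 \<in> T \<and> Searches e w (Suc m) \<in> T"
    if "Searches e w m \<in> T" for m
    using supportedD[OF that] by cases auto
  then have "Searches e w m \<in> T" by (induction m) (use assms in auto)
  with step show ?thesis by blast
qed

end

inductive_set true_facts :: "nat set \<Rightarrow> rf \<Rightarrow> nat \<Rightarrow> nat set" for C e w where
  evaluates: "reval C g xs y \<Longrightarrow> Evaluates (program_code g) (list_encode xs) y \<in> true_facts C e w"
| evaluates_all: "list_all2 (\<lambda>g y. reval C g xs y) gs ys \<Longrightarrow>
    EvaluatesAll (list_encode (map program_code gs)) (list_encode xs) (list_encode ys)
      \<in> true_facts C e w"
| argument: "Argument (list_encode xs) i (arg xs i) \<in> true_facts C e w"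
| nonzero_below: "\<forall>z<y. \<exists>v. v \<noteq> 0 \<and> reval C g (z # xs) v \<Longrightarrow>
    NonzeroBelow (program_code g) (list_encode xs) y \<in> true_facts C e w"
| searches: "Searches (program_code e) w m \<in> true_facts C e w"
| in_oracle: "c \<in> C \<Longrightarrow> InOracle c \<in> true_facts C e w"

lemma InOracle_true_facts: "InOracle c \<in> true_facts C e w \<longleftrightarrow> c \<in> C"
  by (auto intro: true_facts.intros elim: true_facts.cases)

lemma true_facts_evaluates_Cons: "reval C g (x # xs) y \<Longrightarrow>
    Evaluates (program_code g) (cons_code x (list_encode xs)) y \<in> true_facts C e w"
  using true_facts.evaluates[of C g "x # xs" y] by simp

lemma justified_orc:
  "justified (true_facts C e w)
    (Evaluates orc_code (list_encode xs) (if arg xs 0 \<in> C then 1 else 0))"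
proof (cases "arg xs 0 \<in> C")
  case True
  have "justified (true_facts C e w) (Evaluates orc_code (list_encode xs) 1)"
    by (rule justified.orc_in[where c = "arg xs 0"]) (auto intro: true_facts.intros True)
  with True show ?thesis by simp
next
  case False
  have "justified (true_facts C e w) (Evaluates orc_code (list_encode xs) 0)"
    by (rule justified.orc_notin[where c = "arg xs 0"])
      (auto intro: true_facts.intros simp: InOracle_true_facts False)
  with False show ?thesis by simp
qed

lemma justified_Evaluates:
  assumes "reval C g xs y"
  shows "justified (true_facts C e w) (Evaluates (program_code g) (list_encode xs) y)"
  using assms
proof cases
  case orc
  with justified_orc show ?thesis by simp
next
  case (prim0 f xs' g')
  then show ?thesis
    by (auto intro!: justified.prim_0 true_facts.evaluates)
next
  case (primS f g' n xs' v)
  note smaller = primS(3,4)[THEN true_facts.evaluates, of e w]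
  from primS smaller show ?thesis by (auto intro!: justified.prim_Suc[where y = v])
next
  case (mn g')
  then show ?thesis
    by (auto intro!: justified.mn true_facts_evaluates_Cons true_facts.nonzero_below)
qed (auto simp del: One_nat_def intro: justified.intros true_facts.intros)

lemma justified_NonzeroBelow:
  assumes "\<forall>z<y. \<exists>v. v \<noteq> 0 \<and> reval C g (z # xs) v"
  shows "justified (true_facts C e w) (NonzeroBelow (program_code g) (list_encode xs) y)"
proof (cases y)
  case 0
  then show ?thesis by (auto intro: justified.intros)
next
  case (Suc z)
  with assms obtain v where "reval C g (z # xs) (Suc v)" by (metis lessI not0_implies_Suc)
  with assms Suc show ?thesis
    by (auto intro!: justified.nonzero_Suc true_facts_evaluates_Cons true_facts.nonzero_below)
qed

lemma supported_true_facts: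
  assumes "\<And>m. \<exists>l. reval C e [m, l, w] 1"
  shows "supported (true_facts C e w)"
  unfolding supported_def
proof
  fix t assume "t \<in> true_facts C e w"
  then show "justified (true_facts C e w) t"
  proof cases
    case (evaluates g xs y)
    then show ?thesis using justified_Evaluates by blast
  next
    case (evaluates_all xs gs ys)
    from evaluates_all(2) show ?thesis
      unfolding evaluates_all(1) by cases (auto intro: justified.intros true_facts.intros)
  next
    case (argument xs i)
    then show ?thesis by (cases xs; cases i) (auto intro: justified.intros true_facts.intros)
  next
    case (nonzero_below y g xs)
    then show ?thesis using justified_NonzeroBelow by blast
  next
    case (searches m)
    obtain l where "reval C e [m, l, w] 1" using assms by blast
    then have "Evaluates (program_code e) (cons_code m (cons_code l (cons_code w 0))) 1
        \<in> true_facts C e w"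
      using true_facts.evaluates[of C e "[m, l, w]" 1] by simp
    then show ?thesis unfolding searches by (auto intro: justified.intros true_facts.intros)
  next
    case (in_oracle c)
    then show ?thesis by (auto intro: justified.intros)
  qed
qed

lemma recursive_sigma11_iff_supported:
  assumes decides: "\<And>C m l w. reval C e [m, l, w] (if R C m l w then 1 else 0)"
  shows "(\<exists>C. \<forall>m. \<exists>l. R C m l w) \<longleftrightarrow> (\<exists>T. Searches (program_code e) w 0 \<in> T \<and> supported T)"
proof
  assume "\<exists>C. \<forall>m. \<exists>l. R C m l w"
  then obtain C where witnesses: "\<And>m. \<exists>l. R C m l w" by blast
  have "\<exists>l. reval C e [m, l, w] 1" for m
    using witnesses[of m] decides[of C m _ w] by (metis (full_types))
  then have "supported (true_facts C e w)" by (rule supported_true_facts)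
  then show "\<exists>T. Searches (program_code e) w 0 \<in> T \<and> supported T"
    by (auto intro: true_facts.intros)
next
  assume "\<exists>T. Searches (program_code e) w 0 \<in> T \<and> supported T"
  then obtain T where support: "Searches (program_code e) w 0 \<in> T" "supported T" by blast
  have "\<exists>l. R {c. InOracle c \<in> T} m l w" for m
    using supported_Searches[OF support(2,1), of m]
      supported_Evaluates[OF support(2) decides[of _ m _ w]]
    by (metis zero_neq_one)
  then show "\<exists>C. \<forall>m. \<exists>l. R C m l w" by blast
qed

abbreviation "ConsCode a b \<equiv> Next (PairT a b)"
abbreviation "PrimCode f g \<equiv> PairT (Numeral 5) (PairT f g)"
abbreviation "Var \<equiv> Component Witness"

definition clause :: "pterm \<Rightarrow> pterm list \<Rightarrow> formula" where
  "clause h bs = And (Eq Instance h) (Conj (map In bs))"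

lemma sat_clause [simp]:
  "sat T n m l (clause h bs) \<longleftrightarrow> m = pterm_val n m l h \<and> (\<forall>b\<in>set bs. pterm_val n m l b \<in> T)"
  by (auto simp: clause_def)

text \<open>One disjunct per rule of \<open>justified\<close>, whose variables are the components of the witness.\<close>

definition justified_formula :: formula where
  "justified_formula = Disj
    [clause (Tagged 0 (PairT Nought Nought) (Var 0) Nought) [],
     clause (Tagged 0 (PairT (Numeral 1) Nought) (Var 0) (Next (Var 1)))
       [Tagged 3 (Var 0) Nought (Var 1)],
     clause (Tagged 0 (PairT (Numeral 2) (Var 1)) (Var 0) (Var 2))
       [Tagged 3 (Var 0) (Var 1) (Var 2)],
     clause (Tagged 0 (PairT (Numeral 3) Nought) (Var 0) (Numeral 1))
       [Tagged 3 (Var 0) Nought (Var 1), Tagged 6 (Var 1) Nought Nought],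
     And (clause (Tagged 0 (PairT (Numeral 3) Nought) (Var 0) Nought)
       [Tagged 3 (Var 0) Nought (Var 1)])
       (Neg (In (Tagged 6 (Var 1) Nought Nought))),
     clause (Tagged 0 (PairT (Numeral 4) (PairT (Var 3) (Var 0))) (Var 1) (Var 4))
       [Tagged 2 (Var 0) (Var 1) (Var 2), Tagged 0 (Var 3) (Var 2) (Var 4)],
     clause (Tagged 0 (PrimCode (Var 0) (Var 3)) (ConsCode Nought (Var 1)) (Var 2))
       [Tagged 0 (Var 0) (Var 1) (Var 2)],
     clause (Tagged 0 (PrimCode (Var 0) (Var 1)) (ConsCode (Next (Var 2)) (Var 3)) (Var 5))
       [Tagged 0 (PrimCode (Var 0) (Var 1)) (ConsCode (Var 2) (Var 3)) (Var 4),
        Tagged 0 (Var 1) (ConsCode (Var 4) (ConsCode (Var 2) (Var 3))) (Var 5)],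
     clause (Tagged 0 (PairT (Numeral 6) (Var 0)) (Var 2) (Var 1))
       [Tagged 0 (Var 0) (ConsCode (Var 1) (Var 2)) Nought, Tagged 4 (Var 0) (Var 2) (Var 1)],
     clause (Tagged 4 (Var 0) (Var 1) Nought) [],
     clause (Tagged 4 (Var 0) (Var 2) (Next (Var 1)))
       [Tagged 0 (Var 0) (ConsCode (Var 1) (Var 2)) (Next (Var 3)),
        Tagged 4 (Var 0) (Var 2) (Var 1)],
     clause (Tagged 2 Nought (Var 0) Nought) [],
     clause (Tagged 2 (ConsCode (Var 0) (Var 3)) (Var 1) (ConsCode (Var 2) (Var 4)))
       [Tagged 0 (Var 0) (Var 1) (Var 2), Tagged 2 (Var 3) (Var 1) (Var 4)],
     clause (Tagged 3 Nought (Var 0) Nought) [],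
     clause (Tagged 3 (ConsCode (Var 0) (Var 1)) Nought (Var 0)) [],
     clause (Tagged 3 (ConsCode (Var 3) (Var 0)) (Next (Var 1)) (Var 2))
       [Tagged 3 (Var 0) (Var 1) (Var 2)],
     clause (Tagged 5 (Var 0) (Var 3) (Var 1))
       [Tagged 0 (Var 0) (ConsCode (Var 1) (ConsCode (Var 2) (ConsCode (Var 3) Nought)))
         (Numeral 1),
        Tagged 5 (Var 0) (Var 3) (Next (Var 1))],
     clause (Tagged 6 (Var 0) Nought Nought) []]"

lemma justified_if_sat: "sat T n m l justified_formula \<Longrightarrow> justified T m"
  unfolding justified_formula_def sat_Disj
  by (auto simp del: One_nat_def intro: justified.intros)

lemma sat_if_justified:
  assumes "justified T t"
  shows "\<exists>l. sat T n t l justified_formula"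
proof -
  have witness: "sat T n t (tuple as) justified_formula \<Longrightarrow> ?thesis" for as by blast
  note [simp] = justified_formula_def component_tuple
  from assms show ?thesis
  proof cases
    case (zero xs) then show ?thesis by (intro witness[of "[xs]"]) simp
  next
    case (succ xs y) then show ?thesis by (intro witness[of "[xs, y]"]) simp
  next
    case (proj xs i y) then show ?thesis by (intro witness[of "[xs, i, y]"]) simp
  next
    case (orc_in xs c) then show ?thesis by (intro witness[of "[xs, c]"]) simp
  next
    case (orc_notin xs c) then show ?thesis by (intro witness[of "[xs, c]"]) simp
  next
    case (comp gs xs ys f z) then show ?thesis by (intro witness[of "[gs, xs, ys, f, z]"]) simp
  next
    case (prim_0 f xs z g) then show ?thesis by (intro witness[of "[f, xs, z, g]"]) simp
  next
    case (prim_Suc f g n xs y z) then show ?thesis by (intro witness[of "[f, g, n, xs, y, z]"]) simp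
  next
    case (mn g y xs) then show ?thesis by (intro witness[of "[g, y, xs]"]) simp
  next
    case (nonzero_0 g xs) then show ?thesis by (intro witness[of "[g, xs]"]) simp
  next
    case (nonzero_Suc g y xs v) then show ?thesis by (intro witness[of "[g, y, xs, v]"]) simp
  next
    case (all_Nil xs) then show ?thesis by (intro witness[of "[xs]"]) simp
  next
    case (all_Cons g xs y gs ys) then show ?thesis by (intro witness[of "[g, xs, y, gs, ys]"]) simp
  next
    case (argument_Nil i) then show ?thesis by (intro witness[of "[i]"]) simp
  next
    case (argument_0 x xs) then show ?thesis by (intro witness[of "[x, xs]"]) simp
  next
    case (argument_Suc xs i y x) then show ?thesis by (intro witness[of "[xs, i, y, x]"]) simp
  next
    case (searches e m l w) then show ?thesis by (intro witness[of "[e, m, l, w]"]) simp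
  next
    case (in_oracle c) then show ?thesis by (intro witness[of "[c]"]) simp
  qed
qed

lemma justified_iff_sat: "justified T m \<longleftrightarrow> (\<exists>l. sat T n m l justified_formula)"
  using justified_if_sat sat_if_justified by blast

definition universal_formula :: formula where
  "universal_formula = And (Imp (Eq (Next Instance) Input) (In Instance))
      (Imp (In Instance) justified_formula)"

lemma supported_iff_universal_formula:
  "r \<in> T \<and> supported T \<longleftrightarrow> (\<forall>m. \<exists>l. sat T (Suc r) m l universal_formula)"
  unfolding universal_formula_def supported_def by (auto simp: justified_iff_sat[of T _ "Suc r"])

section \<open>Counter machines\<close>

datatype guard = Always | Equal nat nat | Member nat
datatype instr = Inc nat | Rst nat | Jump guard nat

type_synonym registers = "nat \<Rightarrow> nat"

fun guard_holds :: "nat set \<Rightarrow> guard \<Rightarrow> registers \<Rightarrow> bool" where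
  "guard_holds A Always s \<longleftrightarrow> True"
| "guard_holds A (Equal a b) s \<longleftrightarrow> s a = s b"
| "guard_holds A (Member r) s \<longleftrightarrow> s r \<in> A"

fun guard_regs :: "guard \<Rightarrow> nat set" where
  "guard_regs Always = {}"
| "guard_regs (Equal a b) = {a, b}"
| "guard_regs (Member r) = {r}"

fun jumps :: "nat set \<Rightarrow> instr \<Rightarrow> registers \<Rightarrow> bool" where
  "jumps A (Jump g l) s \<longleftrightarrow> guard_holds A g s"
| "jumps A _ s \<longleftrightarrow> False"

fun jump_target :: "instr \<Rightarrow> nat" where
  "jump_target (Jump g l) = l"
| "jump_target _ = 0"

fun update :: "instr \<Rightarrow> registers \<Rightarrow> registers" where
  "update (Inc r) s = s(r := Suc (s r))"
| "update (Rst r) s = s(r := 0)"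
| "update (Jump g l) s = s"

text \<open>Jumps out of the program lead to 0, so that labels stay in a finite range.\<close>

definition next_label :: "instr list \<Rightarrow> nat \<Rightarrow> bool \<Rightarrow> nat" where
  "next_label prog l b =
    (let t = if b then jump_target (prog ! l) else Suc l in if t < length prog then t else 0)"

definition machine_step :: "instr list \<Rightarrow> nat set \<Rightarrow> nat \<times> registers \<Rightarrow> nat \<times> registers" where
  "machine_step prog A c =
    (next_label prog (fst c) (jumps A (prog ! fst c) (snd c)), update (prog ! fst c) (snd c))"

text \<open>Label 0 is where the machine will be observed.\<close>

definition silent_step :: "instr list \<Rightarrow> nat set \<Rightarrow> nat \<times> registers \<Rightarrow> nat \<times> registers \<Rightarrow> bool" where
  "silent_step prog A c c' \<longleftrightarrow> fst c \<noteq> 0 \<and> c' = machine_step prog A c"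

lemma next_label_less: "0 < length prog \<Longrightarrow> next_label prog l b < length prog"
  by (simp add: next_label_def Let_def)

lemma silent_step_Inc: "prog ! l = Inc r \<Longrightarrow> 0 < l \<Longrightarrow> Suc l < length prog \<Longrightarrow>
    silent_step prog A (l, s) (Suc l, s(r := Suc (s r)))"
  by (simp add: silent_step_def machine_step_def next_label_def)

lemma silent_step_Rst: "prog ! l = Rst r \<Longrightarrow> 0 < l \<Longrightarrow> Suc l < length prog \<Longrightarrow>
    silent_step prog A (l, s) (Suc l, s(r := 0))"
  by (simp add: silent_step_def machine_step_def next_label_def)

lemma silent_step_Jump: "prog ! l = Jump g t \<Longrightarrow> 0 < l \<Longrightarrow> guard_holds A g s \<Longrightarrow> t < length prog \<Longrightarrow>
    silent_step prog A (l, s) (t, s)"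
  by (simp add: silent_step_def machine_step_def next_label_def)

lemma silent_step_no_Jump:
  "prog ! l = Jump g t \<Longrightarrow> 0 < l \<Longrightarrow> \<not> guard_holds A g s \<Longrightarrow> Suc l < length prog \<Longrightarrow>
    silent_step prog A (l, s) (Suc l, s)"
  by (simp add: silent_step_def machine_step_def next_label_def)

lemma silent_step_trans [trans]:
  "silent_step prog A a b \<Longrightarrow> silent_step prog A b c \<Longrightarrow> (silent_step prog A)\<^sup>*\<^sup>* a c"
  by (meson converse_rtranclp_into_rtranclp r_into_rtranclp)

declare converse_rtranclp_into_rtranclp [trans]

lemma no_silent_step_0: "\<not> silent_step prog A (0, s) c"
  by (simp add: silent_step_def)

lemma silent_steps_halting:
  assumes "(silent_step prog A)\<^sup>*\<^sup>* a b" "(silent_step prog A ^^ n) a (0, s)"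
  shows "\<exists>m\<le>n. (silent_step prog A ^^ m) b (0, s)"
  using assms
proof (induction arbitrary: n rule: converse_rtranclp_induct)
  case base
  then show ?case by blast
next
  case (step a c)
  then obtain k where n_Suc: "n = Suc k"
    using no_silent_step_0 by (cases n) auto
  with step.prems obtain c' where "silent_step prog A a c'" "(silent_step prog A ^^ k) c' (0, s)"
    by (metis relpowp_Suc_D2)
  then have "(silent_step prog A ^^ k) c (0, s)" using step.hyps by (simp add: silent_step_def)
  from step.IH[OF this] n_Suc show ?case by (meson le_SucI)
qed

lemma proper_silent_steps_halting:
  assumes "(silent_step prog A)\<^sup>+\<^sup>+ a b" "(silent_step prog A ^^ n) a (0, s)"
  shows "\<exists>m<n. (silent_step prog A ^^ m) b (0, s)"
proof -
  obtain c where first_step: "silent_step prog A a c" "(silent_step prog A)\<^sup>*\<^sup>* c b"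
    using assms(1) by (meson tranclpD)
  obtain k where n_Suc: "n = Suc k" using first_step(1) assms(2) no_silent_step_0 by (cases n) auto
  with assms(2) obtain c' where "silent_step prog A a c'" "(silent_step prog A ^^ k) c' (0, s)"
    by (metis relpowp_Suc_D2)
  then have "(silent_step prog A ^^ k) c (0, s)" using first_step by (simp add: silent_step_def)
  from silent_steps_halting[OF first_step(2) this] n_Suc show ?thesis by (meson le_imp_less_Suc)
qed

lemma silent_steps_imp_funpow:
  "(silent_step prog A)\<^sup>*\<^sup>* a b \<Longrightarrow> \<exists>k. b = (machine_step prog A ^^ k) a"
proof (induction rule: rtranclp_induct)
  case base
  then show ?case by (metis funpow_0)
next
  case (step b c)
  then show ?case by (metis silent_step_def funpow.simps(2) comp_apply)
qed

lemma funpow_halting_imp_silent_steps: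
  assumes "fst ((machine_step prog A ^^ k) a) = 0"
  shows "\<exists>n s. (silent_step prog A ^^ n) a (0, s) \<and> (machine_step prog A ^^ n) a = (0, s)"
proof -
  define n where "n = (LEAST k. fst ((machine_step prog A ^^ k) a) = 0)"
  have halted: "fst ((machine_step prog A ^^ n) a) = 0" unfolding n_def using assms by (rule LeastI)
  have "(silent_step prog A ^^ m) a ((machine_step prog A ^^ m) a)" if "m \<le> n" for m
    using that
  proof (induction m)
    case (Suc m)
    then have "fst ((machine_step prog A ^^ m) a) \<noteq> 0"
      unfolding n_def by (meson Suc_le_eq not_less_Least)
    then have "silent_step prog A ((machine_step prog A ^^ m) a) ((machine_step prog A ^^ Suc m) a)"
      by (simp add: silent_step_def)
    with Suc show ?case by auto
  qed simp
  from this[of n] halted show ?thesis by (metis order_refl prod.collapse)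
qed

section \<open>Structured programs\<close>

datatype com = Skip | Increment nat | Reset nat | Seq com com
  | For nat nat com | Branch guard com com

fun exec :: "nat set \<Rightarrow> com \<Rightarrow> registers \<Rightarrow> registers" where
  "exec A Skip s = s"
| "exec A (Increment r) s = s(r := Suc (s r))"
| "exec A (Reset r) s = s(r := 0)"
| "exec A (Seq c d) s = exec A d (exec A c s)"
| "exec A (For j b c) s = ((\<lambda>s. exec A c (s(j := Suc (s j)))) ^^ s b) (s(j := 0))"
| "exec A (Branch g c d) s = (if guard_holds A g s then exec A c s else exec A d s)"

abbreviation block :: "com list \<Rightarrow> com" where "block cs \<equiv> foldr Seq cs Skip"

fun written :: "com \<Rightarrow> nat set" where
  "written Skip = {}"
| "written (Increment r) = {r}"
| "written (Reset r) = {r}"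
| "written (Seq c d) = written c \<union> written d"
| "written (For j b c) = insert j (written c)"
| "written (Branch g c d) = written c \<union> written d"

fun used :: "com \<Rightarrow> nat set" where
  "used Skip = {}"
| "used (Increment r) = {r}"
| "used (Reset r) = {r}"
| "used (Seq c d) = used c \<union> used d"
| "used (For j b c) = {j, b} \<union> used c"
| "used (Branch g c d) = guard_regs g \<union> used c \<union> used d"

fun well_formed :: "com \<Rightarrow> bool" where
  "well_formed (Seq c d) \<longleftrightarrow> well_formed c \<and> well_formed d"
| "well_formed (For j b c) \<longleftrightarrow> j \<noteq> b \<and> j \<notin> written c \<and> b \<notin> written c \<and> well_formed c"
| "well_formed (Branch g c d) \<longleftrightarrow> well_formed c \<and> well_formed d"
| "well_formed _ \<longleftrightarrow> True"

fun compile :: "com \<Rightarrow> nat \<Rightarrow> instr list" where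
  "compile Skip l = []"
| "compile (Increment r) l = [Inc r]"
| "compile (Reset r) l = [Rst r]"
| "compile (Seq c d) l = (let p = compile c l in p @ compile d (l + length p))"
| "compile (For j b c) l = (let p = compile c (l + 3) in
    [Rst j, Jump (Equal j b) (l + length p + 4), Inc j] @ p @ [Jump Always (l + 1)])"
| "compile (Branch g c d) l = (let q = compile d (l + 1); p = compile c (l + length q + 2) in
    Jump g (l + length q + 2) # q @ Jump Always (l + length q + 2 + length p) # p)"

lemma exec_unwritten: "r \<notin> written c \<Longrightarrow> exec A c s r = s r"
proof (induction c arbitrary: s)
  case (For j b c)
  have "((\<lambda>s. exec A c (s(j := Suc (s j)))) ^^ n) t r = t r" for n t
    by (induction n) (use For in auto)
  then show ?case using For by simp
qed auto

lemma finite_used: "finite (used c)"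
proof (induction c)
  case (Branch g c d)
  then show ?case by (cases g) auto
qed auto

definition code_at :: "instr list \<Rightarrow> nat \<Rightarrow> instr list \<Rightarrow> bool" where
  "code_at prog l p \<longleftrightarrow> l + length p \<le> length prog \<and> (\<forall>i<length p. prog ! (l + i) = p ! i)"

lemma code_at_append [simp]:
  "code_at prog l (p @ q) \<longleftrightarrow> code_at prog l p \<and> code_at prog (l + length p) q"
proof -
  have split: "(\<forall>i<m + n. P i) \<longleftrightarrow> (\<forall>i<m. P i) \<and> (\<forall>i<n. P (m + i))" for m n :: nat and P
    by (metis le_Suc_ex nat_add_left_cancel_less not_less trans_less_add1)
  show ?thesis
    unfolding code_at_def length_append split by (auto simp: nth_append add.assoc)
qed

lemma code_at_Cons [simp]:
  "code_at prog l (x # q) \<longleftrightarrow> l < length prog \<and> prog ! l = x \<and> code_at prog (Suc l) q"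
  using code_at_append[of prog l "[x]" q] by (auto simp: code_at_def)

definition runs_compiled :: "instr list \<Rightarrow> nat set \<Rightarrow> com \<Rightarrow> nat \<Rightarrow> bool" where
  "runs_compiled prog A c l \<longleftrightarrow>
    (\<forall>s. (silent_step prog A)\<^sup>*\<^sup>* (l, s) (l + length (compile c l), exec A c s))"

lemma runs_compiled_For:
  assumes distinct_registers: "j \<noteq> b" "j \<notin> written c" "b \<notin> written c"
    and code: "code_at prog l (compile (For j b c) l)" "0 < l"
      "l + length (compile (For j b c) l) < length prog"
    and body: "runs_compiled prog A c (l + 3)"
  shows "runs_compiled prog A (For j b c) l"
  unfolding runs_compiled_def
proof
  fix s
  let ?p = "compile c (l + 3)"
  define t where "t n = ((\<lambda>s. exec A c (s(j := Suc (s j)))) ^^ n) (s(j := 0))" for n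
  have counter: "t n j = n" and bound: "t n b = s b" for n
    by (induction n) (use distinct_registers in \<open>auto simp: t_def exec_unwritten\<close>)
  have loop_Suc: "t (Suc n) = exec A c ((t n)(j := Suc (t n j)))" for n by (simp add: t_def)
  have length_code: "length (compile (For j b c) l) = length ?p + 4" by (simp add: Let_def)
  have instructions: "prog ! l = Rst j" "prog ! (l + 1) = Jump (Equal j b) (l + length ?p + 4)"
    "prog ! (l + 2) = Inc j" "prog ! (l + 3 + length ?p) = Jump Always (l + 1)"
    using code(1) by (auto simp: Let_def numeral_3_eq_3)
  have iteration: "(silent_step prog A)\<^sup>*\<^sup>* (l + 1, t n) (l + 1, t (Suc n))" if "n < s b" for n
  proof -
    have "silent_step prog A (l + 1, t n) (l + 2, t n)"
      using silent_step_no_Jump[OF instructions(2), of A "t n"] code(2,3) that length_code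
      by (simp add: counter bound)
    also have "silent_step prog A (l + 2, t n) (l + 3, (t n)(j := Suc (t n j)))"
      using silent_step_Inc[OF instructions(3), of A "t n"] code(2,3) length_code
      by (simp add: numeral_3_eq_3)
    also have "(silent_step prog A)\<^sup>*\<^sup>* (l + 3, (t n)(j := Suc (t n j)))
        (l + 3 + length ?p, t (Suc n))"
      using body unfolding loop_Suc runs_compiled_def by blast
    also have "silent_step prog A (l + 3 + length ?p, t (Suc n)) (l + 1, t (Suc n))"
      using silent_step_Jump[OF instructions(4)] code(2,3) length_code by simp
    finally show ?thesis by simp
  qed
  have "silent_step prog A (l, s) (l + 1, t 0)"
    using silent_step_Rst[OF instructions(1)] code(2,3) length_code by (simp add: t_def)
  also have "(silent_step prog A)\<^sup>*\<^sup>* (l + 1, t 0) (l + 1, t n)" if "n \<le> s b" for n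
    using that by (induction n) (auto dest: iteration intro: rtranclp_trans simp: Suc_le_eq)
  from this[of "s b"] have "(silent_step prog A)\<^sup>*\<^sup>* (l + 1, t 0) (l + 1, t (s b))" by simp
  also have "silent_step prog A (l + 1, t (s b)) (l + length ?p + 4, t (s b))"
    using silent_step_Jump[OF instructions(2), of A "t (s b)"] code(2,3) length_code
    by (simp add: counter bound)
  finally show "(silent_step prog A)\<^sup>*\<^sup>* (l, s)
      (l + length (compile (For j b c) l), exec A (For j b c) s)"
    unfolding length_code by (simp add: t_def add.assoc)
qed

lemma runs_compiled_Branch:
  assumes code: "code_at prog l (compile (Branch g c d) l)" "0 < l"
      "l + length (compile (Branch g c d) l) < length prog"
    and then_branch: "runs_compiled prog A c (l + length (compile d (l + 1)) + 2)"
    and else_branch: "runs_compiled prog A d (l + 1)"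
  shows "runs_compiled prog A (Branch g c d) l"
  unfolding runs_compiled_def
proof
  fix s
  let ?q = "compile d (l + 1)"
  let ?e = "l + length ?q + 2"
  let ?p = "compile c ?e"
  have length_code: "length (compile (Branch g c d) l) = length ?q + 2 + length ?p"
    by (simp add: Let_def)
  have instructions: "prog ! l = Jump g ?e"
    "prog ! (l + 1 + length ?q) = Jump Always (?e + length ?p)"
    using code(1) by (auto simp: Let_def)
  show "(silent_step prog A)\<^sup>*\<^sup>* (l, s)
      (l + length (compile (Branch g c d) l), exec A (Branch g c d) s)"
  proof (cases "guard_holds A g s")
    case True
    then have "silent_step prog A (l, s) (?e, s)"
      using silent_step_Jump[OF instructions(1)] code(2,3) length_code by simp
    also have "(silent_step prog A)\<^sup>*\<^sup>* (?e, s) (?e + length ?p, exec A c s)"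
      using then_branch unfolding runs_compiled_def by blast
    finally show ?thesis using True unfolding length_code by (simp add: add.assoc)
  next
    case False
    then have "silent_step prog A (l, s) (l + 1, s)"
      using silent_step_no_Jump[OF instructions(1)] code(2,3) length_code by simp
    also have "(silent_step prog A)\<^sup>*\<^sup>* (l + 1, s) (l + 1 + length ?q, exec A d s)"
      using else_branch unfolding runs_compiled_def by blast
    also have "silent_step prog A (l + 1 + length ?q, exec A d s) (?e + length ?p, exec A d s)"
      using silent_step_Jump[OF instructions(2)] code(2,3) length_code by simp
    finally show ?thesis using False unfolding length_code by (simp add: add.assoc)
  qed
qed

lemma compile_correct:
  assumes "well_formed c" "code_at prog l (compile c l)" "0 < l"
    "l + length (compile c l) < length prog"
  shows "runs_compiled prog A c l"
  using assms
proof (induction c arbitrary: l)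
  case Skip
  then show ?case by (simp add: runs_compiled_def)
next
  case (Increment r)
  then show ?case
    by (auto intro!: r_into_rtranclp silent_step_Inc simp: runs_compiled_def
      simp del: fun_upd_apply)
next
  case (Reset r)
  then show ?case
    by (auto intro!: r_into_rtranclp silent_step_Rst simp: runs_compiled_def
      simp del: fun_upd_apply)
next
  case (Seq c d)
  have "runs_compiled prog A c l" "runs_compiled prog A d (l + length (compile c l))"
    by (rule Seq.IH; use Seq.prems in \<open>auto simp: Let_def\<close>)+
  then show ?case
    unfolding runs_compiled_def by (auto simp: Let_def add.assoc intro: rtranclp_trans)
next
  case (For j b c)
  have "runs_compiled prog A c (l + 3)"
    by (rule For.IH) (use For.prems in \<open>auto simp: Let_def numeral_3_eq_3\<close>)
  then show ?case using For.prems by (intro runs_compiled_For) auto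
next
  case (Branch g c d)
  have "runs_compiled prog A c (l + length (compile d (l + 1)) + 2)"
    "runs_compiled prog A d (l + 1)"
    by (rule Branch.IH; use Branch.prems in \<open>auto simp: Let_def\<close>)+
  then show ?case using Branch.prems by (intro runs_compiled_Branch) auto
qed

section \<open>Programs evaluating formulas\<close>

abbreviation Copy :: "nat \<Rightarrow> nat \<Rightarrow> com" where "Copy d a \<equiv> For d a Skip"

text \<open>Walks \<open>s d\<close> steps along the diagonals of the Cantor enumeration, keeping the current first
  component in \<open>d + 2\<close> and the index of the diagonal in \<open>d + 1\<close>.\<close>

definition unpair_com :: "nat \<Rightarrow> com" where
  "unpair_com d = block [Reset (d + 1), Reset (d + 2),
    For (d + 3) d (Branch (Equal (d + 2) (d + 1))
      (Seq (Increment (d + 1)) (Reset (d + 2))) (Increment (d + 2)))]"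

text \<open>Register 0 holds the input and is never written, register 1 bounds the instances checked so
  far, register 2 is reserved for the oracle track, registers 3 and 4 hold the current instance
  and witness.\<close>

fun pterm_com :: "pterm \<Rightarrow> nat \<Rightarrow> com" where
  "pterm_com Input d = Copy d 0"
| "pterm_com Instance d = Copy d 3"
| "pterm_com Witness d = Copy d 4"
| "pterm_com Nought d = Reset d"
| "pterm_com (Next a) d = Seq (pterm_com a d) (Increment d)"
| "pterm_com (PairT a b) d = block [pterm_com a d, pterm_com b (d + 1), Copy (d + 2) d,
    For (d + 3) (d + 1) (Increment (d + 2)),
    For (d + 3) (d + 2) (For (d + 4) (d + 3) (Increment d))]"
| "pterm_com (First a) d = block [pterm_com a d, unpair_com d, Copy d (d + 2)]"
| "pterm_com (Second a) d = block [pterm_com a d, unpair_com d, Reset d, Reset (d + 4),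
    For (d + 3) (d + 1) (Branch (Equal (d + 4) (d + 2)) (Increment d) (Increment (d + 4)))]"

abbreviation set_flag :: "guard \<Rightarrow> nat \<Rightarrow> com" where
  "set_flag g d \<equiv> Branch g (Seq (Reset d) (Increment d)) (Reset d)"

fun formula_com :: "formula \<Rightarrow> nat \<Rightarrow> com" where
  "formula_com (Eq a b) d = block [pterm_com a d, pterm_com b (d + 1),
      set_flag (Equal d (d + 1)) d]"
| "formula_com (In a) d = block [pterm_com a d, Copy (d + 1) 0, Increment (d + 1),
    For (d + 2) d (Increment (d + 1)), set_flag (Member (d + 1)) d]"
| "formula_com (Nand f g) d = block [formula_com f d, formula_com g (d + 1), Reset (d + 2),
    Branch (Equal d (d + 2)) (Increment d) (Branch (Equal (d + 1) (d + 2)) Skip (Reset d))]"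

lemma written_pterm_com: "written (pterm_com t d) \<subseteq> {d..}"
  by (induction t arbitrary: d) (fastforce simp: unpair_com_def)+

lemma written_formula_com: "written (formula_com f d) \<subseteq> {d..}"
proof (induction f arbitrary: d)
  case (Eq a b)
  then show ?case using written_pterm_com[of a d] written_pterm_com[of b "d + 1"] by fastforce
next
  case (In a)
  then show ?case using written_pterm_com[of a d] by fastforce
next
  case (Nand f g)
  then show ?case by fastforce
qed

lemma well_formed_pterm_com: "5 \<le> d \<Longrightarrow> well_formed (pterm_com t d)"
  by (induction t arbitrary: d) (auto simp: unpair_com_def)

lemma well_formed_formula_com: "5 \<le> d \<Longrightarrow> well_formed (formula_com f d)"
  by (induction f arbitrary: d) (auto simp: well_formed_pterm_com)

lemma exec_Copy [simp]:
  assumes "d \<noteq> a"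
  shows "exec A (Copy d a) s = s(d := s a)"
proof -
  have "((\<lambda>s. s(d := Suc (s d))) ^^ n) (s(d := 0)) = s(d := n)" for n
    by (induction n) auto
  with assms show ?thesis by simp
qed

lemma exec_For_Increment:
  assumes "j \<noteq> b" "j \<noteq> r" "b \<noteq> r"
  shows "exec A (For j b (Increment r)) s = s(j := s b, r := s r + s b)"
proof -
  have "((\<lambda>s. exec A (Increment r) (s(j := Suc (s j)))) ^^ n) (s(j := 0)) = s(j := n, r := s r + n)"
    for n
    by (induction n) (use assms in \<open>auto simp: fun_eq_iff\<close>)
  then show ?thesis using assms by simp
qed

lemma exec_For_For_Increment:
  assumes "distinct [i, j, b, r]"
  shows "exec A (For i b (For j i (Increment r))) s r = s r + triangle (s b)"
proof -
  let ?body = "\<lambda>s. exec A (For j i (Increment r)) (s(i := Suc (s i)))"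
  have "(?body ^^ n) (s(i := 0)) i = n \<and> (?body ^^ n) (s(i := 0)) r = s r + triangle n" for n
    by (induction n) (use assms in \<open>auto simp: exec_For_Increment simp del: exec.simps\<close>)
  then show ?thesis by simp
qed

lemma exec_unpair_com:
  shows "exec A (unpair_com d) s (d + 2) = pair_fst (s d)"
    and "exec A (unpair_com d) s (d + 1) = pair_fst (s d) + pair_snd (s d)"
    and "r \<le> d \<Longrightarrow> exec A (unpair_com d) s r = s r"
proof -
  let ?walk = "\<lambda>s. exec A (Branch (Equal (d + 2) (d + 1)) (Seq (Increment (d + 1)) (Reset (d + 2)))
    (Increment (d + 2))) (s(d + 3 := Suc (s (d + 3))))"
  let ?start = "s(d + 1 := 0, d + 2 := 0, d + 3 := 0)"
  have "(?walk ^^ n) ?start (d + 2) = pair_fst n \<and>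
      (?walk ^^ n) ?start (d + 1) = pair_fst n + pair_snd n" for n
  proof (induction n)
    case 0
    show ?case by (simp add: prod_decode_0)
  next
    case (Suc n)
    then show ?case by (auto simp: prod_decode_Suc)
  qed
  from this[of "s d"]
  show "exec A (unpair_com d) s (d + 2) = pair_fst (s d)"
    "exec A (unpair_com d) s (d + 1) = pair_fst (s d) + pair_snd (s d)"
    by (simp_all add: unpair_com_def)
  show "r \<le> d \<Longrightarrow> exec A (unpair_com d) s r = s r"
    by (rule exec_unwritten) (auto simp: unpair_com_def)
qed

lemma exec_For_diff:
  assumes "distinct [j, b, y, c, x]" "s y = 0" "s c = 0" "s x \<le> s b"
  shows "exec A (For j b (Branch (Equal c x) (Increment y) (Increment c))) s y = s b - s x"
proof -
  let ?body = "\<lambda>s. exec A (Branch (Equal c x) (Increment y) (Increment c)) (s(j := Suc (s j)))"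
  define t where "t n = (?body ^^ n) (s(j := 0))" for n
  have loop_Suc: "t (Suc n) = ?body (t n)" for n by (simp add: t_def)
  have "t n x = s x \<and> t n y = n - s x \<and> t n c = min n (s x)" for n
  proof (induction n)
    case 0
    then show ?case using assms by (auto simp: t_def)
  next
    case (Suc n)
    then show ?case using assms(1) by (auto simp: loop_Suc min_def split: if_splits) arith+
  qed
  then show ?thesis by (simp add: t_def)
qed

lemma exec_pterm_com_below: "r < d \<Longrightarrow> exec A (pterm_com t d) s r = s r"
  by (rule exec_unwritten) (use written_pterm_com[of t d] in auto)

lemma exec_formula_com_below: "r < d \<Longrightarrow> exec A (formula_com f d) s r = s r"
  by (rule exec_unwritten) (use written_formula_com[of f d] in auto)

lemma exec_pterm_com: "5 \<le> d \<Longrightarrow> exec A (pterm_com t d) s d = pterm_val (s 0) (s 3) (s 4) t"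
proof (induction t arbitrary: d s)
  case (PairT a b)
  let ?s = "exec A (pterm_com b (d + 1)) (exec A (pterm_com a d) s)"
  have value_a: "?s d = pterm_val (s 0) (s 3) (s 4) a"
    using PairT by (simp add: exec_pterm_com_below)
  have value_b: "?s (d + 1) = pterm_val (s 0) (s 3) (s 4) b"
    using PairT by (simp add: exec_pterm_com_below)
  have "exec A (pterm_com (PairT a b) d) s d = ?s d + triangle (?s d + ?s (d + 1))"
    by (simp add: exec_For_For_Increment exec_For_Increment del: exec.simps(5))
  then show ?case by (simp only: value_a value_b pterm_val.simps) (simp add: prod_encode_def)
next
  case (First a)
  then show ?case by (simp add: exec_unpair_com[simplified] del: exec.simps(5))
next
  case (Second a)
  let ?s = "exec A (unpair_com d) (exec A (pterm_com a d) s)"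
  let ?t = "?s(d := 0, d + 4 := 0)"
  have "exec A (pterm_com (Second a) d) s d = ?t (d + 1) - ?t (d + 2)"
    using exec_For_diff[of "d + 3" "d + 1" d "d + 4" "d + 2" ?t A]
    by (simp add: exec_unpair_com[simplified] del: exec.simps(5))
  with Second show ?case by (simp add: exec_unpair_com[simplified])
qed (auto simp del: exec.simps(5))

lemma exec_formula_com:
  "5 \<le> d \<Longrightarrow> exec A (formula_com f d) s d =
      (if sat {e. e + s 0 + 1 \<in> A} (s 0) (s 3) (s 4) f then 1 else 0)"
proof (induction f arbitrary: d s)
  case (Eq a b)
  then show ?case by (simp add: exec_pterm_com exec_pterm_com_below)
next
  case (In a)
  then show ?case
    by (simp add: exec_pterm_com exec_pterm_com_below exec_For_Increment del: exec.simps(5))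
      (simp add: add.commute)
next
  case (Nand f g)
  then show ?case by (simp add: exec_formula_com_below)
qed

section \<open>The recurrent program\<close>

text \<open>One pass through \<open>search_com\<close> tests the current witness and then proceeds to the next
  witness or to the next instance; it leaves registers 5 and 6 different iff the last instance has
  been settled.\<close>

definition search_com :: "formula \<Rightarrow> com" where
  "search_com \<phi> = block [formula_com \<phi> 5, Reset 6,
    Branch (Equal 5 6) (Increment 4)
      (Branch (Equal 3 1) Skip (block [Increment 3, Reset 4, Reset 5]))]"

definition register_bound :: "formula \<Rightarrow> nat" where
  "register_bound \<phi> = Suc (Max (used (search_com \<phi>)))"

definition clean_com :: "formula \<Rightarrow> com" where
  "clean_com \<phi> = block (map (\<lambda>r. Copy r 0) [3..<register_bound \<phi>])"

definition main_prog :: "formula \<Rightarrow> instr list" where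
  "main_prog \<phi> = (let l = 3 + length (compile (search_com \<phi>) 3) in
    [Inc 1, Rst 3, Rst 4] @ compile (search_com \<phi>) 3 @ Jump (Equal 5 6) 3 #
    compile (clean_com \<phi>) (l + 1) @ [Jump Always 0])"

lemma well_formed_search_com: "well_formed (search_com \<phi>)"
  by (simp add: search_com_def well_formed_formula_com)

lemma exec_search_com:
  fixes A \<phi> and s :: registers
  defines "holds \<equiv> sat {e. e + s 0 + 1 \<in> A} (s 0) (s 3) (s 4) \<phi>"
    and "t \<equiv> exec A (search_com \<phi>) s"
  shows "\<not> holds \<Longrightarrow> t 5 = t 6 \<and> t 4 = Suc (s 4) \<and> (\<forall>r<4. t r = s r)"
    and "holds \<Longrightarrow> s 3 \<noteq> s 1 \<Longrightarrow> t 5 = t 6 \<and> t 4 = 0 \<and> t 3 = Suc (s 3) \<and> (\<forall>r<3. t r = s r)"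
    and "holds \<Longrightarrow> s 3 = s 1 \<Longrightarrow> t 5 \<noteq> t 6 \<and> (\<forall>r<5. t r = s r)"
proof -
  have "exec A (formula_com \<phi> 5) s 5 = (if holds then 1 else 0)"
    unfolding holds_def by (rule exec_formula_com) simp
  moreover have "exec A (formula_com \<phi> 5) s r = s r" if "r < 5" for r
    using that by (rule exec_formula_com_below)
  ultimately show "\<not> holds \<Longrightarrow> t 5 = t 6 \<and> t 4 = Suc (s 4) \<and> (\<forall>r<4. t r = s r)"
    and "holds \<Longrightarrow> s 3 \<noteq> s 1 \<Longrightarrow> t 5 = t 6 \<and> t 4 = 0 \<and> t 3 = Suc (s 3) \<and> (\<forall>r<3. t r = s r)"
    and "holds \<Longrightarrow> s 3 = s 1 \<Longrightarrow> t 5 \<noteq> t 6 \<and> (\<forall>r<5. t r = s r)"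
    by (auto simp: t_def search_com_def)
qed

lemma well_formed_clean_com: "well_formed (clean_com \<phi>)"
proof -
  have "\<forall>r\<in>set rs. 0 < r \<Longrightarrow> well_formed (block (map (\<lambda>r. Copy r 0) rs))" for rs :: "nat list"
    by (induction rs) auto
  then show ?thesis by (auto simp: clean_com_def)
qed

lemma exec_clean_com:
  "exec A (clean_com \<phi>) s r = (if r \<in> {3..<register_bound \<phi>} then s 0 else s r)"
proof -
  have "\<forall>r\<in>set rs. 0 < r \<Longrightarrow> exec A (block (map (\<lambda>r. Copy r 0) rs)) s r =
      (if r \<in> set rs then s 0 else s r)"
    for rs :: "nat list" and s
    by (induction rs arbitrary: s) (auto simp del: exec.simps(5))
  from this[of "[3..<register_bound \<phi>]"] show ?thesis by (auto simp: clean_com_def)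
qed

locale recurrent_program =
  fixes \<phi> :: formula and A :: "nat set" and p :: nat
begin

abbreviation "prog \<equiv> main_prog \<phi>"
abbreviation "search_end \<equiv> 3 + length (compile (search_com \<phi>) 3)"
abbreviation "clean_end \<equiv> search_end + 1 + length (compile (clean_com \<phi>) (search_end + 1))"
abbreviation "silent \<equiv> silent_step prog A"
abbreviation "step \<equiv> machine_step prog A"
abbreviation "holds i v \<equiv> sat {e. e + p + 1 \<in> A} p i v \<phi>"

lemma length_main_prog: "length prog = Suc clean_end"
  by (simp add: main_prog_def Let_def)

lemma main_prog_nth:
  "prog ! 0 = Inc 1" "prog ! 1 = Rst 3" "prog ! 2 = Rst 4"
  "prog ! search_end = Jump (Equal 5 6) 3" "prog ! clean_end = Jump Always 0"
  and code_at_main_prog: "code_at prog 3 (compile (search_com \<phi>) 3)"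
  "code_at prog (search_end + 1) (compile (clean_com \<phi>) (search_end + 1))"
proof -
  have "code_at prog 0 prog" by (simp add: code_at_def)
  moreover have "prog = [Inc 1, Rst 3, Rst 4] @ compile (search_com \<phi>) 3 @ Jump (Equal 5 6) 3 #
    compile (clean_com \<phi>) (search_end + 1) @ [Jump Always 0]" by (simp add: main_prog_def Let_def)
  ultimately have "code_at prog 0
    ([Inc 1, Rst 3, Rst 4] @ compile (search_com \<phi>) 3 @ Jump (Equal 5 6) 3 #
    compile (clean_com \<phi>) (search_end + 1) @ [Jump Always 0])" by metis
  then show "prog ! 0 = Inc 1" "prog ! 1 = Rst 3" "prog ! 2 = Rst 4"
    "prog ! search_end = Jump (Equal 5 6) 3" "prog ! clean_end = Jump Always 0"
    "code_at prog 3 (compile (search_com \<phi>) 3)"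
    "code_at prog (search_end + 1) (compile (clean_com \<phi>) (search_end + 1))"
    by (simp_all add: eval_nat_numeral)
qed

lemma step_0: "step (0, s) = (1, s(1 := Suc (s 1)))"
  using main_prog_nth(1) length_main_prog by (simp add: machine_step_def next_label_def)

lemma silent_1: "silent\<^sup>*\<^sup>* (1, s) (3, s(3 := 0, 4 := 0))"
proof -
  have "silent (1, s) (2, s(3 := 0))"
    using silent_step_Rst[OF main_prog_nth(2)] length_main_prog by (simp add: numeral_2_eq_2)
  also have "silent (2, s(3 := 0)) (3, s(3 := 0, 4 := 0))"
    using silent_step_Rst[OF main_prog_nth(3)] length_main_prog by simp
  finally show ?thesis .
qed

lemma silent_search: "silent\<^sup>*\<^sup>* (3, s) (search_end, exec A (search_com \<phi>) s)"
  using compile_correct[OF well_formed_search_com code_at_main_prog(1)] length_main_prog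
  by (simp add: runs_compiled_def)

lemma silent_search_again:
  assumes "exec A (search_com \<phi>) s 5 = exec A (search_com \<phi>) s 6"
  shows "silent\<^sup>+\<^sup>+ (3, s) (3, exec A (search_com \<phi>) s)"
proof -
  have "silent (search_end, exec A (search_com \<phi>) s) (3, exec A (search_com \<phi>) s)"
    using silent_step_Jump[OF main_prog_nth(4)] assms length_main_prog by simp
  with silent_search show ?thesis by (rule rtranclp_into_tranclp1)
qed

lemma silent_search_finish:
  assumes "exec A (search_com \<phi>) s 5 \<noteq> exec A (search_com \<phi>) s 6"
  shows "silent\<^sup>*\<^sup>* (3, s) (0, exec A (clean_com \<phi>) (exec A (search_com \<phi>) s))"
proof -
  let ?t = "exec A (search_com \<phi>) s"
  note silent_search
  also have "silent (search_end, ?t) (search_end + 1, ?t)"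
    using silent_step_no_Jump[OF main_prog_nth(4)] assms length_main_prog by simp
  also have "silent\<^sup>*\<^sup>* (search_end + 1, ?t) (clean_end, exec A (clean_com \<phi>) ?t)"
    using compile_correct[OF well_formed_clean_com code_at_main_prog(2)] length_main_prog
    by (simp add: runs_compiled_def)
  also have "silent (clean_end, exec A (clean_com \<phi>) ?t) (0, exec A (clean_com \<phi>) ?t)"
    using silent_step_Jump[OF main_prog_nth(5)] length_main_prog by simp
  finally show ?thesis .
qed

definition clean :: "registers \<Rightarrow> bool" where
  "clean s \<longleftrightarrow> s 0 = p \<and> (\<forall>r. 3 \<le> r \<and> r < register_bound \<phi> \<longrightarrow> s r = p)"

lemma search_cases [consumes 1]:
  assumes "s 0 = p"
  obtains (next_witness) t where "silent\<^sup>+\<^sup>+ (3, s) (3, t)" "\<not> holds (s 3) (s 4)"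
      "t 4 = Suc (s 4)" "\<forall>r<4. t r = s r"
  | (next_instance) t where "silent\<^sup>+\<^sup>+ (3, s) (3, t)" "holds (s 3) (s 4)" "s 3 \<noteq> s 1"
      "t 4 = 0" "t 3 = Suc (s 3)" "\<forall>r<3. t r = s r"
  | (finished) t where "silent\<^sup>*\<^sup>* (3, s) (0, t)" "holds (s 3) (s 4)" "s 3 = s 1" "t 1 = s 1"
    "clean t"
proof -
  note search = exec_search_com[of s A \<phi>, unfolded assms]
  consider (fails) "\<not> holds (s 3) (s 4)"
    | (settles) "holds (s 3) (s 4)" "s 3 \<noteq> s 1"
    | (settles_last) "holds (s 3) (s 4)" "s 3 = s 1"
    by blast
  then show ?thesis
  proof cases
    case fails
    with search(1) silent_search_again show ?thesis
      by (intro next_witness[of "exec A (search_com \<phi>) s"]) auto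
  next
    case settles
    with search(2) silent_search_again show ?thesis
      by (intro next_instance[of "exec A (search_com \<phi>) s"]) auto
  next
    case settles_last
    with search(3) silent_search_finish assms show ?thesis
      by (intro finished[of "exec A (clean_com \<phi>) (exec A (search_com \<phi>) s)"])
        (auto simp: exec_clean_com clean_def)
  qed
qed

lemma search_halting_imp_holds:
  assumes "(silent ^^ n) (3, s) (0, u)" "s 0 = p" "s 3 \<le> s 1" "\<And>i. i < s 3 \<Longrightarrow> \<exists>v. holds i v"
  shows "u 0 = p \<and> u 1 = s 1 \<and> (\<forall>i\<le>s 1. \<exists>v. holds i v)"
  using assms
proof (induction n arbitrary: s rule: less_induct)
  case (less n)
  from less.prems(2) show ?case
  proof (cases rule: search_cases[of s])
    case (next_witness t)
    from proper_silent_steps_halting[OF next_witness(1) less.prems(1)]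
    obtain m where "m < n" "(silent ^^ m) (3, t) (0, u)" by blast
    from less.IH[OF this] show ?thesis using next_witness less.prems by simp
  next
    case (next_instance t)
    from proper_silent_steps_halting[OF next_instance(1) less.prems(1)]
    obtain m where "m < n" "(silent ^^ m) (3, t) (0, u)" by blast
    from less.IH[OF this] show ?thesis using next_instance less.prems by (auto simp: less_Suc_eq)
  next
    case (finished t)
    from silent_steps_halting[OF finished(1) less.prems(1)]
    obtain m where "(silent ^^ m) (0, t) (0, u)" by blast
    then have "u = t"
      using no_silent_step_0 by (cases m) (auto dest!: relpowp_Suc_D2 simp del: relpowp.simps(2))
    then show ?thesis using finished less.prems by (auto simp: clean_def le_less)
  qed
qed

lemma round_halting_imp_holds:
  assumes "(silent ^^ n) (1, s) (0, u)" "s 0 = p"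
  shows "u 0 = p \<and> u 1 = s 1 \<and> (\<forall>i\<le>s 1. \<exists>v. holds i v)"
proof -
  obtain m where "(silent ^^ m) (3, s(3 := 0, 4 := 0)) (0, u)"
    using silent_steps_halting[OF silent_1 assms(1)] by blast
  from search_halting_imp_holds[OF this] show ?thesis using assms(2) by simp
qed

lemma search_witness:
  assumes "s 0 = p" "holds (s 3) v" "s 4 \<le> v"
  shows "\<exists>t. silent\<^sup>*\<^sup>* (3, s) (3, t) \<and> holds (t 3) (t 4) \<and> (\<forall>r<4. t r = s r)"
  using assms
proof (induction "v - s 4" arbitrary: s rule: less_induct)
  case less
  from less.prems(1) show ?case
  proof (cases rule: search_cases[of s])
    case (next_witness t)
    then have "s 4 < v" using less.prems by (metis order_le_imp_less_or_eq)
    then obtain u where continued: "silent\<^sup>*\<^sup>* (3, t) (3, u)" "holds (u 3) (u 4)" "\<forall>r<4. u r = t r"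
      using less.hyps[of t] next_witness less.prems diff_less_mono2[of "s 4" "t 4" v] by auto
    have "silent\<^sup>*\<^sup>* (3, s) (3, u)"
      using next_witness(1) continued(1) by (meson rtranclp_trans tranclp_into_rtranclp)
    then show ?thesis using continued next_witness by auto
  qed auto
qed

lemma search_halts:
  assumes "s 0 = p" "s 4 = 0" "s 3 \<le> s 1" "\<And>i. \<exists>v. holds i v"
  shows "\<exists>u. silent\<^sup>*\<^sup>* (3, s) (0, u) \<and> clean u \<and> u 1 = s 1"
  using assms
proof (induction "s 1 - s 3" arbitrary: s rule: less_induct)
  case less
  obtain v where "holds (s 3) v" using less.prems by blast
  then obtain t where found: "silent\<^sup>*\<^sup>* (3, s) (3, t)" "holds (t 3) (t 4)" "\<forall>r<4. t r = s r"
    using search_witness[of s v, OF less.prems(1)] less.prems(2) by auto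
  have "t 0 = p" using found less.prems(1) by simp
  from \<open>t 0 = p\<close> show ?case
  proof (cases rule: search_cases[of t])
    case (next_instance u)
    then obtain w where rest: "silent\<^sup>*\<^sup>* (3, u) (0, w)" "clean w" "w 1 = s 1"
      using less.hyps[of u] less.prems found next_instance diff_less_mono2[of "s 3" "u 3" "s 1"]
      by auto
    have "silent\<^sup>*\<^sup>* (3, s) (0, w)"
      using found(1) next_instance(1) rest(1) by (meson rtranclp_trans tranclp_into_rtranclp)
    with rest show ?thesis by blast
  next
    case (finished u)
    with found show ?thesis by (auto intro: rtranclp_trans)
  qed (use found in blast)
qed

lemma round_halts:
  assumes "s 0 = p" "\<And>i. \<exists>v. holds i v"
  shows "\<exists>u. silent\<^sup>*\<^sup>* (1, s) (0, u) \<and> clean u \<and> u 1 = s 1"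
proof -
  obtain u where "silent\<^sup>*\<^sup>* (3, s(3 := 0, 4 := 0)) (0, u)" "clean u" "u 1 = s 1"
    using search_halts[of "s(3 := 0, 4 := 0)"] assms by auto
  with silent_1 show ?thesis by (meson rtranclp_trans)
qed

theorem holds_if_recurs:
  assumes "s 0 = p" "recurs (\<lambda>c. fst c = 0) step (1, s)"
  shows "\<exists>v. holds i v"
proof -
  have halts: "\<exists>n u. (silent ^^ n) ((step ^^ k) (1, s)) (0, u) \<and>
      (step ^^ n) ((step ^^ k) (1, s)) = (0, u)" for k
  proof -
    have "recurs (\<lambda>c. fst c = 0) step ((step ^^ k) (1, s))" by (simp only: recurs_funpow assms(2))
    then show ?thesis by (rule recursE) (rule funpow_halting_imp_silent_steps)
  qed
  have bound_grows: "\<exists>k u. (step ^^ k) (1, s) = (1, u) \<and> u 0 = p \<and> m \<le> u 1" for m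
  proof (induction m)
    case 0
    then show ?case using assms(1) by (intro exI[of _ 0]) auto
  next
    case (Suc m)
    then obtain k u where reached: "(step ^^ k) (1, s) = (1, u)" "u 0 = p" "m \<le> u 1" by blast
    then obtain n w where round: "(silent ^^ n) (1, u) (0, w)" "(step ^^ n) (1, u) = (0, w)"
      using halts[of k] by auto
    have "(step ^^ Suc (n + k)) (1, s) = (1, w(1 := Suc (w 1)))"
      using reached(1) round(2) step_0 by (simp add: funpow_add)
    then show ?case
      using round_halting_imp_holds[OF round(1) reached(2)] reached(3)
      by (intro exI[of _ "Suc (n + k)"] exI[of _ "w(1 := Suc (w 1))"]) auto
  qed
  then obtain k u where reached: "(step ^^ k) (1, s) = (1, u)" "u 0 = p" "i \<le> u 1" by blast
  with halts[of k] obtain n w where "(silent ^^ n) (1, u) (0, w)" by auto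
  from round_halting_imp_holds[OF this] reached show ?thesis by blast
qed

theorem recurs_if_holds:
  assumes "s 0 = p" "\<And>i. \<exists>v. holds i v"
  shows "\<exists>k\<ge>n. \<exists>u. (step ^^ k) (0, s) = (0, u) \<and> clean u \<and> s 1 < u 1"
proof -
  have again: "\<exists>k\<ge>1. \<exists>u. (step ^^ k) (0, s) = (0, u) \<and> clean u \<and> s 1 < u 1"
    if input: "s 0 = p" for s
  proof -
    let ?s = "s(1 := Suc (s 1))"
    obtain u where round: "silent\<^sup>*\<^sup>* (1, ?s) (0, u)" "clean u" "u 1 = ?s 1"
      using round_halts[of ?s] assms(2) input by auto
    obtain k where "(0, u) = (step ^^ k) (1, ?s)"
      using silent_steps_imp_funpow[OF round(1)] by blast
    then have "(step ^^ Suc k) (0, s) = (0, u)"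
      by (simp only: funpow_Suc_right o_apply step_0)
    with round show ?thesis by (intro exI[of _ "Suc k"]) auto
  qed
  show ?thesis
  proof (induction n)
    case 0
    show ?case using again[of s, OF assms(1)] by auto
  next
    case (Suc n)
    then obtain k u where run: "k \<ge> n" "(step ^^ k) (0, s) = (0, u)" "clean u" "s 1 < u 1" by blast
    obtain k' w where next_run: "k' \<ge> 1" "(step ^^ k') (0, u) = (0, w)" "clean w" "u 1 < w 1"
      using again[of u] run(3) by (auto simp: clean_def)
    have "(step ^^ (k' + k)) (0, s) = (0, w)" using run(2) next_run(2) by (simp add: funpow_add)
    then show ?case using run next_run by (intro exI[of _ "k' + k"]) auto
  qed
qed

end

section \<open>Counter machines in a cellular automaton\<close>

text \<open>The machine lives to the right of an \<open>Origin\<close> cell. Register \<open>r\<close> holds the distance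
  from \<open>Origin\<close> to the leftmost mark \<open>r\<close>; further marks \<open>r\<close> are garbage which increments swallow.
  Accordingly, resetting a register only adds a mark on the \<open>Origin\<close> cell. A head \<open>Outward l\<close>
  runs to the cell where instruction \<open>l\<close> takes effect and returns as \<open>Inward l b\<close> with the outcome
  \<open>b\<close> of the test. The marks 2 are the oracle.\<close>

datatype region = Outside | Origin | Inside
datatype head = Absent | Outward nat | Inward nat bool
datatype cell = Cell (region: region) (marks: "nat set") (head: head)

definition fetch :: "instr list \<Rightarrow> nat \<Rightarrow> instr" where
  "fetch prog l = (if l < length prog then prog ! l else Jump Always 0)"

fun reads :: "instr \<Rightarrow> nat set" where
  "reads (Inc r) = {r}"
| "reads (Rst r) = {}"
| "reads (Jump g l) = guard_regs g"

fun writes :: "instr \<Rightarrow> nat set" where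
  "writes (Inc r) = {r}"
| "writes (Rst r) = {r}"
| "writes (Jump g l) = {}"

definition stops :: "instr \<Rightarrow> nat set \<Rightarrow> bool" where
  "stops i S \<longleftrightarrow> reads i = {} \<or> reads i \<inter> S \<noteq> {}"

fun answer :: "instr \<Rightarrow> nat set \<Rightarrow> bool" where
  "answer (Jump Always l) S \<longleftrightarrow> True"
| "answer (Jump (Equal a b) l) S \<longleftrightarrow> a \<in> S \<and> b \<in> S"
| "answer (Jump (Member r) l) S \<longleftrightarrow> 2 \<in> S"
| "answer _ S \<longleftrightarrow> False"

fun act :: "instr \<Rightarrow> nat set \<Rightarrow> nat set" where
  "act (Inc r) S = S - {r}"
| "act (Rst r) S = insert r S"
| "act (Jump g l) S = S"

fun push :: "instr \<Rightarrow> nat set" where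
  "push (Inc r) = {r}"
| "push _ = {}"

fun place :: "instr \<Rightarrow> nat \<Rightarrow> registers \<Rightarrow> registers" where
  "place (Inc r) i s = s(r := Suc i)"
| "place (Rst r) i s = s(r := 0)"
| "place (Jump g l) i s = s"

definition running :: "instr list \<Rightarrow> cell \<Rightarrow> bool" where
  "running prog c \<longleftrightarrow> (\<exists>l. head c = Outward l \<and> \<not> stops (fetch prog l) (marks c))"

definition executed :: "instr list \<Rightarrow> cell \<Rightarrow> instr option" where
  "executed prog c = (case head c of
      Outward l \<Rightarrow> if stops (fetch prog l) (marks c) then Some (fetch prog l) else None
    | _ \<Rightarrow> None)"

text \<open>Nothing enters a cell from an \<open>Outside\<close> neighbour on its left, outward heads annihilate
  inward ones, and everything to the right of \<open>Origin\<close> is turned into \<open>Inside\<close> at speed 1.\<close>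

definition next_region :: "cell \<Rightarrow> cell \<Rightarrow> region" where
  "next_region l c = (if region l \<noteq> Outside then Inside else region c)"

definition next_marks :: "instr list \<Rightarrow> cell \<Rightarrow> cell \<Rightarrow> nat set" where
  "next_marks prog l c =
    (case executed prog c of Some i \<Rightarrow> act i (marks c) | None \<Rightarrow> marks c) \<union>
    (case executed prog l of Some i \<Rightarrow> if region l \<noteq> Outside then push i else {} | None \<Rightarrow> {})"

definition received_head :: "cell \<Rightarrow> head" where
  "received_head r = (case head r of Inward a b \<Rightarrow> Inward a b | _ \<Rightarrow> Absent)"

definition next_head :: "instr list \<Rightarrow> cell \<Rightarrow> cell \<Rightarrow> cell \<Rightarrow> head" where
  "next_head prog l c r =
    (if region l \<noteq> Outside \<and> running prog l then head l
     else case head c of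
        Absent \<Rightarrow> received_head r
      | Outward a \<Rightarrow>
          if stops (fetch prog a) (marks c) then Inward a (answer (fetch prog a) (marks c))
          else Absent
      | Inward a b \<Rightarrow> if region c = Origin \<and> region l = Outside then Outward (next_label prog a b)
          else received_head r)"

definition cell_rule :: "instr list \<Rightarrow> cell \<Rightarrow> cell \<Rightarrow> cell \<Rightarrow> cell" where
  "cell_rule prog l c r = Cell (next_region l c) (next_marks prog l c) (next_head prog l c r)"

definition left_cell :: "(nat \<Rightarrow> cell) \<Rightarrow> nat \<Rightarrow> cell" where
  "left_cell z j = (case j of 0 \<Rightarrow> Cell Outside {} Absent | Suc k \<Rightarrow> z k)"

definition half_step :: "instr list \<Rightarrow> (nat \<Rightarrow> cell) \<Rightarrow> nat \<Rightarrow> cell" where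
  "half_step prog z j = cell_rule prog (left_cell z j) (z j) (z (Suc j))"

lemma left_cell_simps [simp]: "left_cell z 0 = Cell Outside {} Absent" "left_cell z (Suc j) = z j"
  by (simp_all add: left_cell_def)

lemma cell_rule_sel [simp]:
  "region (cell_rule prog l c r) = next_region l c"
  "marks (cell_rule prog l c r) = next_marks prog l c"
  "head (cell_rule prog l c r) = next_head prog l c r"
  by (simp_all add: cell_rule_def)

lemma executed_eq_Some_iff:
  "executed prog c = Some i \<longleftrightarrow> (\<exists>l. head c = Outward l \<and> i = fetch prog l \<and> stops i (marks c))"
  by (auto simp: executed_def split: head.splits)

lemma executed_None_if_not_Outward: "(\<And>l. head c \<noteq> Outward l) \<Longrightarrow> executed prog c = None"
  by (auto simp: executed_def split: head.splits)

lemma executed_None_if_running: "running prog c \<Longrightarrow> executed prog c = None"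
  by (auto simp: executed_def running_def)

lemma mem_act_iff: "r \<notin> writes i \<Longrightarrow> r \<in> act i S \<longleftrightarrow> r \<in> S"
  by (cases i) auto

lemma push_subset_writes: "push i \<subseteq> writes i"
  by (cases i) auto

lemma mem_next_marks_iff:
  assumes "\<And>i. executed prog c = Some i \<Longrightarrow> r \<notin> writes i"
    "\<And>i. executed prog l = Some i \<Longrightarrow> r \<notin> writes i"
  shows "r \<in> next_marks prog l c \<longleftrightarrow> r \<in> marks c"
proof -
  have "r \<in> act i (marks c) \<longleftrightarrow> r \<in> marks c" if "executed prog c = Some i" for i
    using assms(1)[OF that] by (rule mem_act_iff)
  moreover have "r \<notin> push i" if "executed prog l = Some i" for i
    using assms(2)[OF that] push_subset_writes by blast
  ultimately show ?thesis by (auto simp: next_marks_def split: option.splits)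
qed

lemma next_head_Absent:
  assumes "\<not> running prog l"
    and "running prog c \<or> received_head r = Absent \<and>
      (head c = Absent \<or> (\<exists>a b. head c = Inward a b) \<and> region l \<noteq> Outside)"
  shows "next_head prog l c r = Absent"
  using assms by (auto simp: next_head_def running_def)

lemma next_head_Outward:
  "next_head prog l c r = Outward a \<Longrightarrow> region l \<noteq> Outside \<Longrightarrow> running prog l"
  by (auto simp: next_head_def received_head_def split: head.splits if_splits)

locale machine_automaton =
  fixes prog :: "instr list"
  assumes prog_nonempty: "0 < length prog"
begin

abbreviation "step \<equiv> half_step prog"
abbreviation "instruction \<equiv> fetch prog"

definition settled :: "nat \<Rightarrow> (nat \<Rightarrow> cell) \<Rightarrow> bool" where
  "settled F z \<longleftrightarrow> region (z 0) = Origin \<and> (\<forall>j. 0 < j \<and> j \<le> F \<longrightarrow> region (z j) = Inside)"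

definition located :: "nat \<Rightarrow> nat set \<Rightarrow> registers \<Rightarrow> (nat \<Rightarrow> cell) \<Rightarrow> bool" where
  "located F R s z \<longleftrightarrow> (\<forall>r\<in>R. s r \<le> F \<and> r \<in> marks (z (s r)) \<and> (\<forall>j<s r. r \<notin> marks (z j)))"

text \<open>\<open>F\<close> steps after the observation starts, the first \<open>F\<close> cells contain no outward head except
  the one emitted by \<open>Origin\<close>: foreign ones were ahead of it and move at the same speed. Hence
  registers whose value is at most \<open>F\<close> are out of reach of the garbage in the initial
  configuration. The flag \<open>sole\<close> states that there are no foreign heads at all.\<close>

definition quiet :: "bool \<Rightarrow> nat \<Rightarrow> nat \<Rightarrow> (nat \<Rightarrow> cell) \<Rightarrow> bool" where
  "quiet sole F i z \<longleftrightarrow> (\<forall>j<i. head (z j) = Absent) \<and> (\<forall>j>i. j \<le> F \<longrightarrow> (\<forall>l. head (z j) \<noteq> Outward l)) \<and>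
    (sole \<longrightarrow> (\<forall>j>i. head (z j) = Absent))"

definition tracks :: "bool \<Rightarrow> nat \<Rightarrow> nat \<Rightarrow> head \<Rightarrow> nat set \<Rightarrow> registers \<Rightarrow> (nat \<Rightarrow> cell) \<Rightarrow> bool" where
  "tracks sole F i h R s z \<longleftrightarrow>
    settled F z \<and> i \<le> F \<and> quiet sole F i z \<and> head (z i) = h \<and> located F R s z"

definition outbound :: "bool \<Rightarrow> nat \<Rightarrow> nat \<Rightarrow> nat \<Rightarrow> nat set \<Rightarrow> registers \<Rightarrow> (nat \<Rightarrow> cell) \<Rightarrow> bool" where
  "outbound sole F i l R s z \<longleftrightarrow>
    tracks sole F i (Outward l) R s z \<and> (\<forall>j<i. \<not> stops (instruction l) (marks (z j)))"

lemma head_step: "head (step z j) = next_head prog (left_cell z j) (z j) (z (Suc j))"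
  by (simp add: half_step_def)

lemma marks_step: "marks (step z j) = next_marks prog (left_cell z j) (z j)"
  by (simp add: half_step_def)

lemma settled_not_Outside: "settled F z \<Longrightarrow> j \<le> F \<Longrightarrow> region (z j) \<noteq> Outside"
  unfolding settled_def by (cases j) auto

lemma settled_step:
  assumes "settled F z"
  shows "settled (Suc F) (step z)"
proof -
  have "region (step z (Suc j)) = Inside" if "j \<le> F" for j
    using settled_not_Outside[OF assms that] by (simp add: half_step_def next_region_def)
  moreover have "region (step z 0) = Origin"
    using assms by (simp add: settled_def half_step_def next_region_def)
  ultimately show ?thesis
    unfolding settled_def by (metis Suc_le_mono gr0_conv_Suc)
qed

lemma left_cell_not_running:
  assumes "\<And>k. j = Suc k \<Longrightarrow> \<not> running prog (z k)"
  shows "\<not> running prog (left_cell z j)"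
  using assms by (cases j) (simp_all add: running_def)

lemma quiet_running: "quiet sole F i z \<Longrightarrow> j \<le> F \<or> sole \<Longrightarrow> running prog (z j) \<Longrightarrow> j = i"
  unfolding quiet_def running_def by (metis head.distinct(1) linorder_neqE_nat)

lemma quiet_left_not_running: "quiet sole F i z \<Longrightarrow> j \<le> i \<Longrightarrow> \<not> running prog (left_cell z j)"
  by (rule left_cell_not_running) (simp add: quiet_def running_def)

lemma quiet_executed: "quiet sole F i z \<Longrightarrow> j \<le> F \<Longrightarrow> j \<noteq> i \<Longrightarrow> executed prog (z j) = None"
  unfolding quiet_def by (metis executed_None_if_not_Outward head.distinct(1) linorder_neqE_nat)

definition next_position :: "nat \<Rightarrow> (nat \<Rightarrow> cell) \<Rightarrow> nat" where
  "next_position i z =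
    (if running prog (z i) then Suc i else case head (z i) of Inward l b \<Rightarrow> i - 1 | _ \<Rightarrow> i)"

lemma next_position_bounds: "next_position i z \<le> Suc i" "i \<le> Suc (next_position i z)"
  by (auto simp: next_position_def split: head.splits)

lemma next_position_cases:
  "running prog (z i) \<Longrightarrow> next_position i z = Suc i"
  "next_position i z = Suc i \<Longrightarrow> running prog (z i)"
  "head (z i) = Inward l b \<Longrightarrow> next_position i z = i - 1"
  "next_position i z < i \<Longrightarrow> \<exists>l b. head (z i) = Inward l b"
  by (auto simp: next_position_def running_def split: head.splits if_splits)

context
  fixes sole F i z
  assumes settled: "settled F z" and position: "i \<le> F" and quiet: "quiet sole F i z"
begin

lemma head_step_below:
  assumes "j < next_position i z"
  shows "head (step z j) = Absent"
proof -
  have "j \<le> i" using assms next_position_bounds(1)[of i z] by simp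
  then have left: "\<not> running prog (left_cell z j)" by (rule quiet_left_not_running[OF quiet])
  show ?thesis
  proof (cases "j = i")
    case True
    then have "running prog (z j)"
      using assms next_position_bounds(1)[of i z] next_position_cases(2)[of i z] by simp
    with left show ?thesis by (simp add: head_step next_head_Absent)
  next
    case False
    then have "j < i" using \<open>j \<le> i\<close> by simp
    have "received_head (z (Suc j)) = Absent"
    proof (cases "Suc j = i")
      case True
      then have "head (z i) \<noteq> Inward a b" for a b
        using next_position_cases(3)[of z i a b] assms by auto
      with True show ?thesis by (auto simp: received_head_def split: head.splits)
    next
      case False
      with quiet \<open>j < i\<close> show ?thesis by (simp add: quiet_def received_head_def)
    qed
    with left quiet \<open>j < i\<close> show ?thesis by (simp add: head_step next_head_Absent quiet_def)
  qed
qed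

lemma head_step_ahead:
  assumes "next_position i z < j" "j \<le> Suc F"
  shows "head (step z j) \<noteq> Outward l"
proof -
  obtain k where j_Suc: "j = Suc k" "k \<le> F" using assms by (cases j) auto
  then have "\<not> running prog (z k)"
    using quiet_running[OF quiet, of k] next_position_cases(1)[of z i] assms(1) by auto
  with j_Suc show ?thesis
    using next_head_Outward[of prog "z k"] settled_not_Outside[OF settled] by (auto simp: head_step)
qed

lemma head_step_ahead_sole:
  assumes sole "next_position i z < j"
  shows "head (step z j) = Absent"
proof -
  obtain k where j_Suc: "j = Suc k" using assms(2) by (cases j) auto
  have "i \<le> j" using assms(2) next_position_bounds(2)[of i z] by simp
  have "\<not> running prog (z k)"
    using quiet_running[OF quiet, of k] next_position_cases(1)[of z i] assms j_Suc by auto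
  moreover have "received_head (z (Suc j)) = Absent"
    using quiet \<open>sole\<close> \<open>i \<le> j\<close> by (simp add: quiet_def received_head_def)
  moreover have "head (z j) = Absent \<or> (\<exists>a b. head (z j) = Inward a b) \<and> region (z k) \<noteq> Outside"
    using quiet assms \<open>i \<le> j\<close> next_position_cases(4)[of i z] j_Suc position
      settled_not_Outside[OF settled, of k]
    by (cases "i = j") (auto simp: quiet_def)
  ultimately show ?thesis by (simp add: head_step j_Suc next_head_Absent)
qed

lemma quiet_step: "quiet sole (Suc F) (next_position i z) (step z)"
  unfolding quiet_def using head_step_below head_step_ahead head_step_ahead_sole by blast

end

lemma mem_marks_step_iff:
  assumes "\<And>i. executed prog (z j) = Some i \<Longrightarrow> r \<notin> writes i"
    and "\<And>k i. j = Suc k \<Longrightarrow> executed prog (z k) = Some i \<Longrightarrow> r \<notin> writes i"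
  shows "r \<in> marks (step z j) \<longleftrightarrow> r \<in> marks (z j)"
proof -
  have "executed prog (left_cell z j) = Some i \<Longrightarrow> r \<notin> writes i" for i
    using assms(2) by (cases j) (simp_all add: executed_def)
  then show ?thesis using assms(1) by (simp add: marks_step mem_next_marks_iff)
qed

lemma marks_step_unexecuted:
  assumes "\<And>k. k \<le> j \<Longrightarrow> executed prog (z k) = None"
  shows "marks (step z j) = marks (z j)"
  using assms by (intro set_eqI mem_marks_step_iff) auto

lemma tracks_unexecuted:
  assumes "tracks sole F i h R s z" "executed prog (z i) = None" "k \<le> F"
  shows "executed prog (z k) = None"
  using assms quiet_executed[of sole F i z k] by (cases "k = i") (auto simp: tracks_def)

lemma tracks_step:
  assumes tracks: "tracks sole F i h R s z" and unexecuted: "executed prog (z i) = None"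
    and head: "head (step z (next_position i z)) = h'"
  shows "tracks sole (Suc F) (next_position i z) h' R s (step z)"
proof -
  have "marks (step z j) = marks (z j)" if "j \<le> F" for j
    using tracks_unexecuted[OF tracks unexecuted] that by (intro marks_step_unexecuted) simp
  then have "located (Suc F) R s (step z)"
    using tracks unfolding tracks_def located_def by (metis le_SucI less_imp_le_nat order_trans)
  then show ?thesis
    using tracks head settled_step quiet_step next_position_bounds(1)[of i z]
    by (auto simp: tracks_def)
qed

lemma advance:
  assumes outbound: "outbound sole F i l R s z"
    and not_stops: "\<not> stops (instruction l) (marks (z i))"
  shows "outbound sole (Suc F) (Suc i) l R s (step z)"
proof -
  have tracks: "tracks sole F i (Outward l) R s z" using outbound by (simp add: outbound_def)
  have running: "running prog (z i)" using tracks not_stops by (simp add: tracks_def running_def)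
  have unexecuted: "executed prog (z i) = None" using running by (rule executed_None_if_running)
  have "head (step z (Suc i)) = Outward l"
    using tracks running settled_not_Outside[of F z i]
    by (simp add: tracks_def head_step next_head_def)
  then have "tracks sole (Suc F) (Suc i) (Outward l) R s (step z)"
    using tracks_step[OF tracks unexecuted]
    by (simp add: next_position_cases(1)[of z i, OF running])
  moreover have "\<not> stops (instruction l) (marks (step z j))" if "j < Suc i" for j
  proof -
    have "marks (step z j) = marks (z j)"
      using tracks_unexecuted[OF tracks unexecuted] tracks that
      by (intro marks_step_unexecuted) (simp add: tracks_def)
    then show ?thesis using outbound not_stops that by (auto simp: outbound_def less_Suc_eq)
  qed
  ultimately show ?thesis by (simp add: outbound_def)
qed

lemma return:
  assumes tracks: "tracks sole F (Suc i) (Inward l b) R s z"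
  shows "tracks sole (Suc F) i (Inward l b) R s (step z)"
proof -
  have "head (z (Suc i)) = Inward l b" using tracks by (simp add: tracks_def)
  moreover have "\<not> running prog (left_cell z i)"
    using tracks quiet_left_not_running[of sole F "Suc i" z] by (simp add: tracks_def)
  moreover have "head (z i) = Absent" using tracks by (simp add: tracks_def quiet_def)
  ultimately have "head (step z i) = Inward l b"
    by (simp add: head_step next_head_def received_head_def)
  moreover have "next_position (Suc i) z = i"
    using next_position_cases(3)[of z "Suc i"] tracks by (simp add: tracks_def)
  moreover have "executed prog (z (Suc i)) = None"
    using tracks by (simp add: executed_def tracks_def)
  ultimately show ?thesis using tracks_step[OF tracks] by simp
qed

lemma emit:
  assumes tracks: "tracks sole F 0 (Inward l b) R s z"
  shows "outbound sole (Suc F) 0 (next_label prog l b) R s (step z)"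
proof -
  have "head (step z 0) = Outward (next_label prog l b)"
    using tracks by (simp add: head_step next_head_def tracks_def settled_def running_def)
  moreover have "next_position 0 z = 0"
    using next_position_cases(3)[of z 0] tracks by (simp add: tracks_def)
  moreover have "executed prog (z 0) = None" using tracks by (simp add: executed_def tracks_def)
  ultimately show ?thesis using tracks_step[OF tracks] by (simp add: outbound_def)
qed

lemma mem_marks_turn_iff:
  assumes quiet: "quiet sole F i z" and executed: "executed prog (z i) = Some k"
    and "r \<notin> writes k" "j \<le> F"
  shows "r \<in> marks (step z j) \<longleftrightarrow> r \<in> marks (z j)"
proof (rule mem_marks_step_iff)
  have only_k: "k' = k" if "executed prog (z j') = Some k'" "j' \<le> F" for j' k'
    using quiet_executed[OF quiet that(2)] executed that(1) by (cases "j' = i") auto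
  then show "r \<notin> writes k'" if "executed prog (z j) = Some k'" for k'
    using assms(3,4) that by blast
  show "r \<notin> writes k'" if "j = Suc j'" "executed prog (z j') = Some k'" for j' k'
    using only_k[OF that(2)] assms(3,4) that(1) by simp
qed

lemma located_turn:
  assumes outbound: "outbound sole F i l R s z" and stops: "stops (instruction l) (marks (z i))"
  shows "located (Suc F) (R \<union> writes (instruction l)) (place (instruction l) i s) (step z)"
proof -
  have located: "located F R s z" and position: "i \<le> F" and quiet: "quiet sole F i z"
    and region: "region (z i) \<noteq> Outside" and executed: "executed prog (z i) = Some (instruction l)"
    and not_stops: "\<And>j. j < i \<Longrightarrow> \<not> stops (instruction l) (marks (z j))"
    using outbound stops settled_not_Outside
    by (auto simp: outbound_def tracks_def executed_eq_Some_iff)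
  have unwritten: "s r \<le> Suc F \<and> r \<in> marks (step z (s r)) \<and> (\<forall>j<s r. r \<notin> marks (step z j))"
    if "r \<in> R" "r \<notin> writes (instruction l)" for r
    using located that(1) mem_marks_turn_iff[OF quiet executed that(2)] by (auto simp: located_def)
  have unexecuted: "executed prog (z j) = None" if "j < i" for j
    using quiet_executed[OF quiet] that position by simp
  have marks_position: "marks (step z i) = act (instruction l) (marks (z i))"
    using executed unexecuted[of "i - 1"]
    by (cases i) (simp_all add: marks_step next_marks_def executed_def)
  have pushed: "push (instruction l) \<subseteq> marks (step z (Suc i))"
    using executed region by (auto simp: marks_step next_marks_def)
  show ?thesis
  proof (cases "instruction l")
    case (Inc r)
    have "r \<notin> marks (step z j)" if "j < Suc i" for j
      using marks_position marks_step_unexecuted[of j z] unexecuted not_stops[of j] Inc that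
      by (cases "j = i") (auto simp: stops_def)
    then show ?thesis using Inc unwritten pushed position by (auto simp: located_def)
  next
    case (Rst r)
    then have "i = 0" using not_stops[of 0] by (cases i) (auto simp: stops_def)
    then show ?thesis using Rst unwritten marks_position by (auto simp: located_def)
  next
    case (Jump g t)
    then show ?thesis using unwritten by (auto simp: located_def)
  qed
qed

lemma turn:
  assumes outbound: "outbound sole F i l R s z" and stops: "stops (instruction l) (marks (z i))"
  shows "tracks sole (Suc F) i (Inward l (answer (instruction l) (marks (z i))))
    (R \<union> writes (instruction l)) (place (instruction l) i s) (step z)"
proof -
  have settled: "settled F z" and position: "i \<le> F" and quiet: "quiet sole F i z"
    and head: "head (z i) = Outward l"
    using outbound by (auto simp: outbound_def tracks_def)
  have not_running: "\<not> running prog (z i)" using head stops by (simp add: running_def)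
  then have "next_position i z = i" using head by (simp add: next_position_def)
  then have "quiet sole (Suc F) i (step z)" using quiet_step[OF settled position quiet] by simp
  moreover have "\<not> running prog (left_cell z i)"
    by (simp add: quiet_left_not_running[OF quiet])
  then have "head (step z i) = Inward l (answer (instruction l) (marks (z i)))"
    using head stops by (simp add: head_step next_head_def)
  ultimately show ?thesis
    using settled_step[OF settled] position located_turn[OF outbound stops]
    by (simp add: tracks_def)
qed

lemma walk:
  assumes "outbound sole F i l R s z"
    and "\<And>m. m < n \<Longrightarrow> \<not> stops (instruction l) (marks ((step ^^ m) z (i + m)))"
  shows "outbound sole (F + n) (i + n) l R s ((step ^^ n) z)"
  using assms(2) by (induction n) (use assms(1) advance in auto)

lemma walk_back:
  assumes "tracks sole F i (Inward l b) R s z" "m \<le> i"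
  shows "tracks sole (F + m) (i - m) (Inward l b) R s ((step ^^ m) z)"
  using assms(2)
proof (induction m)
  case (Suc m)
  then have "tracks sole (F + m) (Suc (i - Suc m)) (Inward l b) R s ((step ^^ m) z)"
    by (simp add: Suc_diff_Suc)
  from return[OF this] show ?case by simp
qed (use assms(1) in simp)

lemma round_trip:
  assumes outbound: "outbound sole F 0 l R s z"
    and not_stops: "\<And>m. m < c \<Longrightarrow> \<not> stops (instruction l) (marks ((step ^^ m) z m))"
    and stops: "stops (instruction l) (marks ((step ^^ c) z c))"
  shows "outbound sole (F + (2 * c + 2)) 0
      (next_label prog l (answer (instruction l) (marks ((step ^^ c) z c))))
      (R \<union> writes (instruction l)) (place (instruction l) c s) ((step ^^ (2 * c + 2)) z)"
    and "0 < m \<Longrightarrow> m < 2 * c + 2 \<Longrightarrow> head ((step ^^ m) z 0) \<noteq> Outward l'"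
proof -
  let ?b = "answer (instruction l) (marks ((step ^^ c) z c))"
  have way_out: "outbound sole (F + n) n l R s ((step ^^ n) z)" if "n \<le> c" for n
    using walk[OF outbound, of n] not_stops that by simp
  have "tracks sole (Suc (F + c)) c (Inward l ?b) (R \<union> writes (instruction l))
      (place (instruction l) c s) ((step ^^ Suc c) z)"
    using turn[OF way_out stops] by simp
  then have way_back: "tracks sole (Suc (F + c) + n) (c - n) (Inward l ?b)
      (R \<union> writes (instruction l)) (place (instruction l) c s)
      ((step ^^ (n + Suc c)) z)" if "n \<le> c" for n
    unfolding funpow_add_apply using walk_back that by blast
  have "outbound sole (Suc (Suc (F + c) + c)) 0 (next_label prog l ?b) (R \<union> writes (instruction l))
      (place (instruction l) c s) ((step ^^ Suc (c + Suc c)) z)"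
    unfolding funpow.simps(2) o_apply by (rule emit) (use way_back[of c] in simp)
  moreover have "Suc (Suc (F + c) + c) = F + (2 * c + 2)" "Suc (c + Suc c) = 2 * c + 2" by simp_all
  ultimately show "outbound sole (F + (2 * c + 2)) 0 (next_label prog l ?b)
      (R \<union> writes (instruction l)) (place (instruction l) c s) ((step ^^ (2 * c + 2)) z)"
    by metis
  assume early: "0 < m" "m < 2 * c + 2"
  show "head ((step ^^ m) z 0) \<noteq> Outward l'"
  proof (cases "m \<le> c")
    case True
    then show ?thesis
      using way_out[OF True] early(1) by (auto simp: outbound_def tracks_def quiet_def)
  next
    case False
    then obtain n where later: "m = n + Suc c" by (metis add.commute le_Suc_ex not_less_eq_eq)
    then have "n \<le> c" using early(2) by simp
    from way_back[OF this] show ?thesis unfolding later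
      by (cases "c - n") (auto simp: tracks_def quiet_def)
  qed
qed

lemma emission_imp_stops:
  assumes outbound: "outbound sole F 0 l R s z"
    and emission: "0 < t" "head ((step ^^ t) z 0) = Outward l'"
  shows "\<exists>c. (\<forall>m<c. \<not> stops (instruction l) (marks ((step ^^ m) z m))) \<and>
    stops (instruction l) (marks ((step ^^ c) z c)) \<and> 2 * c + 2 \<le> t"
proof -
  have "\<exists>c. stops (instruction l) (marks ((step ^^ c) z c))"
  proof (rule ccontr)
    assume "\<nexists>c. stops (instruction l) (marks ((step ^^ c) z c))"
    then have "outbound sole (F + t) t l R s ((step ^^ t) z)" using walk[OF outbound, of t] by simp
    with emission show False by (auto simp: outbound_def tracks_def quiet_def)
  qed
  then obtain c where first_stop: "stops (instruction l) (marks ((step ^^ c) z c))"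
      "\<forall>m<c. \<not> stops (instruction l) (marks ((step ^^ m) z m))"
    using exists_least_iff[of "\<lambda>c. stops (instruction l) (marks ((step ^^ c) z c))"] by blast
  have "\<not> t < 2 * c + 2"
    using round_trip(2)[OF outbound _ first_stop(1), of t l'] first_stop(2) emission by blast
  with first_stop show ?thesis by (intro exI[of _ c]) auto
qed

lemma outbound_mono: "outbound sole F i l R s z \<Longrightarrow> R' \<subseteq> R \<Longrightarrow> outbound sole F i l R' s z"
  by (auto simp: outbound_def tracks_def located_def)

lemma outbound_head: "outbound sole F i l R s z \<Longrightarrow> head (z i) = Outward l"
  by (simp add: outbound_def tracks_def)

text \<open>Every visit to \<open>P\<close> is reached by finitely many of the jumps that preserve \<open>Q\<close>.\<close>

lemma invariant_at_visit:
  assumes "Q a x" "P ((f ^^ t) x)"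
    and jump: "\<And>a x t. Q a x \<Longrightarrow> 0 < t \<Longrightarrow> P ((f ^^ t) x) \<Longrightarrow> \<exists>n. 0 < n \<and> n \<le> t \<and> Q (a + n) ((f ^^ n) x)"
  shows "Q (a + t) ((f ^^ t) x)"
  using assms(1,2)
proof (induction t arbitrary: a x rule: less_induct)
  case (less t)
  show ?case
  proof (cases "t = 0")
    case True
    with less.prems show ?thesis by simp
  next
    case False
    then obtain n where first_jump: "0 < n" "n \<le> t" "Q (a + n) ((f ^^ n) x)"
      using jump less.prems by blast
    then have "(f ^^ (t - n)) ((f ^^ n) x) = (f ^^ t) x" by (simp flip: funpow_add_apply)
    with less.IH[of "t - n" "a + n" "(f ^^ n) x"] first_jump less.prems(2) show ?thesis by simp
  qed
qed

lemma outbound_at_emission: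
  assumes "outbound sole F 0 l R s z" "head ((step ^^ t) z 0) = Outward l'"
  shows "\<exists>s'. outbound sole (F + t) 0 l' {} s' ((step ^^ t) z)"
proof -
  have "\<exists>l R s. outbound sole (F + t) 0 l R s ((step ^^ t) z)"
  proof (rule invariant_at_visit[where Q = "\<lambda>F z. \<exists>l R s. outbound sole F 0 l R s z"
        and P = "\<lambda>z. head (z 0) = Outward l'"])
    fix F z t assume "\<exists>l R s. outbound sole F 0 l R s z" "0 < t"
      and emission: "head ((step ^^ t) z 0) = Outward l'"
    then obtain l R s where outbound: "outbound sole F 0 l R s z" by blast
    from emission_imp_stops[OF this \<open>0 < t\<close> emission] obtain c
      where first_stop: "\<forall>m<c. \<not> stops (instruction l) (marks ((step ^^ m) z m))"
        "stops (instruction l) (marks ((step ^^ c) z c))" "2 * c + 2 \<le> t" by blast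
    with round_trip(1)[OF outbound] show
      "\<exists>n. 0 < n \<and> n \<le> t \<and> (\<exists>l R s. outbound sole (F + n) 0 l R s ((step ^^ n) z))"
      by (intro exI[of _ "2 * c + 2"]) auto
  qed (use assms in auto)
  then obtain l'' R' s' where "outbound sole (F + t) 0 l'' R' s' ((step ^^ t) z)" by blast
  moreover from outbound_head[OF this] assms(2) have "l'' = l'" by simp
  ultimately show ?thesis using outbound_mono by blast
qed

end

locale register_automaton = machine_automaton +
  fixes V :: "nat set"
  assumes reads_V: "i \<in> set prog \<Longrightarrow> reads i \<subseteq> V"
    and writes_V: "i \<in> set prog \<Longrightarrow> writes i \<subseteq> V"
    and oracle_V: "2 \<notin> V"
begin

definition oracle_track :: "(nat \<Rightarrow> cell) \<Rightarrow> nat set" where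
  "oracle_track z = {j. 2 \<in> marks (z j)}"

lemma reads_instruction: "reads (instruction l) \<subseteq> V"
  using reads_V[of "prog ! l"] by (simp add: fetch_def)

lemma writes_instruction: "writes (instruction l) \<subseteq> V"
  using writes_V[of "prog ! l"] by (simp add: fetch_def)

lemma oracle_track_funpow: "oracle_track ((step ^^ n) z) = oracle_track z"
proof (induction n)
  case (Suc n)
  have "2 \<notin> writes i" if "executed prog c = Some i" for i c
    using that writes_instruction oracle_V by (auto simp: executed_eq_Some_iff)
  then have "oracle_track (step z) = oracle_track z" for z
    unfolding oracle_track_def by (intro Collect_cong mem_marks_step_iff)
  with Suc show ?case by simp
qed simp

lemma register_visible:
  assumes "outbound sole F i l V s z" "r \<in> V"
  shows "r \<in> marks (z (s r))" "j < s r \<Longrightarrow> r \<notin> marks (z j)"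
  using assms by (auto simp: outbound_def tracks_def located_def)

lemma stops_if_reads: "r \<in> reads i \<Longrightarrow> r \<in> S \<Longrightarrow> stops i S"
  by (auto simp: stops_def)

lemma ex_first_stop:
  assumes outbound: "outbound sole F 0 l V s z"
  shows "\<exists>c. (\<forall>m<c. \<not> stops (instruction l) (marks ((step ^^ m) z m))) \<and>
    stops (instruction l) (marks ((step ^^ c) z c))"
proof -
  have "\<exists>c. stops (instruction l) (marks ((step ^^ c) z c))"
  proof (rule ccontr)
    assume never: "\<nexists>c. stops (instruction l) (marks ((step ^^ c) z c))"
    then have outbound_later: "outbound sole (F + n) n l V s ((step ^^ n) z)" for n
      using walk[OF outbound, of n] by simp
    obtain r where read: "r \<in> reads (instruction l)" using never by (auto simp: stops_def)
    then have "r \<in> marks ((step ^^ Suc (s r)) z (s r))"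
      using register_visible(1)[OF outbound_later] reads_instruction by blast
    moreover have "\<not> stops (instruction l) (marks ((step ^^ Suc (s r)) z (s r)))"
      using outbound_later[of "Suc (s r)"] unfolding outbound_def by blast
    ultimately show False using stops_if_reads[OF read] by blast
  qed
  then show ?thesis
    using exists_least_iff[of "\<lambda>c. stops (instruction l) (marks ((step ^^ c) z c))"] by blast
qed

lemma answer_place_eq_machine:
  assumes outbound: "outbound sole F c l V s z" and stops: "stops (instruction l) (marks (z c))"
  shows "answer (instruction l) (marks (z c)) = jumps (oracle_track z) (instruction l) s"
    and "place (instruction l) c s = update (instruction l) s"
proof -
  have at_c: "r \<in> marks (z c) \<longleftrightarrow> s r = c" and "c \<le> s r" if "r \<in> reads (instruction l)" for r
  proof -
    have tracked: "r \<in> V" using that reads_instruction by blast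
    have "\<not> s r < c"
      using outbound stops_if_reads[OF that register_visible(1)[OF outbound tracked]]
      by (auto simp: outbound_def)
    then show "c \<le> s r" by simp
    then show "r \<in> marks (z c) \<longleftrightarrow> s r = c"
      using register_visible[OF outbound tracked] by (metis le_neq_implies_less)
  qed
  then show "answer (instruction l) (marks (z c)) = jumps (oracle_track z) (instruction l) s"
    using stops
    by (cases "(instruction l, marks (z c))" rule: answer.cases)
      (auto simp: stops_def oracle_track_def)
  show "place (instruction l) c s = update (instruction l) s"
    using at_c stops by (cases "instruction l") (auto simp: stops_def)
qed

lemma simulate_step:
  assumes outbound: "outbound sole F 0 l V s z" and label: "l < length prog"
  defines "\<sigma> \<equiv> machine_step prog (oracle_track z) (l, s)"
  shows "\<exists>n>0. outbound sole (F + n) 0 (fst \<sigma>) V (snd \<sigma>) ((step ^^ n) z) \<and>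
    (\<forall>m l'. 0 < m \<and> m < n \<longrightarrow> head ((step ^^ m) z 0) \<noteq> Outward l')"
proof -
  obtain c where not_stops: "\<And>m. m < c \<Longrightarrow> \<not> stops (instruction l) (marks ((step ^^ m) z m))"
    and stops: "stops (instruction l) (marks ((step ^^ c) z c))"
    using ex_first_stop[OF outbound] by blast
  have "outbound sole (F + c) c l V s ((step ^^ c) z)"
    using walk[OF outbound, of c] not_stops by simp
  note effect = answer_place_eq_machine[OF this stops, unfolded oracle_track_funpow]
  have "V \<union> writes (instruction l) = V" using writes_instruction[of l] by blast
  moreover have "prog ! l = instruction l" using label by (simp add: fetch_def)
  ultimately have "outbound sole (F + (2 * c + 2)) 0 (fst \<sigma>) V (snd \<sigma>) ((step ^^ (2 * c + 2)) z)"
    using round_trip(1)[OF outbound not_stops stops] effect by (simp add: \<sigma>_def machine_step_def)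
  with round_trip(2)[OF outbound not_stops stops] show ?thesis by (intro exI[of _ "2 * c + 2"]) auto
qed

lemma fst_machine_step_less: "fst c < length prog \<Longrightarrow>
    fst ((machine_step prog A ^^ k) c) < length prog"
  by (induction k) (auto simp: machine_step_def next_label_less[OF prog_nonempty])

lemma simulate:
  assumes "outbound sole F 0 l V s z" "l < length prog"
  defines "\<sigma> k \<equiv> (machine_step prog (oracle_track z) ^^ k) (l, s)"
  shows "\<exists>n\<ge>k. outbound sole (F + n) 0 (fst (\<sigma> k)) V (snd (\<sigma> k)) ((step ^^ n) z)"
proof (induction k)
  case 0
  then show ?case using assms by (intro exI[of _ 0]) (auto simp: \<sigma>_def)
next
  case (Suc k)
  then obtain n where simulated: "n \<ge> k"
    "outbound sole (F + n) 0 (fst (\<sigma> k)) V (snd (\<sigma> k)) ((step ^^ n) z)" by blast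
  have "fst (\<sigma> k) < length prog" using fst_machine_step_less assms(2) by (simp add: \<sigma>_def)
  from simulate_step[OF simulated(2) this] obtain m where simulated_step: "m > 0"
    "outbound sole (F + n + m) 0 (fst (\<sigma> (Suc k))) V (snd (\<sigma> (Suc k)))
        ((step ^^ m) ((step ^^ n) z))"
    by (auto simp: \<sigma>_def oracle_track_funpow)
  then have "outbound sole (F + (m + n)) 0 (fst (\<sigma> (Suc k))) V (snd (\<sigma> (Suc k)))
      ((step ^^ (m + n)) z)"
    by (simp add: funpow_add_apply ac_simps)
  then show ?case using simulated_step(1) simulated(1) by (intro exI[of _ "m + n"]) auto
qed

lemma emission_imp_label:
  assumes "outbound sole F 0 l V s z" "l < length prog" "head ((step ^^ t) z 0) = Outward l'"
  shows "\<exists>k. fst ((machine_step prog (oracle_track z) ^^ k) (l, s)) = l'"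
proof -
  define \<sigma> where "\<sigma> k = (machine_step prog (oracle_track z) ^^ k) (l, s)" for k
  define simulated where
    "simulated F y \<longleftrightarrow> oracle_track y = oracle_track z \<and>
        (\<exists>k. outbound sole F 0 (fst (\<sigma> k)) V (snd (\<sigma> k)) y)" for F y
  have "simulated (F + t) ((step ^^ t) z)"
  proof (rule invariant_at_visit[where P = "\<lambda>z. head (z 0) = Outward l'"])
    fix F y t assume "simulated F y" "0 < t" and emission: "head ((step ^^ t) y 0) = Outward l'"
    then obtain k where track: "oracle_track y = oracle_track z"
      and state: "outbound sole F 0 (fst (\<sigma> k)) V (snd (\<sigma> k)) y" unfolding simulated_def by blast
    have "fst (\<sigma> k) < length prog" using fst_machine_step_less assms(2) by (simp add: \<sigma>_def)
    from simulate_step[OF state this] obtain n where next_state: "n > 0"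
      "outbound sole (F + n) 0 (fst (\<sigma> (Suc k))) V (snd (\<sigma> (Suc k))) ((step ^^ n) y)"
      "\<And>m l'. 0 < m \<Longrightarrow> m < n \<Longrightarrow> head ((step ^^ m) y 0) \<noteq> Outward l'"
      by (auto simp: \<sigma>_def track)
    then have "n \<le> t" using \<open>0 < t\<close> emission not_le_imp_less by blast
    with next_state(1,2) track show "\<exists>n. 0 < n \<and> n \<le> t \<and> simulated (F + n) ((step ^^ n) y)"
      unfolding simulated_def oracle_track_funpow by blast
  next
    have "outbound sole F 0 (fst (\<sigma> 0)) V (snd (\<sigma> 0)) z" using assms(1) by (simp add: \<sigma>_def)
    then show "simulated F z" unfolding simulated_def by blast
  qed (rule assms(3))
  then obtain k where "outbound sole (F + t) 0 (fst (\<sigma> k)) V (snd (\<sigma> k)) ((step ^^ t) z)"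
    unfolding simulated_def by blast
  from outbound_head[OF this] assms(3) show ?thesis by (auto simp: \<sigma>_def)
qed

lemma recurs_label_if_recurs_emission:
  assumes "outbound sole F 0 l V s z" "l < length prog"
    "recurs (\<lambda>z. head (z 0) = Outward l') step z"
  shows "recurs (\<lambda>c. fst c = l') (machine_step prog (oracle_track z)) (l, s)"
  unfolding recurs_def
proof
  fix n
  let ?f = "machine_step prog (oracle_track z)"
  let ?\<sigma> = "(?f ^^ n) (l, s)"
  obtain m where simulated: "outbound sole (F + m) 0 (fst ?\<sigma>) V (snd ?\<sigma>) ((step ^^ m) z)"
    using simulate[OF assms(1,2)] by blast
  have "recurs (\<lambda>z. head (z 0) = Outward l') step ((step ^^ m) z)"
    by (simp only: recurs_funpow assms(3))
  then obtain t where "head ((step ^^ t) ((step ^^ m) z) 0) = Outward l'" by (rule recursE)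
  from emission_imp_label[OF simulated _ this] fst_machine_step_less assms(2)
  obtain k where "fst ((?f ^^ k) ?\<sigma>) = l'" by (auto simp: oracle_track_funpow)
  then show "\<exists>k\<ge>n. fst ((?f ^^ k) (l, s)) = l'"
    by (intro exI[of _ "k + n"]) (simp add: funpow_add_apply)
qed

end

section \<open>Half-lines in the cellular automaton\<close>

definition heads :: "nat \<Rightarrow> head set" where
  "heads L = {Absent} \<union> Outward ` {..<L} \<union> case_prod Inward ` ({..<L} \<times> UNIV)"

definition cells :: "nat \<Rightarrow> nat \<Rightarrow> cell set" where
  "cells K L = {c. marks c \<subseteq> {..<K} \<and> head c \<in> heads L}"

lemma mem_heads_simps [simp]:
  "Absent \<in> heads L" "Outward l \<in> heads L \<longleftrightarrow> l < L" "Inward l b \<in> heads L \<longleftrightarrow> l < L"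
  by (auto simp: heads_def)

lemma finite_cells: "finite (cells K L)"
proof -
  have "(UNIV :: region set) = {Outside, Origin, Inside}" using region.exhaust by auto
  then have "finite (UNIV :: region set)" by (metis finite.simps)
  then have "finite ((\<lambda>(t, S, h). Cell t S h) ` (UNIV \<times> Pow {..<K} \<times> heads L))"
    by (simp add: heads_def)
  moreover have "cells K L \<subseteq> (\<lambda>(t, S, h). Cell t S h) ` (UNIV \<times> Pow {..<K} \<times> heads L)"
  proof
    fix c assume "c \<in> cells K L"
    then show "c \<in> (\<lambda>(t, S, h). Cell t S h) ` (UNIV \<times> Pow {..<K} \<times> heads L)"
      by (intro image_eqI[of _ _ "(region c, marks c, head c)"]) (auto simp: cells_def)
  qed
  ultimately show ?thesis by (rule rev_finite_subset)
qed

lemma cell_rule_Outside: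
  "region l = Outside \<Longrightarrow> region l' = Outside \<Longrightarrow> cell_rule prog l c r = cell_rule prog l' c r"
  by (auto simp: cell_rule_def next_region_def next_marks_def next_head_def
      split: option.splits head.splits)

abbreviation line_step :: "instr list \<Rightarrow> (int \<Rightarrow> cell) \<Rightarrow> int \<Rightarrow> cell" where
  "line_step prog \<equiv> radius1 (cell_rule prog)"

lemma right_half_line_step:
  assumes "region (y (- 1)) = Outside"
  shows "right_half (line_step prog y) = half_step prog (right_half y)"
proof
  fix j
  show "right_half (line_step prog y) j = half_step prog (right_half y) j"
  proof (cases j)
    case 0
    then show ?thesis
      using cell_rule_Outside[OF assms] by (simp add: right_half_def radius1_def half_step_def)
  next
    case (Suc k)
    then show ?thesis by (simp add: right_half_def radius1_def half_step_def add.commute)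
  qed
qed

lemma right_half_funpow:
  assumes "\<And>t. region ((line_step prog ^^ t) y (- 1)) = Outside"
  shows "right_half ((line_step prog ^^ t) y) = (half_step prog ^^ t) (right_half y)"
  by (induction t) (simp_all add: right_half_line_step assms)

lemma region_line_step_Origin:
  assumes "region (line_step prog y i) = Origin"
  shows "region (y i) = Origin" "region (y (i - 1)) = Outside"
  using assms by (auto simp: radius1_def next_region_def split: if_splits)

lemma region_left_of_recurrent_Origin:
  assumes "recurs (\<lambda>y. region (y i) = Origin) (line_step prog) y"
  shows "region ((line_step prog ^^ t) y (i - 1)) = Outside"
proof -
  obtain u where later: "Suc t \<le> u" "region ((line_step prog ^^ u) y i) = Origin"
    using assms by (rule recursE)
  have "region ((line_step prog ^^ (t + d)) y i) = Origin \<Longrightarrow>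
      region ((line_step prog ^^ t) y i) = Origin" for t d
    by (induction d) (auto dest: region_line_step_Origin(1))
  from this[of "Suc t" "u - Suc t"] later have
    "region (line_step prog ((line_step prog ^^ t) y) i) = Origin" by simp
  then show ?thesis by (rule region_line_step_Origin(2))
qed

section \<open>Hardness\<close>

lemma used_pterm_com: "used (pterm_com t d) \<subseteq> {0, 3, 4} \<union> {d..}"
  by (induction t arbitrary: d) (fastforce simp: unpair_com_def)+

lemma used_formula_com: "used (formula_com f d) \<subseteq> {0, 3, 4} \<union> {d..}"
proof (induction f arbitrary: d)
  case (Eq a b)
  then show ?case using used_pterm_com[of a d] used_pterm_com[of b "d + 1"] by fastforce
next
  case (In a)
  then show ?case using used_pterm_com[of a d] by fastforce
next
  case (Nand f g)
  then show ?case by fastforce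
qed

lemma compile_registers: "i \<in> set (compile c l) \<Longrightarrow> reads i \<union> writes i \<subseteq> used c"
  by (induction c arbitrary: l) (fastforce simp: Let_def)+

lemma used_search_com: "used (search_com \<phi>) \<subseteq> {..<register_bound \<phi>} - {2}"
proof -
  have "2 \<notin> used (search_com \<phi>)" using used_formula_com[of \<phi> 5] by (auto simp: search_com_def)
  then show ?thesis
    using Max_ge[OF finite_used[of "search_com \<phi>"]]
    by (auto simp: register_bound_def less_Suc_eq_le)
qed

lemma register_bound_ge: "7 \<le> register_bound \<phi>"
proof -
  have "6 \<in> used (search_com \<phi>)" by (simp add: search_com_def)
  then show ?thesis using used_search_com[of \<phi>] by fastforce
qed

lemma used_clean_com: "used (clean_com \<phi>) \<subseteq> {..<register_bound \<phi>} - {2}"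
proof -
  have "used (block (map (\<lambda>r. Copy r 0) rs)) \<subseteq> {0} \<union> set rs" for rs :: "nat list"
    by (induction rs) auto
  from this[of "[3..<register_bound \<phi>]"] show ?thesis
    using register_bound_ge[of \<phi>] by (fastforce simp: clean_com_def)
qed

lemma main_prog_registers:
  assumes "i \<in> set (main_prog \<phi>)"
  shows "reads i \<union> writes i \<subseteq> {..<register_bound \<phi>} - {2}"
proof -
  from assms consider (search) "i \<in> set (compile (search_com \<phi>) 3)"
    | (clean) l where "i \<in> set (compile (clean_com \<phi>) l)"
    | (control) "reads i \<union> writes i \<subseteq> {1, 3, 4, 5, 6}"
    unfolding main_prog_def Let_def by auto
  then show ?thesis
  proof cases
    case search
    then show ?thesis using compile_registers used_search_com by blast
  next
    case clean
    then show ?thesis using compile_registers used_clean_com by blast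
  next
    case control
    then show ?thesis using register_bound_ge[of \<phi>] by fastforce
  qed
qed

locale recurrent_automaton =
  fixes \<phi> :: formula
begin

abbreviation "prog \<equiv> main_prog \<phi>"
abbreviation "K \<equiv> register_bound \<phi>"
abbreviation "V \<equiv> {..<K} - {2}"
abbreviation "D \<equiv> {..<K} - {1, 2}"
abbreviation "alphabet \<equiv> cells K (length prog)"

lemma length_prog: "1 < length prog"
  by (simp add: main_prog_def Let_def)

sublocale register_automaton prog V
  by unfold_locales (use length_prog main_prog_registers[of _ \<phi>] in auto)

sublocale coding: finite_local_rule alphabet "cell_rule prog"
proof
  show "finite alphabet" by (rule finite_cells)
  have "Cell Outside {} Absent \<in> alphabet" by (simp add: cells_def)
  then show "alphabet \<noteq> {}" by blast
  fix l c r assume cells: "l \<in> alphabet" "c \<in> alphabet" "r \<in> alphabet"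
  have "act (instruction i) S \<subseteq> {..<K}" "push (instruction i) \<subseteq> {..<K}" if "S \<subseteq> {..<K}" for i S
    using writes_instruction[of i] that by (cases "instruction i"; auto)+
  then have "next_marks prog l c \<subseteq> {..<K}"
    using cells
    by (auto simp: next_marks_def cells_def executed_eq_Some_iff
        split: option.splits if_splits; blast)
  moreover have "next_label prog i b < length prog" for i b
    by (rule next_label_less[OF prog_nonempty])
  then have "next_head prog l c r \<in> heads (length prog)"
    using cells by (auto simp: next_head_def received_head_def cells_def split: head.splits)
  ultimately show "cell_rule prog l c r \<in> alphabet" by (simp add: cells_def)
qed

text \<open>At label 0 all registers except the bound in register 1 equal the input \<open>Suc N\<close>, so that the
  first \<open>N + 2\<close> cells do not depend on the oracle, whose marks start after them.\<close>

definition pattern :: "nat \<Rightarrow> cell list" where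
  "pattern N = Cell Origin {} (Outward 0) # replicate N (Cell Inside {} Absent) @
      [Cell Inside D Absent]"

lemma has_prefix_pattern_iff:
  "has_prefix (pattern N) z \<longleftrightarrow> z 0 = Cell Origin {} (Outward 0) \<and>
    (\<forall>j. 0 < j \<and> j \<le> N \<longrightarrow> z j = Cell Inside {} Absent) \<and> z (Suc N) = Cell Inside D Absent"
proof -
  have "has_prefix (pattern N) z \<longleftrightarrow>
      z 0 = Cell Origin {} (Outward 0) \<and> (\<forall>j<Suc N. z (Suc j) = pattern N ! Suc j)"
    by (simp add: has_prefix_def pattern_def All_less_Suc2)
  then show ?thesis
    by (auto simp: pattern_def nth_append less_Suc_eq gr0_conv_Suc Suc_le_eq)
qed

lemma pattern_in_alphabet: "pattern N \<in> lists alphabet"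
  using length_prog by (auto simp: pattern_def cells_def)

lemma ex_half_line_recurs_pattern:
  assumes "recurs (\<lambda>y. has_prefix (pattern N) (right_half y)) (line_step prog) y"
  shows "\<exists>z. has_prefix (pattern N) z \<and> recurs (has_prefix (pattern N)) step z"
proof -
  obtain t where shown: "has_prefix (pattern N) (right_half ((line_step prog ^^ t) y))"
    using assms by (rule recursE)
  define y' where "y' = (line_step prog ^^ t) y"
  have recurs: "recurs (\<lambda>y. has_prefix (pattern N) (right_half y)) (line_step prog) y'"
    unfolding y'_def recurs_funpow by (rule assms)
  then have "recurs (\<lambda>y. region (y 0) = Origin) (line_step prog) y'"
    by (rule recurs_mono) (simp add: has_prefix_pattern_iff right_half_def)
  from region_left_of_recurrent_Origin[OF this]
  have "right_half ((line_step prog ^^ t) y') = (step ^^ t) (right_half y')" for t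
    by (intro right_half_funpow) simp
  then have "recurs (has_prefix (pattern N)) step (right_half y')"
    using recurs by (simp add: recurs_def)
  then show ?thesis using shown unfolding y'_def by blast
qed

lemma recurs_emission_if_pattern:
  "recurs (has_prefix (pattern N)) step z \<Longrightarrow> recurs (\<lambda>z. head (z 0) = Outward 0) step z"
  by (erule recurs_mono) (simp add: has_prefix_pattern_iff)

lemma ex_outbound_at_label_0:
  assumes "has_prefix (pattern N) z" "recurs (has_prefix (pattern N)) step z"
  shows "\<exists>F z'. outbound False F 0 0 D (\<lambda>_. Suc N) z' \<and> recurs (\<lambda>z. head (z 0) = Outward 0) step z'"
proof -
  have "outbound False 0 0 0 {} (\<lambda>_. 0) z"
    using assms(1)
    by (auto simp: has_prefix_pattern_iff outbound_def tracks_def settled_def quiet_def located_def)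
  moreover obtain t where shown: "Suc N \<le> t" "has_prefix (pattern N) ((step ^^ t) z)"
    using assms(2) by (rule recursE)
  moreover from shown have "head ((step ^^ t) z 0) = Outward 0"
    by (simp add: has_prefix_pattern_iff)
  ultimately obtain s where outbound: "outbound False t 0 0 {} s ((step ^^ t) z)"
    using outbound_at_emission[of False 0 0 "{}" _ z t 0] by auto
  have "r \<notin> marks ((step ^^ t) z j)" if "j < Suc N" "r \<in> D" for j r
    using shown(2) that by (cases "j = 0") (auto simp: has_prefix_pattern_iff)
  then have "located t D (\<lambda>_. Suc N) ((step ^^ t) z)"
    using shown by (auto simp: located_def has_prefix_pattern_iff)
  then have "outbound False t 0 0 D (\<lambda>_. Suc N) ((step ^^ t) z)"
    using outbound by (simp add: outbound_def tracks_def)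
  moreover have "recurs (\<lambda>z. head (z 0) = Outward 0) step ((step ^^ t) z)"
    unfolding recurs_funpow by (rule recurs_emission_if_pattern[OF assms(2)])
  ultimately show ?thesis by blast
qed

lemma ex_outbound_at_label_1:
  assumes outbound: "outbound False F 0 0 D (\<lambda>_. Suc N) z"
    and recurs: "recurs (\<lambda>z. head (z 0) = Outward 0) step z"
  shows "\<exists>F s z'. outbound False F 0 1 V s z' \<and> s 0 = Suc N \<and>
      recurs (\<lambda>z. head (z 0) = Outward 0) step z'"
proof -
  have first_instruction: "instruction 0 = Inc 1"
    using length_prog by (simp add: fetch_def main_prog_def Let_def)
  obtain t where "1 \<le> t" "head ((step ^^ t) z 0) = Outward 0" using recurs by (rule recursE)
  then obtain c where first_stop: "\<And>m. m < c \<Longrightarrow> \<not> stops (instruction 0) (marks ((step ^^ m) z m))"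
    "stops (instruction 0) (marks ((step ^^ c) z c))"
    using emission_imp_stops[OF outbound, of t 0] by auto
  have "next_label prog 0 False = 1" using length_prog by (simp add: next_label_def)
  moreover have "D \<union> {1} = V" using register_bound_ge[of \<phi>] by auto
  ultimately have "outbound False (F + (2 * c + 2)) 0 1 V ((\<lambda>_. Suc N)(1 := Suc c))
      ((step ^^ (2 * c + 2)) z)"
    using round_trip(1)[OF outbound first_stop] by (simp add: first_instruction)
  moreover have "recurs (\<lambda>z. head (z 0) = Outward 0) step ((step ^^ (2 * c + 2)) z)"
    unfolding recurs_funpow by (rule recurs)
  ultimately show ?thesis by (metis fun_upd_other zero_neq_one)
qed

lemma sat_if_recurs_pattern:
  assumes "recurs (\<lambda>y. has_prefix (pattern N) (right_half y)) (line_step prog) y"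
  shows "\<exists>T. \<forall>m. \<exists>l. sat T (Suc N) m l \<phi>"
proof -
  obtain F s z where outbound: "outbound False F 0 1 V s z" and input: "s 0 = Suc N"
    and recurs: "recurs (\<lambda>z. head (z 0) = Outward 0) step z"
    using ex_half_line_recurs_pattern[OF assms] ex_outbound_at_label_0 ex_outbound_at_label_1
    by meson
  interpret program: recurrent_program \<phi> "oracle_track z" "Suc N" .
  have "recurs (\<lambda>c. fst c = 0) program.step (1, s)"
    by (rule recurs_label_if_recurs_emission[OF outbound length_prog recurs])
  from program.holds_if_recurs[of s, OF input this] show ?thesis by blast
qed

definition start_cell :: "nat set \<Rightarrow> nat \<Rightarrow> nat \<Rightarrow> cell" where
  "start_cell T N j = Cell (if j = 0 then Origin else Inside)
    {r. r \<in> D \<and> j = Suc N \<or> r = 1 \<and> j = Suc (Suc N) \<or> r = 2 \<and> (\<exists>c\<in>T. j = c + Suc N + 1)}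
    (if j = 0 then Outward 0 else Absent)"

definition start :: "nat set \<Rightarrow> nat \<Rightarrow> int \<Rightarrow> cell" where
  "start T N i = (if i < 0 then Cell Outside {} Absent else start_cell T N (nat i))"

lemma range_start: "range (start T N) \<subseteq> alphabet"
  using length_prog register_bound_ge[of \<phi>] by (auto simp: start_def start_cell_def cells_def)

lemma right_half_funpow_start:
  "right_half ((line_step prog ^^ t) (start T N)) = (step ^^ t) (start_cell T N)"
proof -
  have "region ((line_step prog ^^ t) (start T N) i) = Outside" if "i < 0" for t i
    using that by (induction t arbitrary: i) (auto simp: radius1_def next_region_def start_def)
  then have "right_half ((line_step prog ^^ t) (start T N)) = (step ^^ t) (right_half (start T N))"
    by (intro right_half_funpow) simp
  also have "right_half (start T N) = start_cell T N"
    by (simp add: fun_eq_iff right_half_def start_def)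
  finally show ?thesis .
qed

lemma outbound_start:
  "outbound True (Suc (Suc N)) 0 0 V ((\<lambda>_. Suc N)(1 := Suc (Suc N))) (start_cell T N)"
  by (auto simp: outbound_def tracks_def settled_def quiet_def located_def start_cell_def)

lemma oracle_track_start: "{e. e + Suc N + 1 \<in> oracle_track (start_cell T N)} = T"
  by (auto simp: oracle_track_def start_cell_def)

lemma has_prefix_pattern_if_outbound:
  assumes outbound: "outbound True F 0 0 V u z" and "Suc N \<le> F"
    and displayed: "\<And>r. r \<in> D \<Longrightarrow> u r = Suc N"
    and bound: "Suc N < u 1" and marks: "\<And>j. marks (z j) \<subseteq> {..<K}"
    and no_oracle: "\<And>j. j \<le> Suc N \<Longrightarrow> 2 \<notin> marks (z j)"
  shows "has_prefix (pattern N) z"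
proof -
  have settled: "settled F z" and quiet: "quiet True F 0 z" and head: "head (z 0) = Outward 0"
    using outbound by (auto simp: outbound_def tracks_def)
  have no_bound: "1 \<notin> marks (z j)" if "j \<le> Suc N" for j
    using register_visible(2)[OF outbound, of 1 j] bound that register_bound_ge[of \<phi>] by auto
  have "marks (z j) = {}" if "j < Suc N" for j
  proof -
    have "r \<notin> marks (z j)" if "r \<in> D" for r
      using register_visible(2)[OF outbound, of r j] displayed[OF that] that \<open>j < Suc N\<close> by simp
    then show ?thesis using marks[of j] no_bound[of j] no_oracle[of j] that by auto
  qed
  moreover have "r \<in> marks (z (Suc N))" if "r \<in> D" for r
    using register_visible(1)[OF outbound, of r] displayed[OF that] that by simp
  then have "marks (z (Suc N)) = D"
    using marks[of "Suc N"] no_bound[of "Suc N"] no_oracle[of "Suc N"] by auto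
  ultimately show ?thesis
    using settled quiet head \<open>Suc N \<le> F\<close>
    by (auto simp: has_prefix_pattern_iff settled_def quiet_def intro!: cell.expand)
qed

lemma recurs_pattern_if_sat:
  assumes witnesses: "\<And>m. \<exists>l. sat T (Suc N) m l \<phi>"
  shows "recurs (\<lambda>y. has_prefix (pattern N) (right_half y)) (line_step prog) (start T N)"
  unfolding recurs_def
proof
  fix n
  let ?z = "start_cell T N"
  let ?s = "(\<lambda>_. Suc N)(1 := Suc (Suc N))"
  interpret program: recurrent_program \<phi> "oracle_track ?z" "Suc N" .
  obtain k u where run: "n \<le> k" "(program.step ^^ k) (0, ?s) = (0, u)" "program.clean u"
    "?s 1 < u 1"
    using program.recurs_if_holds[of ?s n] witnesses unfolding oracle_track_start by auto
  obtain t where simulated: "k \<le> t" "outbound True (Suc (Suc N) + t) 0 0 V u ((step ^^ t) ?z)"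
    using simulate[OF outbound_start[of N T] prog_nonempty, of k] run(2) by auto
  have "has_prefix (pattern N) ((step ^^ t) ?z)"
  proof (rule has_prefix_pattern_if_outbound[OF simulated(2)])
    show "u r = Suc N" if "r \<in> D" for r
      using run(3) that by (cases "r = 0") (auto simp: program.clean_def)
    show "marks ((step ^^ t) ?z j) \<subseteq> {..<K}" for j
      using coding.range_funpow_radius1[OF range_start, of t T N]
      by (auto simp: cells_def right_half_def image_subset_iff simp flip: right_half_funpow_start)
    show "2 \<notin> marks ((step ^^ t) ?z j)" if "j \<le> Suc N" for j
    proof -
      have "j \<notin> oracle_track ?z" using that by (auto simp: oracle_track_def start_cell_def)
      then have "j \<notin> oracle_track ((step ^^ t) ?z)" unfolding oracle_track_funpow .
      then show ?thesis by (simp add: oracle_track_def)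
    qed
  qed (use run(4) in simp_all)
  then show "\<exists>t\<ge>n. has_prefix (pattern N) (right_half ((line_step prog ^^ t) (start T N)))"
    using simulated(1) run(1) by (intro exI[of _ t]) (simp add: right_half_funpow_start)
qed

abbreviation "asymptotic_language \<equiv>
  lang_code (card alphabet) (language (asymptotic_set (card alphabet) (radius1 coding.coded_rule)))"

lemma pattern_code_mem_iff:
  "word_code (card alphabet) (map coding.encode (pattern N)) \<in> asymptotic_language \<longleftrightarrow>
    (\<exists>T. \<forall>m. \<exists>l. sat T (Suc N) m l \<phi>)"
  unfolding coding.lang_code_coded_iff[OF pattern_in_alphabet]
  using sat_if_recurs_pattern recurs_pattern_if_sat range_start by meson

lemma oracle_computable_pattern_code:
  assumes "oracle_computable a F"
  shows "oracle_computable a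
      (\<lambda>C xs. word_code (card alphabet) (map coding.encode (pattern (F C xs))))"
proof -
  let ?k = "card alphabet" and ?blank = "coding.encode (Cell Inside {} Absent)"
    and ?last = "coding.encode (Cell Inside D Absent)"
  define tail_code where "tail_code n = word_code ?k (replicate n ?blank @ [?last])" for n
  have "oracle_computable 1 (\<lambda>C xs. tail_code (xs ! 0))"
    by (rule oracle_computable_primrec[where H = "\<lambda>C xs. tail_code" and N = "\<lambda>C xs. xs ! 0"
          and F = "\<lambda>C xs. Suc ?last" and G = "\<lambda>C xs. Suc ?blank + ?k * (xs ! 0)"])
      (auto intro!: oracle_computable_intros simp: tail_code_def)
  then have "oracle_computable a (\<lambda>C xs. tail_code (F C xs))"
    using assms by (rule oracle_computable_compose1)
  then have "oracle_computable a
      (\<lambda>C xs. Suc (coding.encode (Cell Origin {} (Outward 0))) + ?k * tail_code (F C xs))"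
    by (intro oracle_computable_add oracle_computable_mult oracle_computable_const)
  then show ?thesis by (simp add: tail_code_def pattern_def)
qed

end

interpretation universal: recurrent_automaton universal_formula .

lemma many_one_reducible_universal:
  assumes "sigma11 P"
  shows "many_one_reducible P universal.asymptotic_language"
proof -
  obtain R e where decides: "\<And>C m l w. reval C e [m, l, w] (if R C m l w then 1 else 0)"
    and membership: "\<And>w. w \<in> P \<longleftrightarrow> (\<exists>C. \<forall>m. \<exists>l. R C m l w)"
    using assms unfolding sigma11_def recursive_pred_def by blast
  define g where "g w = word_code (card universal.alphabet)
    (map universal.coding.encode (universal.pattern (Searches (program_code e) w 0)))" for w
  have "oracle_computable 1 (\<lambda>C xs. g (xs ! 0))"
    unfolding g_def tagged_def
    by (intro universal.oracle_computable_pattern_code oracle_computable_pair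
      oracle_computable_const oracle_computable_nth) simp
  then have "computable g" by (rule computable_if_oracle_computable)
  moreover have "w \<in> P \<longleftrightarrow> g w \<in> universal.asymptotic_language" for w
    unfolding membership recursive_sigma11_iff_supported[OF decides] g_def
      universal.pattern_code_mem_iff supported_iff_universal_formula ..
  ultimately show ?thesis unfolding many_one_reducible_def by blast
qed

lemma sigma11_complete_universal: "sigma11_complete universal.asymptotic_language"
  unfolding sigma11_complete_def
  using universal.coding.coded.sigma11_lang_code_radius1 many_one_reducible_universal by blast

theorem theorem1:
  shows "(\<forall>P. sigma11 P \<longrightarrow>
            (\<exists>k f. cellular_automaton k f \<and>
               many_one_reducible P (lang_code k (language (asymptotic_set k f)))))
       \<and> (\<exists>k f. cellular_automaton k f \<and>
               sigma11_complete (lang_code k (language (asymptotic_set k f))))"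
  using universal.coding.coded.cellular_automaton_radius1 many_one_reducible_universal
    sigma11_complete_universal
  by blast

end
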